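(* Let $n\ge3$ and let $W$ be a continuous rotationally symmetric interaction kernel on $\mathbb S^{n-1}$ with $\hat W_j<0$ for at least one $j\in\mathbb N$. Let $k\in\mathbb N$ be such that $\hat W_k=\min_{l\in\mathbb N}\hat W_l$ and let $N_{\hat W_k}=\{l\in\mathbb N:\hat W_l=\hat W_k\}$. Suppose there is a linear combination $v=\sum_{l\in N_{\hat W_k}}\alpha_lY_{l,0}$ with $\int_{\mathbb S^{n-1}}v^3\,d\sigma\ne0$. Then the free energy functional $\mathcal F_\gamma$ has a discontinuous transition point $\gamma_c$ with $$0<\gamma_c<-\frac1{\min_{l\in\mathbb N}\hat W_l}.$$
   Context: $\mathbb N=\{1,2,\dots\}$. $\sigma$ is the surface measure on $\mathbb S^{n-1}\subset\mathbb R^n$, $\omega_n=\sigma(\mathbb S^{n-1})$, $m=\sigma/\omega_n$, $\langle f,g\rangle_{L_2}=\omega_n^{-1}\int fg\,d\sigma$; $\bar\rho=1/\omega_n$ is the density (w.r.t. $\sigma$) of the uniform measure. Rotationally symmetric means $W(x,y)=W(\langle x,y\rangle)$, $W:[-1,1]\to\mathbb R$. Gegenbauer polynomials: $C_0^\lambda=1$, $C_1^\lambda(t)=2\lambda t$, $(k+2)C_{k+2}^\lambda(t)=2(\lambda+k+1)tC_{k+1}^\lambda(t)-(2\lambda+k)C_k^\lambda(t)$. $$\hat W_k=\frac{\Gamma(\frac n2)}{\sqrt\pi\,\Gamma(\frac{n-1}2)}\int_{-1}^1W(t)\frac{C_k^{\frac{n-2}2}(t)}{C_k^{\frac{n-2}2}(1)}(1-t^2)^{\frac{n-3}2}dt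 ,$$ and $Y_{k,0}(x)=A_kC_k^{\frac{n-2}2}(x_n)$ with $A_k>0$ such that $\|Y_{k,0}\|_{L_2}=1$. Free energy: for $\gamma>0$ and a probability measure $\mu$ on $\mathbb S^{n-1}$, $\mathcal F_\gamma(\mu)=\gamma^{-1}\mathcal E(\mu)+\mathcal I(\mu)$, where $\mathcal E(\mu)=\int\rho\log\rho\,dm$ if $\mu$ has a positive density $\rho$ w.r.t. $m$ and $+\infty$ otherwise, and $\mathcal I(\mu)=\frac12\iint W(x,y)\,d\mu(x)d\mu(y)$. Transition point: $\gamma_c>0$ such that (1) for all $\gamma\in(0,\gamma_c)$ the uniform measure is the unique minimizer of $\mathcal F_\gamma$; (2) the uniform measure is a minimizer of $\mathcal F_{\gamma_c}$; (3) for every $\gamma>\gamma_c$ there is a minimizer of $\mathcal F_\gamma$ with a.e. positive density different from the uniform measure. A transition point is continuous if $\bar\rho$ is the unique minimizer of $\mathcal F_{\gamma_c}$ and for any family of minimizers $\rho_\gamma$ of $\mathcal F_\gamma$, $\gamma>\gamma_c$, one has $\lim_{\gamma\downarrow\gamma_c}\|\rho_\gamma-\bar\rho\|_{L_1}=0$; otherwise it is discontinuous. *)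

theory Defs
  imports "HOL-Probability.Probability"
begin

section \<open>Surface measure\<close>

abbreviation unit_sphere :: "(real^'n) set" where
  "unit_sphere \<equiv> sphere 0 1"

text \<open>The surface measure is introduced through polar coordinates: the measure of a Borel set
  \<open>A\<close> of the sphere is \<open>n\<close> times the Lebesgue measure of the cone
  \<open>{t x | 0 < t \<le> 1, x \<in> A}\<close>.\<close>

definition surface_measure :: "(real^'n) measure" where
  "surface_measure =
     scale_measure (of_nat CARD('n))
       (distr (restrict_space lborel (cball 0 1 - {0})) (restrict_space borel unit_sphere)
         (\<lambda>x. x /\<^sub>R norm x))"

definition sphere_area :: "'n::finite itself \<Rightarrow> real" where
  "sphere_area _ = measure (surface_measure :: (real^'n) measure) unit_sphere"

definition uniform_sphere :: "(real^'n) measure" where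
  "uniform_sphere = scale_measure (ennreal (1 / sphere_area TYPE('n))) surface_measure"

definition L2_inner_sphere :: "(real^'n \<Rightarrow> real) \<Rightarrow> (real^'n \<Rightarrow> real) \<Rightarrow> real" where
  "L2_inner_sphere f g = (1 / sphere_area TYPE('n)) * (LINT x|surface_measure. f x * g x)"

definition L2_norm_sphere :: "(real^'n \<Rightarrow> real) \<Rightarrow> real" where
  "L2_norm_sphere f = sqrt (L2_inner_sphere f f)"


section \<open>Gegenbauer polynomials and zonal harmonics\<close>

fun gegenbauer :: "real \<Rightarrow> nat \<Rightarrow> real \<Rightarrow> real" where
  "gegenbauer a 0 t = 1"
| "gegenbauer a (Suc 0) t = 2 * a * t"
| "gegenbauer a (Suc (Suc k)) t =
     (2 * (a + real k + 1) * t * gegenbauer a (Suc k) t - (2 * a + real k) * gegenbauer a k t)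
       / (real k + 2)"

definition gegenbauer_coeff :: "nat \<Rightarrow> (real \<Rightarrow> real) \<Rightarrow> nat \<Rightarrow> real" where
  "gegenbauer_coeff n W k =
     Gamma (real n / 2) / (sqrt pi * Gamma ((real n - 1) / 2)) *
     (LINT t:{-1..1}|lborel.
        W t * (gegenbauer ((real n - 2) / 2) k t / gegenbauer ((real n - 2) / 2) k 1) *
        (1 - t\<^sup>2) powr ((real n - 3) / 2))"

text \<open>The index type of \<^typ>\<open>real^'n\<close> has no distinguished last element; the coordinate
  \<open>x\<^sub>n\<close> is therefore replaced by \<open>x $ p\<close> for an index \<open>p\<close> that is passed as a parameter.\<close>

definition zonal_const :: "'n::finite \<Rightarrow> nat \<Rightarrow> real" where
  "zonal_const p k =
     (THE A. A > 0 \<and>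
        L2_norm_sphere (\<lambda>x::real^'n. A * gegenbauer ((real CARD('n) - 2) / 2) k (x $ p)) = 1)"

definition zonal_harmonic :: "'n::finite \<Rightarrow> nat \<Rightarrow> real^'n \<Rightarrow> real" where
  "zonal_harmonic p k x = zonal_const p k * gegenbauer ((real CARD('n) - 2) / 2) k (x $ p)"


section \<open>Free energy\<close>

definition sphere_prob :: "(real^'n) measure \<Rightarrow> bool" where
  "sphere_prob \<mu> \<longleftrightarrow> prob_space \<mu> \<and> sets \<mu> = sets (restrict_space borel unit_sphere)"

definition has_density :: "'a measure \<Rightarrow> 'a measure \<Rightarrow> ('a \<Rightarrow> real) \<Rightarrow> bool" where
  "has_density M \<mu> \<rho> \<longleftrightarrow>
     \<rho> \<in> borel_measurable M \<and> (AE x in M. 0 \<le> \<rho> x) \<and> \<mu> = density M (\<lambda>x. ennreal (\<rho> x))"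

definition has_pos_density :: "'a measure \<Rightarrow> 'a measure \<Rightarrow> ('a \<Rightarrow> real) \<Rightarrow> bool" where
  "has_pos_density M \<mu> \<rho> \<longleftrightarrow> has_density M \<mu> \<rho> \<and> (AE x in M. 0 < \<rho> x)"

text \<open>Since \<open>\<rho> log \<rho>\<close> is bounded below and the uniform measure is finite, the integral of
  \<open>\<rho> log \<rho>\<close> is \<open>+\<infinity>\<close> exactly when \<open>\<rho> log \<rho>\<close> is not integrable; the Bochner integral would
  return \<open>0\<close> in that case, so it is treated separately. Two densities of the same measure
  agree almost everywhere, so the value does not depend on the choice of \<open>\<rho>\<close>.\<close>

definition entropy_sphere :: "(real^'n) measure \<Rightarrow> ereal" where
  "entropy_sphere \<mu> =
     (if \<exists>\<rho>. has_pos_density uniform_sphere \<mu> \<rho>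
      then let \<rho> = (SOME \<rho>. has_pos_density uniform_sphere \<mu> \<rho>) in
        if integrable uniform_sphere (\<lambda>x. \<rho> x * ln (\<rho> x))
        then ereal (LINT x|uniform_sphere. \<rho> x * ln (\<rho> x))
        else \<infinity>
      else \<infinity>)"

definition interaction_energy :: "(real^'n \<Rightarrow> real^'n \<Rightarrow> real) \<Rightarrow> (real^'n) measure \<Rightarrow> real" where
  "interaction_energy K \<mu> = 1 / 2 * (LINT x|\<mu>. LINT y|\<mu>. K x y)"

definition free_energy ::
  "(real^'n \<Rightarrow> real^'n \<Rightarrow> real) \<Rightarrow> real \<Rightarrow> (real^'n) measure \<Rightarrow> ereal" where
  "free_energy K \<gamma> \<mu> = ereal (1 / \<gamma>) * entropy_sphere \<mu> + ereal (interaction_energy K \<mu>)"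

definition is_minimizer ::
  "(real^'n \<Rightarrow> real^'n \<Rightarrow> real) \<Rightarrow> real \<Rightarrow> (real^'n) measure \<Rightarrow> bool" where
  "is_minimizer K \<gamma> \<mu> \<longleftrightarrow> is_arg_min (free_energy K \<gamma>) sphere_prob \<mu>"


section \<open>Transition points\<close>

definition transition_point :: "(real^'n \<Rightarrow> real^'n \<Rightarrow> real) \<Rightarrow> real \<Rightarrow> bool" where
  "transition_point K \<gamma>c \<longleftrightarrow>
     0 < \<gamma>c \<and>
     (\<forall>\<gamma>. 0 < \<gamma> \<and> \<gamma> < \<gamma>c \<longrightarrow> (\<forall>\<mu>. is_minimizer K \<gamma> \<mu> \<longleftrightarrow> \<mu> = uniform_sphere)) \<and>
     is_minimizer K \<gamma>c uniform_sphere \<and>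
     (\<forall>\<gamma>>\<gamma>c. \<exists>\<mu>. is_minimizer K \<gamma> \<mu> \<and> (\<exists>\<rho>. has_pos_density uniform_sphere \<mu> \<rho>) \<and>
        \<mu> \<noteq> uniform_sphere)"

text \<open>In the limit condition the densities \<open>\<rho> \<gamma>\<close>, like the constant density of the uniform
  measure, are taken with respect to the surface measure.\<close>

definition continuous_transition_point :: "(real^'n \<Rightarrow> real^'n \<Rightarrow> real) \<Rightarrow> real \<Rightarrow> bool" where
  "continuous_transition_point K \<gamma>c \<longleftrightarrow>
     transition_point K \<gamma>c \<and>
     (\<forall>\<mu>. is_minimizer K \<gamma>c \<mu> \<longleftrightarrow> \<mu> = uniform_sphere) \<and>
     (\<forall>\<rho> :: real \<Rightarrow> real^'n \<Rightarrow> real.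
        (\<forall>\<gamma>>\<gamma>c. \<exists>\<mu>. is_minimizer K \<gamma> \<mu> \<and> has_density surface_measure \<mu> (\<rho> \<gamma>)) \<longrightarrow>
        ((\<lambda>\<gamma>. LINT x|surface_measure. \<bar>\<rho> \<gamma> x - 1 / sphere_area TYPE('n)\<bar>) \<longlongrightarrow> 0) (at_right \<gamma>c))"

definition discontinuous_transition_point :: "(real^'n \<Rightarrow> real^'n \<Rightarrow> real) \<Rightarrow> real \<Rightarrow> bool" where
  "discontinuous_transition_point K \<gamma>c \<longleftrightarrow>
     transition_point K \<gamma>c \<and> \<not> continuous_transition_point K \<gamma>c"

end

theory Submission
  imports Defs "HOL-Complex_Analysis.Great_Picard" "HOL-Real_Asymp.Real_Asymp"
begin

text \<open>
  Write \<open>m\<close> for the uniform probability measure, \<open>\<phi>(x) = x ln x - x + 1\<close>, \<open>u = \<rho> - 1\<close> for a density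
  \<open>\<rho>\<close> with respect to \<open>m\<close>, and \<open>\<langle>u, K u\<rangle>\<close> for the quadratic form of the kernel. Since the kernel
  has constant integral in each variable,
  \<open>F\<^sub>\<gamma>(\<rho>) - F\<^sub>\<gamma>(1) = \<gamma>\<inverse> \<integral>\<phi>(1 + u) dm + \<langle>u, K u\<rangle>/2\<close>. Put \<open>\<lambda> = - min W\<^sub>l > 0\<close>, where \<open>W\<^sub>l\<close>
  are the Gegenbauer coefficients for \<open>l \<ge> 1\<close>. By the Funk-Hecke formula the quadratic part at
  \<open>u = 0\<close>, on functions of mean zero, is positive semidefinite exactly up to \<open>\<gamma> = 1/\<lambda>\<close>.

  \<^item> At \<open>\<gamma> = 1/\<lambda>\<close> the second-order term vanishes in the direction \<open>v\<close>, and
    \<open>\<phi>(1 + u) = u\<^sup>2/2 - u\<^sup>3/6 + O(u\<^sup>4)\<close> leaves \<open>-\<epsilon>\<^sup>3 \<lambda>/6 \<integral>v\<^sup>3 dm\<close>, which is negative for one sign of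
    \<open>\<epsilon>\<close>. So the uniform measure is no longer a minimizer at \<open>1/\<lambda>\<close> (\<open>cubic_instability\<close>).
  \<^item> The parameters for which the uniform measure is a minimizer form an interval starting at \<open>0\<close>:
    the entropy is nonnegative, so it is weighted more for smaller \<open>\<gamma>\<close>, and by a Pinsker
    inequality it dominates the interaction for small \<open>\<gamma>\<close>. The interval is closed on the right, and
    its endpoint is the transition point \<open>\<gamma>\<^sub>c\<close>; the first point gives \<open>\<gamma>\<^sub>c < 1/\<lambda>\<close>.
  \<^item> For \<open>\<gamma> < 1/\<lambda>\<close>, in particular slightly above \<open>\<gamma>\<^sub>c\<close>, the uniform density is minimal among all
    densities close to it in \<open>L\<^sub>1\<close> (\<open>uniform_L1_local_minimal\<close>). Minimizers for \<open>\<gamma>\<close> slightly above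
    \<open>\<gamma>\<^sub>c\<close> have strictly smaller energy, so they stay at a fixed \<open>L\<^sub>1\<close> distance: the transition is
    discontinuous.
  \<^item> Minimizers exist for every \<open>\<gamma> > 0\<close>. Along a minimizing sequence the potentials are relatively
    compact in the supremum norm, and the uniform convexity of the entropy then makes the densities
    themselves converge in \<open>L\<^sub>1\<close> (\<open>exists_energy_minimizer\<close>). A minimizer is positive because
    \<open>\<phi>\<close> has slope \<open>-\<infinity>\<close> at \<open>0\<close> (\<open>energy_minimizer_positive\<close>).

  These steps are carried out for a bounded symmetric kernel of constant mean on a probability space,
  given the compactness of the potentials, a lower bound of the quadratic form and one direction \<open>v\<close>
  attaining that bound. The rest of the development supplies these data for the sphere. Infinitesimal
  rotation invariance is a divergence theorem (\<open>sphere_divergence\<close>). Applied to functions of \<open>x \<bullet> y\<close>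
  and \<open>z \<bullet> y\<close> it shows that the Laplace-Beltrami operator is symmetric, whence the orthogonality of
  the zonal polynomials, and it gives a recursion for mixed moments, whence the one-dimensional
  formula for zonal integrals and the Funk-Hecke formula (\<open>funk_hecke\<close>). The lower bound \<open>-\<lambda>\<close> of the quadratic form follows by
  uniform polynomial approximation of the kernel and Bessel's inequality (\<open>zonal_bessel\<close>).
\<close>

section \<open>Inequalities for the entropy integrand\<close>

text \<open>A function on \<open>(-1, \<infinity>)\<close> whose derivative has the sign of its argument has its minimum at
  \<open>0\<close>; this is how the Taylor bounds below are proved.\<close>

lemma nonneg_of_deriv_sign:
  fixes f f' :: "real \<Rightarrow> real"
  assumes der: "\<And>u. u > -1 \<Longrightarrow> (f has_real_derivative f' u) (at u)"
    and sgn: "\<And>u. u > -1 \<Longrightarrow> 0 \<le> u * f' u"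
    and "f 0 = 0" "u > -1"
  shows "0 \<le> f u"
proof (cases "u = 0")
  case False
  consider "u > 0" | "u < 0" using False by linarith
  then show ?thesis
  proof cases
    case 1
    then obtain z where z: "z > 0" "z < u" "f u - f 0 = (u - 0) * f' z"
      using MVT2[of 0 u f f'] der by force
    have "0 \<le> z * f' z" using sgn z by auto
    then have "0 \<le> f' z" using z by (simp add: zero_le_mult_iff)
    then show ?thesis using z \<open>f 0 = 0\<close> 1 by simp
  next
    case 2
    then obtain z where z: "z > u" "z < 0" "f 0 - f u = (0 - u) * f' z"
      using MVT2[of u 0 f f'] der \<open>u > -1\<close> by force
    have "0 \<le> z * f' z" using sgn z \<open>u > -1\<close> by auto
    then have "f' z \<le> 0" using z by (simp add: zero_le_mult_iff)
    then have "(0 - u) * f' z \<le> 0" using 2 by (intro mult_nonneg_nonpos) auto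
    then show ?thesis using z \<open>f 0 = 0\<close> by linarith
  qed
qed (use assms(3) in simp)

text \<open>For probability densities the integral of this function is the entropy, since the two added
  terms cancel; pointwise it is nonnegative and vanishes only at \<open>1\<close>.\<close>

definition rel_entropy_fun :: "real \<Rightarrow> real" where
  "rel_entropy_fun x = x * ln x - x + 1"

lemma rel_entropy_fun_01 [simp]: "rel_entropy_fun 0 = 1" "rel_entropy_fun 1 = 0"
  by (simp_all add: rel_entropy_fun_def)

text \<open>The right-hand side minus the left-hand side has derivative \<open>u\<^sup>3 / (1 + u)\<close>.\<close>

lemma ln_taylor_upper:
  fixes u :: real assumes "u > -1"
  shows "ln (1 + u) \<le> u - u\<^sup>2 / 2 + u ^ 3 / 3"
proof -
  have "0 \<le> (\<lambda>u. u - u\<^sup>2 / 2 + u ^ 3 / 3 - ln (1 + u)) u"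
  proof (rule nonneg_of_deriv_sign[where f = "\<lambda>u. u - u\<^sup>2 / 2 + u ^ 3 / 3 - ln (1 + u)" and f' = "\<lambda>u. u^3 / (1 + u)"])
    fix u :: real assume u: "u > -1"
    have "1 - u + u\<^sup>2 - 1 / (1 + u) = u ^ 3 / (1 + u)"
      using u by (simp add: field_simps power2_eq_square power3_eq_cube)
    moreover have "((\<lambda>u. u - u\<^sup>2 / 2 + u ^ 3 / 3 - ln (1 + u)) has_real_derivative 1 - u + u\<^sup>2 - 1 / (1 + u)) (at u)"
      using u by (auto intro!: derivative_eq_intros)
    ultimately show "((\<lambda>u. u - u\<^sup>2 / 2 + u ^ 3 / 3 - ln (1 + u)) has_real_derivative u ^ 3 / (1 + u)) (at u)"
      by simp
    have "u * (u ^ 3 / (1 + u)) = (u\<^sup>2)\<^sup>2 / (1 + u)" by (simp add: power2_eq_square power3_eq_cube)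
    then show "0 \<le> u * (u ^ 3 / (1 + u))" using u by simp
  qed (use assms in auto)
  then show ?thesis by simp
qed

text \<open>The function \<open>ln (1 + u) - u + u\<^sup>2/2\<close> is increasing and vanishes at \<open>0\<close>. It is the
  derivative that occurs in \<open>rel_entropy_fun_lower\<close>.\<close>

lemma ln_taylor_sign:
  fixes u :: real assumes "u > -1"
  shows "0 \<le> u * (ln (1 + u) - u + u\<^sup>2 / 2)"
proof -
  define g where "g = (\<lambda>u::real. ln (1 + u) - u + u\<^sup>2 / 2)"
  have d: "\<exists>y. (g has_real_derivative y) (at x) \<and> 0 \<le> y" if "x > -1" for x :: real
  proof -
    have "1 / (1 + x) - 1 + x = x\<^sup>2 / (1 + x)"
      using that by (simp add: field_simps power2_eq_square)
    moreover have "(g has_real_derivative (1 / (1 + x) - 1 + x)) (at x)"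
      using that unfolding g_def by (auto intro!: derivative_eq_intros)
    ultimately show ?thesis using that by (intro exI[of _ "x\<^sup>2 / (1 + x)"]) auto
  qed
  have mono: "g a \<le> g b" if "-1 < a" "a \<le> b" for a b
    using that(2)
  proof (rule DERIV_nonneg_imp_nondecreasing)
    fix x assume "a \<le> x" then show "\<exists>y. (g has_real_derivative y) (at x) \<and> 0 \<le> y"
      using that by (intro d) auto
  qed
  have "g 0 = 0" by (simp add: g_def)
  then have "0 \<le> u * g u"
    using mono[of 0 u] mono[of u 0] assms by (cases "u \<ge> 0") (auto simp: zero_le_mult_iff)
  then show ?thesis by (simp add: g_def)
qed

text \<open>Third-order Taylor polynomial with an error of order four. The coefficient of \<open>u\<^sup>3\<close> is what
  makes the phase transition discontinuous.\<close>

lemma rel_entropy_fun_upper: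
  assumes "u > -1"
  shows "rel_entropy_fun (1 + u) \<le> u\<^sup>2 / 2 - u ^ 3 / 6 + u ^ 4 / 3"
proof -
  have "(1 + u) * ln (1 + u) \<le> (1 + u) * (u - u\<^sup>2 / 2 + u ^ 3 / 3)"
    using ln_taylor_upper[OF assms] assms by (intro mult_left_mono) auto
  also have "\<dots> = u + u\<^sup>2 / 2 - u ^ 3 / 6 + u ^ 4 / 3"
    by (simp add: field_simps power2_eq_square power3_eq_cube power4_eq_xxxx)
  finally show ?thesis
    by (simp add: rel_entropy_fun_def)
qed

text \<open>The Taylor remainder has the sign of the fourth derivative, which is positive, so this holds
  for all densities and not only near \<open>1\<close>.\<close>

lemma rel_entropy_fun_lower:
  assumes "u \<ge> -1"
  shows "u\<^sup>2 / 2 - u ^ 3 / 6 \<le> rel_entropy_fun (1 + u)"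
proof (cases "u = -1")
  case False
  have "0 \<le> (\<lambda>u. (1 + u) * ln (1 + u) - u - u\<^sup>2 / 2 + u ^ 3 / 6) u"
  proof (rule nonneg_of_deriv_sign[where f = "\<lambda>u. (1 + u) * ln (1 + u) - u - u\<^sup>2 / 2 + u ^ 3 / 6" and f' = "\<lambda>u. ln (1 + u) - u + u\<^sup>2 / 2"])
    fix u :: real assume u: "u > -1"
    show "((\<lambda>u. (1 + u) * ln (1 + u) - u - u\<^sup>2 / 2 + u ^ 3 / 6) has_real_derivative ln (1 + u) - u + u\<^sup>2 / 2) (at u)"
      using u by (auto intro!: derivative_eq_intros)
  qed (use assms False ln_taylor_sign in auto)
  then show ?thesis by (simp add: rel_entropy_fun_def)
qed (simp add: rel_entropy_fun_def)

text \<open>Convexity, as the bound by the tangent at \<open>b\<close>.\<close>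

lemma rel_entropy_fun_tangent:
  assumes "x \<ge> 0" "b > 0"
  shows "rel_entropy_fun b + ln b * (x - b) \<le> rel_entropy_fun x"
proof (cases "x = 0")
  case False
  have "ln (b / x) \<le> b / x - 1"
    using assms False by (intro ln_le_minus_one) auto
  then have "x * (ln b - ln x) \<le> x * (b / x - 1)"
    using assms False by (intro mult_left_mono) (auto simp: ln_div)
  then show ?thesis
    using False by (simp add: rel_entropy_fun_def algebra_simps)
qed (use assms in \<open>simp add: rel_entropy_fun_def\<close>)

lemma rel_entropy_fun_nonneg: "x \<ge> 0 \<Longrightarrow> 0 \<le> rel_entropy_fun x"
  using rel_entropy_fun_tangent[of x 1] by simp

lemma rel_entropy_fun_convex:
  assumes "0 \<le> e" "e \<le> 1" "x \<ge> 0"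
  shows "rel_entropy_fun ((1 - e) * x + e) \<le> (1 - e) * rel_entropy_fun x"
proof (cases "(1 - e) * x + e = 0")
  case True
  moreover have "0 \<le> (1 - e) * x" using assms by simp
  ultimately have "e = 0" using assms(1) by linarith
  then show ?thesis by simp
next
  case False
  define b where "b = (1 - e) * x + e"
  have "0 \<le> (1 - e) * x" using assms by simp
  then have b: "b > 0" using False assms(1) by (simp add: b_def)
  have "(1 - e) * (rel_entropy_fun b + ln b * (x - b)) \<le> (1 - e) * rel_entropy_fun x"
    using assms rel_entropy_fun_tangent[OF assms(3) b] by (intro mult_left_mono) auto
  moreover have "e * (rel_entropy_fun b + ln b * (1 - b)) \<le> e * rel_entropy_fun 1"
    using assms rel_entropy_fun_tangent[OF _ b, of 1] by (intro mult_left_mono) auto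
  moreover have "(1 - e) * (rel_entropy_fun b + ln b * (x - b)) + e * (rel_entropy_fun b + ln b * (1 - b))
     = rel_entropy_fun b + ln b * ((1 - e) * x + e - b)" by algebra
  ultimately show ?thesis by (simp add: b_def)
qed

text \<open>Uniform convexity. With \<open>a = m (1 + t)\<close> and \<open>b = m (1 - t)\<close> the gap is
  \<open>m (\<phi>(1 + t) + \<phi>(1 - t))\<close>, and in \<open>rel_entropy_fun_lower\<close> the cubic terms cancel.\<close>

lemma rel_entropy_fun_midpoint_gap:
  assumes "a \<ge> 0" "b \<ge> 0" 
  shows "(a - b)\<^sup>2 / (2 * (a + b)) \<le> rel_entropy_fun a + rel_entropy_fun b - 2 * rel_entropy_fun ((a + b) / 2)"
proof (cases "a + b = 0")
  case False
  define m where "m = (a + b) / 2"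
  define t where "t = (a - b) / (a + b)"
  have m: "m > 0" using assms False by (simp add: m_def)
  have ab: "a = m * (1 + t)" "b = m * (1 + (- t))"
    using False by (simp_all add: m_def t_def field_simps)
  have t: "t \<ge> -1" "t \<le> 1" using assms False by (auto simp: t_def field_simps)
  have *: "rel_entropy_fun (m * (1 + s)) = m * rel_entropy_fun (1 + s) + m * (1 + s) * ln m - m + 1"
    if "s \<ge> -1" for s
  proof (cases "s = -1")
    case False
    then have "ln (m * (1 + s)) = ln m + ln (1 + s)" using that m by (intro ln_mult_pos) auto
    then show ?thesis by (simp add: rel_entropy_fun_def algebra_simps)
  qed (simp add: rel_entropy_fun_def)
  have "rel_entropy_fun a + rel_entropy_fun b - 2 * rel_entropy_fun m
     = m * (rel_entropy_fun (1 + t) + rel_entropy_fun (1 + (-t)))"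
    unfolding ab using *[of t] *[of "-t"] t by (simp add: algebra_simps rel_entropy_fun_def[of m])
  also have "\<dots> \<ge> m * t\<^sup>2"
    using rel_entropy_fun_lower[of t] rel_entropy_fun_lower[of "-t"] t m
    by (intro mult_left_mono) auto
  also have "m * t\<^sup>2 = (a - b)\<^sup>2 / (2 * (a + b))"
    using False by (simp add: m_def t_def power_divide power2_eq_square[of "a + b"])
  finally show ?thesis by (simp add: m_def)
qed (use assms in \<open>simp add: add_nonneg_eq_0_iff\<close>)

text \<open>The arithmetic-geometric mean inequality in the form that converts the convexity gap into an
  \<open>L\<^sub>1\<close> distance: the first term is at most \<open>\<tau>\<close> times the gap, and the second integrates to
  \<open>1 / \<tau>\<close> for densities.\<close>

lemma abs_diff_le_weighted:
  fixes a b \<tau> :: real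
  assumes "a \<ge> 0" "b \<ge> 0" "\<tau> > 0"
  shows "\<bar>a - b\<bar> \<le> \<tau> * ((a - b)\<^sup>2 / (2 * (a + b))) + (a + b) / (2 * \<tau>)"
proof (cases "a + b = 0")
  case False
  define s where "s = a + b"
  have s: "s > 0" using assms False by (simp add: s_def)
  have "0 \<le> (\<tau> * c - s)\<^sup>2 / (2 * \<tau> * s)" for c using s assms by simp
  also have "(\<tau> * c - s)\<^sup>2 / (2 * \<tau> * s) = \<tau> * (c\<^sup>2 / (2 * s)) + s / (2 * \<tau>) - c" for c
    using s assms by (simp add: divide_simps) (simp add: power2_eq_square algebra_simps)
  finally have "0 \<le> \<tau> * (\<bar>a - b\<bar>\<^sup>2 / (2 * s)) + s / (2 * \<tau>) - \<bar>a - b\<bar>" .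
  then have "0 \<le> \<tau> * ((a - b)\<^sup>2 / (2 * s)) + s / (2 * \<tau>) - \<bar>a - b\<bar>" by simp
  then show ?thesis by (simp add: s_def)
qed (use assms in \<open>simp add: add_nonneg_eq_0_iff\<close>)

text \<open>Near \<open>1\<close> the entropy controls the square of the deviation with almost the optimal constant,
  and beyond the threshold \<open>d\<close> it grows at least linearly. The second part absorbs the unbounded
  peaks of a density that is only known to be close to \<open>1\<close> in \<open>L\<^sub>1\<close>.\<close>

lemma rel_entropy_fun_truncated_lower:
  assumes "0 < d" "d \<le> 1" "u \<ge> -1"
  shows "(1 - d) / 2 * (min u d)\<^sup>2 + ln (1 + d) * (u - min u d) \<le> rel_entropy_fun (1 + u)"
proof -
  have small: "(1 - d) / 2 * v\<^sup>2 \<le> rel_entropy_fun (1 + v)" if "v \<le> d" "v \<ge> -1" for v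
  proof -
    have "v * v\<^sup>2 \<le> d * v\<^sup>2" using that by (intro mult_right_mono) auto
    moreover have "0 \<le> d * v\<^sup>2" using assms by simp
    moreover have "v ^ 3 = v * v\<^sup>2" by (simp add: power2_eq_square power3_eq_cube)
    moreover have "(1 - d) / 2 * v\<^sup>2 = v\<^sup>2 / 2 - d * v\<^sup>2 / 2" by (simp add: field_simps)
    ultimately have "(1 - d) / 2 * v\<^sup>2 \<le> v\<^sup>2 / 2 - v ^ 3 / 6"
      by linarith
    then show ?thesis using rel_entropy_fun_lower[of v] that by linarith
  qed
  show ?thesis
  proof (cases "u \<le> d")
    case True
    then show ?thesis using small[of u] assms by (simp add: min_def)
  next
    case False
    then show ?thesis
      using small[of d] assms rel_entropy_fun_tangent[of "1 + u" "1 + d"] by (simp add: min_def)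
  qed
qed

lemma continuous_on_rel_entropy_fun: "continuous_on {0..} rel_entropy_fun"
proof -
  have "((\<lambda>x::real. x * ln x) \<longlongrightarrow> 0) (at_right 0)"
    by real_asymp
  then have 0: "continuous (at 0 within {0..}) (\<lambda>x::real. x * ln x)"
    unfolding continuous_within by (simp add: at_within_Ici_at_right)
  have "continuous (at x within {0..}) (\<lambda>x::real. x * ln x)" if "x \<in> {0..}" for x
  proof (cases "x = 0")
    case False
    then have "isCont (\<lambda>x::real. x * ln x) x" by (intro continuous_intros) auto
    then show ?thesis by (rule continuous_at_imp_continuous_at_within)
  qed (use 0 in simp)
  then have "continuous_on {0..} (\<lambda>x::real. x * ln x)"
    by (simp add: continuous_on_eq_continuous_within)
  then have "continuous_on {0..} (\<lambda>x. (\<lambda>x::real. x * ln x) x - x + 1)"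
    by (intro continuous_on_add continuous_on_diff continuous_on_id continuous_on_const)
  then show ?thesis unfolding rel_entropy_fun_def[abs_def] .
qed

lemma borel_measurable_rel_entropy_fun [measurable]: "rel_entropy_fun \<in> borel_measurable borel"
  unfolding rel_entropy_fun_def[abs_def] by measurable

section \<open>Mean-field energies on a probability space\<close>

text \<open>The hypothesis on the mean says that the uniform density has a constant potential, so that
  first-order terms around it vanish.\<close>

locale mean_field = prob_space M for M :: "'a measure" +
  fixes k :: "'a \<Rightarrow> 'a \<Rightarrow> real" and B c0 :: real
  assumes kernel_measurable [measurable]: "case_prod k \<in> borel_measurable (M \<Otimes>\<^sub>M M)"
    and kernel_bounded: "\<And>x y. \<bar>k x y\<bar> \<le> B"
    and kernel_sym: "\<And>x y. k x y = k y x"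
    and kernel_mean: "\<And>x. x \<in> space M \<Longrightarrow> (LINT y|M. k x y) = c0"
begin

lemma B_nonneg: "0 \<le> B"
  using kernel_bounded[of undefined undefined] by linarith

lemma kernel_section_measurable [measurable]: "x \<in> space M \<Longrightarrow> (\<lambda>y. k x y) \<in> borel_measurable M"
  by measurable

definition potential :: "('a \<Rightarrow> real) \<Rightarrow> 'a \<Rightarrow> real" where
  "potential u x = (LINT y|M. k x y * u y)"

definition pairing :: "('a \<Rightarrow> real) \<Rightarrow> ('a \<Rightarrow> real) \<Rightarrow> real" where
  "pairing u w = (LINT x|M. u x * potential w x)"

lemma integrable_kernel_mult:
  assumes "integrable M u" "x \<in> space M"
  shows "integrable M (\<lambda>y. k x y * u y)"
proof (rule Bochner_Integration.integrable_bound)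
  show "integrable M (\<lambda>y. B * u y)" using assms by simp
  show "(\<lambda>y. k x y * u y) \<in> borel_measurable M" using assms by measurable
  show "AE y in M. norm (k x y * u y) \<le> norm (B * u y)"
    using kernel_bounded B_nonneg by (auto simp: abs_mult intro!: mult_right_mono)
qed

lemma potential_bound:
  assumes "integrable M u" "x \<in> space M"
  shows "\<bar>potential u x\<bar> \<le> B * (LINT y|M. \<bar>u y\<bar>)"
proof -
  have "\<bar>potential u x\<bar> \<le> (LINT y|M. \<bar>k x y * u y\<bar>)"
    unfolding potential_def by (rule integral_abs_bound)
  also have "\<dots> \<le> (LINT y|M. B * \<bar>u y\<bar>)"
  proof (rule integral_mono)
    show "integrable M (\<lambda>y. \<bar>k x y * u y\<bar>)" using integrable_kernel_mult[OF assms] by (rule integrable_abs)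
    show "\<bar>k x y * u y\<bar> \<le> B * \<bar>u y\<bar>" for y
      using kernel_bounded by (auto simp: abs_mult intro!: mult_right_mono)
  qed (use assms in simp)
  finally show ?thesis by simp
qed

lemma potential_measurable [measurable]:
  assumes [measurable]: "u \<in> borel_measurable M"
  shows "potential u \<in> borel_measurable M"
  unfolding potential_def[abs_def] by measurable

lemma integrable_mult_potential:
  assumes "integrable M u" "integrable M w"
  shows "integrable M (\<lambda>x. u x * potential w x)"
proof (rule Bochner_Integration.integrable_bound)
  show "integrable M (\<lambda>x. (B * (LINT y|M. \<bar>w y\<bar>)) * u x)" using assms by simp
  show "(\<lambda>x. u x * potential w x) \<in> borel_measurable M"
    using assms by (auto intro!: borel_measurable_times potential_measurable)
  show "AE x in M. norm (u x * potential w x) \<le> norm (B * (LINT y|M. \<bar>w y\<bar>) * u x)"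
  proof (rule AE_I2)
    fix x assume "x \<in> space M"
    then have "\<bar>potential w x\<bar> \<le> B * (LINT y|M. \<bar>w y\<bar>)" using assms by (intro potential_bound)
    then have "\<bar>u x\<bar> * \<bar>potential w x\<bar> \<le> \<bar>u x\<bar> * \<bar>B * (LINT y|M. \<bar>w y\<bar>)\<bar>"
      by (intro mult_left_mono) auto
    then show "norm (u x * potential w x) \<le> norm (B * (LINT y|M. \<bar>w y\<bar>) * u x)"
      by (simp add: abs_mult ac_simps)
  qed
qed

lemma pairing_bound:
  assumes "integrable M u" "integrable M w"
  shows "\<bar>pairing u w\<bar> \<le> B * (LINT x|M. \<bar>u x\<bar>) * (LINT x|M. \<bar>w x\<bar>)"
proof -
  have "\<bar>pairing u w\<bar> \<le> (LINT x|M. \<bar>u x * potential w x\<bar>)"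
    unfolding pairing_def by (rule integral_abs_bound)
  also have "\<dots> \<le> (LINT x|M. \<bar>u x\<bar> * (B * (LINT y|M. \<bar>w y\<bar>)))"
  proof (rule integral_mono)
    show "integrable M (\<lambda>x. \<bar>u x * potential w x\<bar>)" using integrable_mult_potential[OF assms] by (rule integrable_abs)
    show "\<bar>u x * potential w x\<bar> \<le> \<bar>u x\<bar> * (B * (LINT y|M. \<bar>w y\<bar>))" if "x \<in> space M" for x
      using potential_bound[OF assms(2) that] by (auto simp: abs_mult intro!: mult_left_mono)
  qed (use assms in simp)
  finally show ?thesis by (simp add: ac_simps)
qed

lemma potential_lincomb:
  assumes "integrable M u" "integrable M w" "x \<in> space M"
  shows "potential (\<lambda>y. a * u y + b * w y) x = a * potential u x + b * potential w x"
proof -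
  have "potential (\<lambda>y. a * u y + b * w y) x = (LINT y|M. a * (k x y * u y) + b * (k x y * w y))"
    unfolding potential_def by (simp add: algebra_simps)
  also have "\<dots> = a * potential u x + b * potential w x"
    unfolding potential_def using integrable_kernel_mult assms by (subst Bochner_Integration.integral_add) auto
  finally show ?thesis .
qed

lemma pairing_lincomb_right:
  assumes "integrable M v" "integrable M u" "integrable M w"
  shows "pairing v (\<lambda>y. a * u y + b * w y) = a * pairing v u + b * pairing v w"
proof -
  have "pairing v (\<lambda>y. a * u y + b * w y) = (LINT x|M. a * (v x * potential u x) + b * (v x * potential w x))"
    unfolding pairing_def using assms
    by (intro Bochner_Integration.integral_cong refl) (simp add: potential_lincomb algebra_simps)
  also have "\<dots> = a * pairing v u + b * pairing v w"
    unfolding pairing_def using integrable_mult_potential assms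
    by (subst Bochner_Integration.integral_add) auto
  finally show ?thesis .
qed

text \<open>Fubini's theorem and the symmetry of the kernel.\<close>

lemma pairing_sym:
  assumes "integrable M u" "integrable M w"
  shows "pairing u w = pairing w u"
proof -
  interpret P: pair_sigma_finite M M ..
  have [measurable]: "u \<in> borel_measurable M" "w \<in> borel_measurable M" using assms by auto
  have "integrable (M \<Otimes>\<^sub>M M) (\<lambda>(x, y). u x * w y)"
    using assms by (intro P.Fubini_integrable) (auto simp: abs_mult)
  then have "integrable (M \<Otimes>\<^sub>M M) (\<lambda>p. B * (case p of (x, y) \<Rightarrow> u x * w y))"
    by simp
  then have I: "integrable (M \<Otimes>\<^sub>M M) (case_prod (\<lambda>x y. u x * (k x y * w y)))"
  proof (rule Bochner_Integration.integrable_bound)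
    show "case_prod (\<lambda>x y. u x * (k x y * w y)) \<in> borel_measurable (M \<Otimes>\<^sub>M M)" by measurable
    show "AE p in M \<Otimes>\<^sub>M M. norm (case p of (x, y) \<Rightarrow> u x * (k x y * w y))
        \<le> norm (B * (case p of (x, y) \<Rightarrow> u x * w y))"
    proof (rule AE_I2, clarify)
      fix x y
      have "\<bar>k x y\<bar> * \<bar>u x * w y\<bar> \<le> \<bar>B\<bar> * \<bar>u x * w y\<bar>"
        using kernel_bounded[of x y] by (intro mult_right_mono) auto
      then show "norm (u x * (k x y * w y)) \<le> norm (B * (u x * w y))"
        by (simp add: abs_mult ac_simps)
    qed
  qed
  have "pairing u w = (LINT x|M. LINT y|M. u x * (k x y * w y))"
    by (simp add: pairing_def potential_def)
  also have "\<dots> = (LINT y|M. LINT x|M. u x * (k x y * w y))"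
    using P.Fubini_integral[OF I] by simp
  also have "\<dots> = (LINT y|M. w y * potential u y)"
  proof (intro Bochner_Integration.integral_cong refl)
    fix y
    have "(LINT x|M. u x * (k x y * w y)) = (LINT x|M. w y * (k y x * u x))"
      by (intro Bochner_Integration.integral_cong refl) (simp add: kernel_sym[of y] ac_simps)
    then show "(LINT x|M. u x * (k x y * w y)) = w y * potential u y"
      by (simp add: potential_def)
  qed
  finally show ?thesis by (simp add: pairing_def)
qed

lemma pairing_lincomb_left:
  assumes "integrable M v" "integrable M u" "integrable M w"
  shows "pairing (\<lambda>y. a * u y + b * w y) v = a * pairing u v + b * pairing w v"
  using pairing_lincomb_right[OF assms] assms
  by (simp add: pairing_sym[of _ v])

lemma pairing_lincomb_self:
  assumes "integrable M u" "integrable M w"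
  shows "pairing (\<lambda>y. a * u y + b * w y) (\<lambda>y. a * u y + b * w y)
    = a\<^sup>2 * pairing u u + 2 * a * b * pairing u w + b\<^sup>2 * pairing w w"
  using assms pairing_sym[OF assms]
  by (simp add: pairing_lincomb_left pairing_lincomb_right power2_eq_square algebra_simps)

lemma potential_one: "x \<in> space M \<Longrightarrow> potential (\<lambda>_. 1) x = c0"
  by (simp add: potential_def kernel_mean)

lemma pairing_one_right:
  assumes "integrable M u"
  shows "pairing u (\<lambda>_. 1) = c0 * (LINT x|M. u x)"
proof -
  have "pairing u (\<lambda>_. 1) = (LINT x|M. u x * c0)"
    unfolding pairing_def by (intro Bochner_Integration.integral_cong refl) (simp add: potential_one)
  then show ?thesis by simp
qed

lemma pairing_one_add:
  assumes "integrable M u"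
  shows "pairing (\<lambda>x. 1 + u x) (\<lambda>x. 1 + u x) = c0 + 2 * c0 * (LINT x|M. u x) + pairing u u"
  using pairing_lincomb_self[of "\<lambda>_. 1" u 1 1] pairing_one_right[of "\<lambda>_. 1"] pairing_one_right[OF assms] assms
    pairing_sym[of u "\<lambda>_. 1"]
  by (simp add: prob_space)

text \<open>Densities are nonnegative everywhere, not only almost everywhere, which keeps the pointwise
  inequalities free of exceptional sets. Zeros are allowed: this class is closed under the limits
  taken below, and positivity of minimizers is proved afterwards.\<close>

definition finite_entropy_density :: "('a \<Rightarrow> real) \<Rightarrow> bool" where
  "finite_entropy_density \<rho> \<longleftrightarrow> (\<forall>x. 0 \<le> \<rho> x) \<and> integrable M \<rho> \<and> (LINT x|M. \<rho> x) = 1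
     \<and> integrable M (\<lambda>x. rel_entropy_fun (\<rho> x))"

lemma finite_entropy_densityD:
  assumes "finite_entropy_density \<rho>"
  shows "\<And>x. 0 \<le> \<rho> x" "integrable M \<rho>" "(LINT x|M. \<rho> x) = 1"
    "integrable M (\<lambda>x. rel_entropy_fun (\<rho> x))" "\<rho> \<in> borel_measurable M"
    "(LINT x|M. \<bar>\<rho> x\<bar>) = 1"
  using assms by (auto simp: finite_entropy_density_def)

definition entropy_of :: "('a \<Rightarrow> real) \<Rightarrow> real" where
  "entropy_of \<rho> = (LINT x|M. rel_entropy_fun (\<rho> x))"

definition energy :: "real \<Rightarrow> ('a \<Rightarrow> real) \<Rightarrow> real" where
  "energy \<gamma> \<rho> = entropy_of \<rho> / \<gamma> + pairing \<rho> \<rho> / 2"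

lemma finite_entropy_density_one: "finite_entropy_density (\<lambda>_. 1)"
  by (simp add: finite_entropy_density_def prob_space)

lemma energy_one: "energy \<gamma> (\<lambda>_. 1) = c0 / 2"
  using pairing_one_right[of "\<lambda>_. 1"] by (simp add: energy_def entropy_of_def prob_space)

lemma entropy_of_nonneg: "finite_entropy_density \<rho> \<Longrightarrow> 0 \<le> entropy_of \<rho>"
  unfolding entropy_of_def
  by (intro Bochner_Integration.integral_nonneg) (auto simp: rel_entropy_fun_nonneg finite_entropy_densityD)

text \<open>The second part is uniform convexity of the entropy in \<open>L\<^sub>1\<close>: if the midpoint gains little
  entropy, the two densities are close (choose \<open>\<tau>\<close> as the inverse of the expected distance).\<close>

lemma midpoint_density:
  assumes \<rho>: "finite_entropy_density \<rho>" and \<sigma>: "finite_entropy_density \<sigma>"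
  shows "finite_entropy_density (\<lambda>x. (\<rho> x + \<sigma> x) / 2)"
    and "\<tau> > 0 \<Longrightarrow> (LINT x|M. \<bar>\<rho> x - \<sigma> x\<bar>)
      \<le> \<tau> * (entropy_of \<rho> + entropy_of \<sigma> - 2 * entropy_of (\<lambda>x. (\<rho> x + \<sigma> x) / 2)) + 1 / \<tau>"
proof -
  note D = finite_entropy_densityD[OF \<rho>] finite_entropy_densityD[OF \<sigma>]
  have [measurable]: "\<rho> \<in> borel_measurable M" "\<sigma> \<in> borel_measurable M" using D by auto
  have gap: "(\<rho> x - \<sigma> x)\<^sup>2 / (2 * (\<rho> x + \<sigma> x))
     \<le> rel_entropy_fun (\<rho> x) + rel_entropy_fun (\<sigma> x) - 2 * rel_entropy_fun ((\<rho> x + \<sigma> x) / 2)" for x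
    using D by (intro rel_entropy_fun_midpoint_gap) auto
  have int: "integrable M (\<lambda>x. rel_entropy_fun ((\<rho> x + \<sigma> x) / 2))"
  proof (rule Bochner_Integration.integrable_bound)
    show "integrable M (\<lambda>x. rel_entropy_fun (\<rho> x) + rel_entropy_fun (\<sigma> x))" using D by simp
    show "AE x in M. norm (rel_entropy_fun ((\<rho> x + \<sigma> x) / 2)) \<le> norm (rel_entropy_fun (\<rho> x) + rel_entropy_fun (\<sigma> x))"
    proof (rule AE_I2)
      fix x
      have "0 \<le> rel_entropy_fun ((\<rho> x + \<sigma> x) / 2)" "0 \<le> rel_entropy_fun (\<rho> x)" "0 \<le> rel_entropy_fun (\<sigma> x)"
        "0 \<le> (\<rho> x - \<sigma> x)\<^sup>2 / (2 * (\<rho> x + \<sigma> x))"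
        using D by (auto intro!: rel_entropy_fun_nonneg)
      then show "norm (rel_entropy_fun ((\<rho> x + \<sigma> x) / 2)) \<le> norm (rel_entropy_fun (\<rho> x) + rel_entropy_fun (\<sigma> x))"
        using gap[of x] unfolding real_norm_def by linarith
    qed
  qed measurable
  then show "finite_entropy_density (\<lambda>x. (\<rho> x + \<sigma> x) / 2)"
    using D by (simp add: finite_entropy_density_def)
  assume \<tau>: "\<tau> > 0"
  have "(LINT x|M. \<bar>\<rho> x - \<sigma> x\<bar>) \<le> (LINT x|M. \<tau> * (rel_entropy_fun (\<rho> x) + rel_entropy_fun (\<sigma> x)
      - 2 * rel_entropy_fun ((\<rho> x + \<sigma> x) / 2)) + (\<rho> x + \<sigma> x) / (2 * \<tau>))"
  proof (rule integral_mono)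
    fix x
    have "\<bar>\<rho> x - \<sigma> x\<bar> \<le> \<tau> * ((\<rho> x - \<sigma> x)\<^sup>2 / (2 * (\<rho> x + \<sigma> x))) + (\<rho> x + \<sigma> x) / (2 * \<tau>)"
      using D \<tau> by (intro abs_diff_le_weighted) auto
    also have "\<tau> * ((\<rho> x - \<sigma> x)\<^sup>2 / (2 * (\<rho> x + \<sigma> x)))
      \<le> \<tau> * (rel_entropy_fun (\<rho> x) + rel_entropy_fun (\<sigma> x) - 2 * rel_entropy_fun ((\<rho> x + \<sigma> x) / 2))"
      using gap \<tau> by (intro mult_left_mono) auto
    finally show "\<bar>\<rho> x - \<sigma> x\<bar> \<le> \<tau> * (rel_entropy_fun (\<rho> x) + rel_entropy_fun (\<sigma> x)
      - 2 * rel_entropy_fun ((\<rho> x + \<sigma> x) / 2)) + (\<rho> x + \<sigma> x) / (2 * \<tau>)" by simp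
  qed (use D int in auto)
  also have "\<dots> = \<tau> * (entropy_of \<rho> + entropy_of \<sigma> - 2 * entropy_of (\<lambda>x. (\<rho> x + \<sigma> x) / 2)) + 1 / \<tau>"
    using D int by (simp add: entropy_of_def)
  finally show "(LINT x|M. \<bar>\<rho> x - \<sigma> x\<bar>)
      \<le> \<tau> * (entropy_of \<rho> + entropy_of \<sigma> - 2 * entropy_of (\<lambda>x. (\<rho> x + \<sigma> x) / 2)) + 1 / \<tau>" .
qed

text \<open>Pinsker's inequality up to the constant: the midpoint estimate against the uniform density,
  with \<open>\<tau> = 2/h\<close>.\<close>

lemma weak_pinsker:
  assumes \<rho>: "finite_entropy_density \<rho>"
  shows "(LINT x|M. \<bar>\<rho> x - 1\<bar>)\<^sup>2 \<le> 4 * entropy_of \<rho>"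
proof (cases "(LINT x|M. \<bar>\<rho> x - 1\<bar>) = 0")
  case False
  define h where "h = (LINT x|M. \<bar>\<rho> x - 1\<bar>)"
  have h: "h > 0" using False by (auto simp: h_def less_le)
  have "h \<le> (2 / h) * (entropy_of \<rho> + 0 - 2 * entropy_of (\<lambda>x. (\<rho> x + 1) / 2)) + 1 / (2 / h)"
    using midpoint_density(2)[OF \<rho> finite_entropy_density_one, of "2 / h"] h
    by (simp add: h_def entropy_of_def)
  moreover have "(2 / h) * (entropy_of \<rho> + 0 - 2 * entropy_of (\<lambda>x. (\<rho> x + 1) / 2)) \<le> (2 / h) * entropy_of \<rho>"
    using h entropy_of_nonneg[OF midpoint_density(1)[OF \<rho> finite_entropy_density_one]]
    by (intro mult_left_mono) auto
  ultimately have "h / 2 \<le> (2 / h) * entropy_of \<rho>" by simp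
  then show ?thesis using h unfolding h_def[symmetric] by (simp add: field_simps power2_eq_square)
qed (use entropy_of_nonneg[OF \<rho>] in simp)

end

section \<open>Existence and positivity of minimizers\<close>

text \<open>Fatou's lemma for real functions, stated so that it also yields the integrability of the
  limit.\<close>

lemma fatou_integral_le:
  fixes f :: "nat \<Rightarrow> 'a \<Rightarrow> real"
  assumes [measurable]: "g \<in> borel_measurable M"
    and int: "\<And>n. integrable M (f n)" and nonneg: "\<And>n x. 0 \<le> f n x"
    and lim: "AE x in M. (\<lambda>n. f n x) \<longlonglongrightarrow> g x"
    and le: "\<forall>\<^sub>F n in sequentially. integral\<^sup>L M (f n) \<le> C"
  shows "integrable M g" "integral\<^sup>L M g \<le> C"
proof -
  have [measurable]: "f n \<in> borel_measurable M" for n using int by auto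
  have pos: "AE x in M. 0 \<le> g x"
    using lim by eventually_elim (rule LIMSEQ_le_const, use nonneg in auto)
  obtain N where "integral\<^sup>L M (f N) \<le> C"
    using eventually_happens'[OF _ le] by auto
  moreover have "0 \<le> integral\<^sup>L M (f N)"
    using nonneg by (intro Bochner_Integration.integral_nonneg)
  ultimately have C: "0 \<le> C" by linarith
  have "(\<integral>\<^sup>+x. ennreal (g x) \<partial>M) = (\<integral>\<^sup>+x. liminf (\<lambda>n. ennreal (f n x)) \<partial>M)"
  proof (rule nn_integral_cong_AE)
    show "AE x in M. ennreal (g x) = liminf (\<lambda>n. ennreal (f n x))"
      using lim
    proof eventually_elim
      case (elim x)
      then have "(\<lambda>n. ennreal (f n x)) \<longlonglongrightarrow> ennreal (g x)" by (rule tendsto_ennrealI)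
      then show ?case by (intro lim_imp_Liminf[symmetric]) auto
    qed
  qed
  also have "\<dots> \<le> liminf (\<lambda>n. \<integral>\<^sup>+x. ennreal (f n x) \<partial>M)"
    by (rule nn_integral_liminf) measurable
  also have "\<dots> = liminf (\<lambda>n. ennreal (integral\<^sup>L M (f n)))"
    using int nonneg by (simp add: nn_integral_eq_integral)
  also have "\<dots> \<le> limsup (\<lambda>n. ennreal (integral\<^sup>L M (f n)))" by (rule Liminf_le_Limsup) simp
  also have "\<dots> \<le> ennreal C"
    using le by (intro Limsup_bounded) (auto elim!: eventually_mono intro: ennreal_leI)
  finally have nn: "(\<integral>\<^sup>+x. ennreal (g x) \<partial>M) \<le> ennreal C" .
  show g: "integrable M g"
    using pos nn by (intro integrableI_nonneg) (auto intro: le_less_trans)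
  show "integral\<^sup>L M g \<le> C"
    using nn C pos by (simp add: nn_integral_eq_integral[OF g])
qed

context mean_field begin

lemma pairing_self_diff:
  assumes "integrable M a" "integrable M b"
  shows "\<bar>pairing a a - pairing b b\<bar> \<le> B * (LINT x|M. \<bar>a x - b x\<bar>) * ((LINT x|M. \<bar>a x\<bar>) + (LINT x|M. \<bar>b x\<bar>))"
proof -
  define d where "d = (\<lambda>x. a x - b x)"
  have d: "integrable M d" using assms by (simp add: d_def)
  have "pairing d a = pairing a a - pairing b a"
    using pairing_lincomb_left[OF assms(1) assms, of 1 "-1"] by (simp add: d_def)
  moreover have "pairing b d = pairing b a - pairing b b"
    using pairing_lincomb_right[OF assms(2) assms, of 1 "-1"] by (simp add: d_def)
  ultimately have "pairing a a - pairing b b = pairing d a + pairing b d" by simp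
  then have "\<bar>pairing a a - pairing b b\<bar> \<le> \<bar>pairing d a\<bar> + \<bar>pairing b d\<bar>" by linarith
  also have "\<dots> \<le> B * (LINT x|M. \<bar>d x\<bar>) * (LINT x|M. \<bar>a x\<bar>) + B * (LINT x|M. \<bar>b x\<bar>) * (LINT x|M. \<bar>d x\<bar>)"
    using assms d by (intro add_mono pairing_bound)
  finally show ?thesis by (simp add: d_def algebra_simps)
qed

text \<open>The interaction is quadratic, so the convexity gap of the entropy differs from that of the
  energy only by the interaction of the difference.\<close>

lemma parallelogram_energy:
  assumes \<rho>: "finite_entropy_density \<rho>" and \<sigma>: "finite_entropy_density \<sigma>" and "\<gamma> > 0"
  shows "entropy_of \<rho> + entropy_of \<sigma> - 2 * entropy_of (\<lambda>x. (\<rho> x + \<sigma> x) / 2) =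
    \<gamma> * (energy \<gamma> \<rho> + energy \<gamma> \<sigma> - 2 * energy \<gamma> (\<lambda>x. (\<rho> x + \<sigma> x) / 2)
      - pairing (\<lambda>x. \<rho> x - \<sigma> x) (\<lambda>x. \<rho> x - \<sigma> x) / 4)"
proof -
  have i: "integrable M \<rho>" "integrable M \<sigma>" using finite_entropy_densityD \<rho> \<sigma> by auto
  have 1: "pairing (\<lambda>x. (\<rho> x + \<sigma> x) / 2) (\<lambda>x. (\<rho> x + \<sigma> x) / 2) = pairing \<rho> \<rho> / 4 + pairing \<rho> \<sigma> / 2 + pairing \<sigma> \<sigma> / 4"
    using pairing_lincomb_self[OF i, of "1/2" "1/2"] by (simp add: power2_eq_square add_divide_distrib)
  have 2: "pairing (\<lambda>x. \<rho> x - \<sigma> x) (\<lambda>x. \<rho> x - \<sigma> x) = pairing \<rho> \<rho> - 2 * pairing \<rho> \<sigma> + pairing \<sigma> \<sigma>"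
    using pairing_lincomb_self[OF i, of "1" "-1"] by simp
  show ?thesis using \<open>\<gamma> > 0\<close> unfolding energy_def 1 2 by (simp add: field_simps)
qed

end

text \<open>Compactness of the potential operator, in the only form needed: potentials of densities have
  uniformly Cauchy subsequences.\<close>

locale compact_mean_field = mean_field +
  assumes potential_compact:
    "(\<And>n. finite_entropy_density (\<rho> n)) \<Longrightarrow>
      \<exists>r :: nat \<Rightarrow> nat. strict_mono r \<and>
        (\<forall>e>0. \<exists>N. \<forall>m\<ge>N. \<forall>n\<ge>N. \<forall>x\<in>space M. \<bar>potential (\<rho> (r m)) x - potential (\<rho> (r n)) x\<bar> \<le> e)"
begin

text \<open>Take a minimizing sequence whose potentials are uniformly Cauchy. Then the interaction of a
  difference of two members is small, their midpoint cannot have energy below the infimum, and by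
  \<open>parallelogram_energy\<close> the entropy gap is small. Hence the sequence is Cauchy in \<open>L\<^sub>1\<close>. The
  entropy of the limit is bounded by Fatou's lemma.\<close>

lemma exists_energy_minimizer:
  assumes \<gamma>: "\<gamma> > 0"
  shows "\<exists>\<rho>. finite_entropy_density \<rho> \<and> (\<forall>\<sigma>. finite_entropy_density \<sigma> \<longrightarrow> energy \<gamma> \<rho> \<le> energy \<gamma> \<sigma>)"
proof -
  define jm where "jm = Inf (energy \<gamma> ` Collect finite_entropy_density)"
  have bdd: "bdd_below (energy \<gamma> ` Collect finite_entropy_density)"
  proof (rule bdd_belowI2)
    fix \<rho> assume "\<rho> \<in> Collect finite_entropy_density"
    then have \<rho>: "finite_entropy_density \<rho>" by simp
    have "\<bar>pairing \<rho> \<rho>\<bar> \<le> B"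
      using pairing_bound[of \<rho> \<rho>] finite_entropy_densityD[OF \<rho>] by simp
    moreover have "0 \<le> entropy_of \<rho> / \<gamma>" using entropy_of_nonneg[OF \<rho>] \<gamma> by simp
    ultimately show "- B / 2 \<le> energy \<gamma> \<rho>" by (simp add: energy_def abs_le_iff)
  qed
  have jm_le: "jm \<le> energy \<gamma> \<rho>" if "finite_entropy_density \<rho>" for \<rho>
    unfolding jm_def using that bdd by (intro cInf_lower) auto
  have "\<exists>\<rho>. finite_entropy_density \<rho> \<and> energy \<gamma> \<rho> < jm + 1 / real (Suc n)" for n
    using cInf_lessD[of "energy \<gamma> ` Collect finite_entropy_density" "jm + 1 / real (Suc n)"]
      finite_entropy_density_one unfolding jm_def by auto
  then obtain \<rho>' where \<rho>': "\<And>n. finite_entropy_density (\<rho>' n)" "\<And>n. energy \<gamma> (\<rho>' n) < jm + 1 / real (Suc n)"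
    by metis
  from potential_compact[where \<rho> = \<rho>', OF \<rho>'(1)]
  obtain r :: "nat \<Rightarrow> nat" where r: "strict_mono r"
    and uc: "\<forall>e>0. \<exists>N. \<forall>m\<ge>N. \<forall>n\<ge>N. \<forall>x\<in>space M. \<bar>potential (\<rho>' (r m)) x - potential (\<rho>' (r n)) x\<bar> \<le> e"
    by (elim exE conjE)
  define \<sigma> where "\<sigma> n = \<rho>' (r n)" for n
  have \<sigma>: "finite_entropy_density (\<sigma> n)" for n unfolding \<sigma>_def by (rule \<rho>')
  note D = finite_entropy_densityD[OF \<sigma>]
  have \<sigma>e: "energy \<gamma> (\<sigma> n) < jm + 1 / real (Suc n)" for n
  proof -
    have "1 / real (Suc (r n)) \<le> 1 / real (Suc n)"
      using seq_suble[OF r, of n] by (intro divide_left_mono) auto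
    then show ?thesis using \<rho>'(2)[of "r n"] unfolding \<sigma>_def by linarith
  qed
  have energy_small: "\<forall>\<^sub>F n in sequentially. energy \<gamma> (\<sigma> n) < jm + \<delta>" if "\<delta> > 0" for \<delta>
  proof -
    have "\<forall>\<^sub>F n in sequentially. 1 / real (Suc n) < \<delta>"
      using LIMSEQ_Suc[OF lim_1_over_n] that order_tendstoD(2) by (auto simp del: of_nat_Suc)
    then show ?thesis
    proof eventually_elim
      case (elim n)
      then show ?case using \<sigma>e[of n] by linarith
    qed
  qed
  have cauchy: "\<exists>N. \<forall>m\<ge>N. \<forall>n\<ge>N. (LINT x|M. norm (\<sigma> m x - \<sigma> n x)) < e" if e: "e > 0" for e
  proof -
    \<comment> \<open>Below, \<open>\<tau> = 2 / e\<close> turns an energy excess and potential difference of \<open>\<delta>\<close> into \<open>5 e / 16\<close>,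
      and \<open>1 / \<tau>\<close> adds \<open>e / 2\<close>.\<close>
    define \<delta> where "\<delta> = e\<^sup>2 / (16 * \<gamma>)"
    have \<delta>: "\<delta> > 0" using e \<gamma> by (simp add: \<delta>_def)
    obtain N1 where N1: "\<And>m n x. m \<ge> N1 \<Longrightarrow> n \<ge> N1 \<Longrightarrow> x \<in> space M \<Longrightarrow> \<bar>potential (\<sigma> m) x - potential (\<sigma> n) x\<bar> \<le> \<delta>"
      using uc[rule_format, OF \<delta>] unfolding \<sigma>_def by auto
    obtain N2 where N2: "\<And>n. n \<ge> N2 \<Longrightarrow> energy \<gamma> (\<sigma> n) < jm + \<delta>"
      using energy_small[OF \<delta>] unfolding eventually_sequentially by auto
    have "(LINT x|M. \<bar>\<sigma> m x - \<sigma> n x\<bar>) < e" if mn: "m \<ge> max N1 N2" "n \<ge> max N1 N2" for m n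
    proof -
      define d where "d = (\<lambda>x. \<sigma> m x - \<sigma> n x)"
      have d: "integrable M d" using D by (simp add: d_def)
      have "(LINT x|M. \<bar>d x\<bar>) \<le> (LINT x|M. \<bar>\<sigma> m x\<bar> + \<bar>\<sigma> n x\<bar>)"
      proof (rule integral_mono)
        show "\<bar>d x\<bar> \<le> \<bar>\<sigma> m x\<bar> + \<bar>\<sigma> n x\<bar>" for x
          unfolding d_def by (rule abs_triangle_ineq4)
      qed (use d D in auto)
      then have d2: "(LINT x|M. \<bar>d x\<bar>) \<le> 2" using D by simp
      have "\<bar>pairing d d\<bar> \<le> (LINT x|M. \<bar>d x * potential d x\<bar>)"
        unfolding pairing_def by (rule integral_abs_bound)
      also have "\<dots> \<le> (LINT x|M. \<bar>d x\<bar> * \<delta>)"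
      proof (rule integral_mono)
        show "integrable M (\<lambda>x. \<bar>d x * potential d x\<bar>)"
          using integrable_mult_potential[OF d d] by (rule integrable_abs)
        fix x assume x: "x \<in> space M"
        have "potential d x = potential (\<sigma> m) x - potential (\<sigma> n) x"
          using potential_lincomb[OF D(2) D(2) x, of 1 m "-1" n] by (simp add: d_def)
        then show "\<bar>d x * potential d x\<bar> \<le> \<bar>d x\<bar> * \<delta>"
          using N1[of m n x] mn x by (auto simp: abs_mult intro!: mult_left_mono)
      qed (use d in simp)
      also have "\<dots> = (LINT x|M. \<bar>d x\<bar>) * \<delta>" by simp
      also have "\<dots> \<le> 2 * \<delta>" using d2 \<delta> by (intro mult_right_mono) auto
      finally have p: "- pairing d d / 4 \<le> \<delta> / 2" by (simp add: abs_le_iff)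
      have "jm \<le> energy \<gamma> (\<lambda>x. (\<sigma> m x + \<sigma> n x) / 2)"
        using midpoint_density(1)[OF \<sigma> \<sigma>] by (rule jm_le)
      then have "energy \<gamma> (\<sigma> m) + energy \<gamma> (\<sigma> n) - 2 * energy \<gamma> (\<lambda>x. (\<sigma> m x + \<sigma> n x) / 2)
         - pairing d d / 4 \<le> 5 / 2 * \<delta>"
        using N2[of m] N2[of n] mn p by simp
      then have "\<gamma> * (energy \<gamma> (\<sigma> m) + energy \<gamma> (\<sigma> n) - 2 * energy \<gamma> (\<lambda>x. (\<sigma> m x + \<sigma> n x) / 2)
         - pairing d d / 4) \<le> \<gamma> * (5 / 2 * \<delta>)"
        using \<gamma> by (intro mult_left_mono) auto
      also have "\<gamma> * (5 / 2 * \<delta>) = 5 / 32 * e\<^sup>2" using \<gamma> by (simp add: \<delta>_def)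
      finally have "entropy_of (\<sigma> m) + entropy_of (\<sigma> n) - 2 * entropy_of (\<lambda>x. (\<sigma> m x + \<sigma> n x) / 2) \<le> 5 / 32 * e\<^sup>2"
        using parallelogram_energy[OF \<sigma> \<sigma> \<gamma>, of m n] by (simp add: d_def)
      moreover define G where "G = entropy_of (\<sigma> m) + entropy_of (\<sigma> n) - 2 * entropy_of (\<lambda>x. (\<sigma> m x + \<sigma> n x) / 2)"
      ultimately have "(2 / e) * G \<le> (2 / e) * (5 / 32 * e\<^sup>2)"
        using e by (intro mult_left_mono) auto
      also have "\<dots> = 5 / 16 * e" using e by (simp add: power2_eq_square)
      finally have "(2 / e) * G \<le> 5 / 16 * e" .
      moreover have "(LINT x|M. \<bar>\<sigma> m x - \<sigma> n x\<bar>) \<le> (2 / e) * G + 1 / (2 / e)"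
        unfolding G_def using e by (intro midpoint_density(2) \<sigma>) auto
      moreover have "1 / (2 / e) = e / 2" by simp
      ultimately show ?thesis using e by linarith
    qed
    then show ?thesis by (intro exI[of _ "max N1 N2"]) simp
  qed
  obtain s where s: "strict_mono s" "AE x in M. Cauchy (\<lambda>i. \<sigma> (s i) x)"
    using cauchy_L1_AE_cauchy_subseq[where s = \<sigma>, OF D(2) cauchy] .
  have [measurable]: "\<sigma> n \<in> borel_measurable M" for n by (rule D)
  define \<rho> where "\<rho> x = max 0 (lim (\<lambda>i. \<sigma> (s i) x))" for x
  have [measurable]: "\<rho> \<in> borel_measurable M"
    unfolding \<rho>_def[abs_def] by measurable
  have lim: "AE x in M. (\<lambda>i. \<sigma> (s i) x) \<longlonglongrightarrow> \<rho> x"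
    using s(2)
  proof eventually_elim
    case (elim x)
    then have l: "(\<lambda>i. \<sigma> (s i) x) \<longlonglongrightarrow> lim (\<lambda>i. \<sigma> (s i) x)"
      by (simp add: Cauchy_convergent_iff convergent_LIMSEQ_iff)
    then have "0 \<le> lim (\<lambda>i. \<sigma> (s i) x)" by (rule LIMSEQ_le_const) (use D in auto)
    then show ?case using l by (simp add: \<rho>_def)
  qed
  have L1: "\<exists>N. \<forall>n\<ge>N. integrable M (\<lambda>x. \<bar>\<sigma> n x - \<rho> x\<bar>) \<and> (LINT x|M. \<bar>\<sigma> n x - \<rho> x\<bar>) \<le> e" if e: "e > 0" for e
  proof -
    obtain N where N: "\<And>m n. m \<ge> N \<Longrightarrow> n \<ge> N \<Longrightarrow> (LINT x|M. \<bar>\<sigma> m x - \<sigma> n x\<bar>) < e"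
      using cauchy[OF e] by auto
    have "integrable M (\<lambda>x. \<bar>\<sigma> n x - \<rho> x\<bar>) \<and> (LINT x|M. \<bar>\<sigma> n x - \<rho> x\<bar>) \<le> e" if n: "n \<ge> N" for n
    proof -
      have l: "AE x in M. (\<lambda>i. \<bar>\<sigma> n x - \<sigma> (s i) x\<bar>) \<longlonglongrightarrow> \<bar>\<sigma> n x - \<rho> x\<bar>"
        using lim by eventually_elim (intro tendsto_intros)
      have "\<forall>\<^sub>F i in sequentially. (LINT x|M. \<bar>\<sigma> n x - \<sigma> (s i) x\<bar>) \<le> e"
      proof (rule eventually_sequentiallyI)
        fix i assume "i \<ge> N"
        then have "s i \<ge> N" using seq_suble[OF s(1), of i] by linarith
        then show "(LINT x|M. \<bar>\<sigma> n x - \<sigma> (s i) x\<bar>) \<le> e" using N[OF n] by (simp add: less_imp_le)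
      qed
      from fatou_integral_le[OF _ _ _ l this] show ?thesis using D by simp
    qed
    then show ?thesis by blast
  qed
  obtain n0 where "integrable M (\<lambda>x. \<bar>\<sigma> n0 x - \<rho> x\<bar>)" using L1[of 1] by auto
  then have "integrable M (\<lambda>x. \<sigma> n0 x - \<rho> x)" by (subst (asm) integrable_abs_iff) simp
  from Bochner_Integration.integrable_diff[OF D(2)[of n0] this]
  have \<rho>i: "integrable M \<rho>" by simp
  have \<rho>1: "(LINT x|M. \<rho> x) = 1"
  proof -
    have "\<bar>1 - (LINT x|M. \<rho> x)\<bar> \<le> e" if e: "e > 0" for e
    proof -
      obtain n where n: "(LINT x|M. \<bar>\<sigma> n x - \<rho> x\<bar>) \<le> e" using L1[OF e] by auto
      have "1 - (LINT x|M. \<rho> x) = (LINT x|M. \<sigma> n x - \<rho> x)" using D \<rho>i by simp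
      also have "\<bar>\<dots>\<bar> \<le> (LINT x|M. \<bar>\<sigma> n x - \<rho> x\<bar>)" by (rule integral_abs_bound)
      finally show ?thesis using n by linarith
    qed
    note close = this
    have "\<bar>1 - (LINT x|M. \<rho> x)\<bar> \<le> 0"
    proof (rule field_le_epsilon)
      fix e :: real assume "0 < e"
      from close[OF this] show "\<bar>1 - (LINT x|M. \<rho> x)\<bar> \<le> 0 + e" by linarith
    qed
    then show ?thesis by linarith
  qed
  have \<rho>0: "0 \<le> \<rho> x" for x by (simp add: \<rho>_def)
  have entlim: "AE x in M. (\<lambda>i. rel_entropy_fun (\<sigma> (s i) x)) \<longlonglongrightarrow> rel_entropy_fun (\<rho> x)"
    using lim
  proof eventually_elim
    case (elim x)
    show ?case
      by (rule continuous_on_tendsto_compose[OF continuous_on_rel_entropy_fun elim])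
        (use \<rho>0 D in auto)
  qed
  have ent: "integrable M (\<lambda>x. rel_entropy_fun (\<rho> x)) \<and> entropy_of \<rho> \<le> \<gamma> * (jm + 2 * e - pairing \<rho> \<rho> / 2)"
    if e: "e > 0" for e
  proof -
    have "e / (B + 1) > 0" using e B_nonneg by simp
    from L1[OF this] obtain N where N: "\<And>n. n \<ge> N \<Longrightarrow> (LINT x|M. \<bar>\<sigma> n x - \<rho> x\<bar>) \<le> e / (B + 1)" by auto
    obtain N' where N': "\<And>n. n \<ge> N' \<Longrightarrow> energy \<gamma> (\<sigma> n) < jm + e"
      using energy_small[OF e] unfolding eventually_sequentially by auto
    have "\<forall>\<^sub>F i in sequentially. (LINT x|M. rel_entropy_fun (\<sigma> (s i) x)) \<le> \<gamma> * (jm + 2 * e - pairing \<rho> \<rho> / 2)"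
    proof (rule eventually_sequentiallyI)
      fix i assume "i \<ge> max N N'"
      then have i: "s i \<ge> N" "s i \<ge> N'" using seq_suble[OF s(1), of i] by auto
      have "\<bar>pairing (\<sigma> (s i)) (\<sigma> (s i)) - pairing \<rho> \<rho>\<bar> \<le> B * (LINT x|M. \<bar>\<sigma> (s i) x - \<rho> x\<bar>) * 2"
        using pairing_self_diff[OF D(2) \<rho>i, of "s i"] D \<rho>0 \<rho>1 by simp
      also have "\<dots> \<le> B * (e / (B + 1)) * 2"
        using N[OF i(1)] B_nonneg by (intro mult_right_mono mult_left_mono) auto
      also have "\<dots> \<le> 2 * e"
        using e B_nonneg by (simp add: field_simps)
      finally have "pairing \<rho> \<rho> / 2 - e \<le> pairing (\<sigma> (s i)) (\<sigma> (s i)) / 2"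
        by (simp add: abs_le_iff)
      then have "entropy_of (\<sigma> (s i)) / \<gamma> \<le> jm + 2 * e - pairing \<rho> \<rho> / 2"
        using N'[OF i(2)] by (simp add: energy_def)
      then show "(LINT x|M. rel_entropy_fun (\<sigma> (s i) x)) \<le> \<gamma> * (jm + 2 * e - pairing \<rho> \<rho> / 2)"
        using \<gamma> by (simp add: entropy_of_def field_simps)
    qed
    from fatou_integral_le[OF _ _ _ entlim this] show ?thesis
      using D by (simp add: entropy_of_def rel_entropy_fun_nonneg)
  qed
  have fed: "finite_entropy_density \<rho>"
    using ent[of 1] \<rho>0 \<rho>i \<rho>1 by (simp add: finite_entropy_density_def)
  have "energy \<gamma> \<rho> \<le> jm + e" if "e > 0" for e
    using ent[of "e / 2"] that \<gamma> by (simp add: energy_def field_simps)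
  then have "energy \<gamma> \<rho> \<le> jm" by (rule field_le_epsilon)
  then show ?thesis using fed jm_le by (intro exI[of _ \<rho>]) (auto intro: order_trans)
qed

end

context mean_field begin

text \<open>If \<open>\<rho>\<close> vanished on a set \<open>A\<close> of positive measure, mixing in a fraction \<open>e\<close> of the uniform
  density would change the entropy by at most the negative amount \<open>prob A * e ln e\<close> and the
  interaction by \<open>O(e)\<close>, which is smaller for small \<open>e\<close>.\<close>

lemma energy_minimizer_positive:
  assumes \<gamma>: "\<gamma> > 0" and \<rho>: "finite_entropy_density \<rho>"
    and min: "\<And>\<sigma>. finite_entropy_density \<sigma> \<Longrightarrow> energy \<gamma> \<rho> \<le> energy \<gamma> \<sigma>"
  shows "AE x in M. 0 < \<rho> x"
proof -
  note D = finite_entropy_densityD[OF \<rho>]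
  have [measurable]: "\<rho> \<in> borel_measurable M" by (rule D)
  define A where "A = {x \<in> space M. \<rho> x = 0}"
  have A [measurable]: "A \<in> sets M" unfolding A_def by measurable
  have "prob A = 0"
  proof (rule ccontr)
    assume "prob A \<noteq> 0"
    then have a: "prob A > 0" by (simp add: zero_less_measure_iff)
    \<comment> \<open>Chosen such that \<open>prob A * ln e = - (4 B \<gamma> + 1)\<close>, which exceeds the change of the interaction.\<close>
    define e where "e = exp (- ((4 * B * \<gamma> + 1) / prob A))"
    have e: "0 < e" "e < 1" using a B_nonneg \<gamma> by (auto simp: e_def add_nonneg_pos)
    have lne: "ln e = - ((4 * B * \<gamma> + 1) / prob A)" by (simp add: e_def)
    define \<sigma> where "\<sigma> = (\<lambda>x. (1 - e) * \<rho> x + e)"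
    have pt: "rel_entropy_fun (\<sigma> x) \<le> (1 - e) * rel_entropy_fun (\<rho> x) + indicator A x * (e * ln e)"
      if "x \<in> space M" for x
    proof (cases "x \<in> A")
      case True
      then show ?thesis by (simp add: A_def \<sigma>_def rel_entropy_fun_def)
    next
      case False
      then show ?thesis using rel_entropy_fun_convex[of e "\<rho> x"] e D by (simp add: \<sigma>_def)
    qed
    have \<sigma>0: "0 \<le> \<sigma> x" for x using e D by (simp add: \<sigma>_def)
    have int: "integrable M (\<lambda>x. rel_entropy_fun (\<sigma> x))"
    proof (rule Bochner_Integration.integrable_bound)
      show "integrable M (\<lambda>x. (1 - e) * rel_entropy_fun (\<rho> x))" using D by simp
      show "(\<lambda>x. rel_entropy_fun (\<sigma> x)) \<in> borel_measurable M" unfolding \<sigma>_def by measurable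
      show "AE x in M. norm (rel_entropy_fun (\<sigma> x)) \<le> norm ((1 - e) * rel_entropy_fun (\<rho> x))"
      proof (rule AE_I2)
        fix x
        have "0 \<le> rel_entropy_fun (\<sigma> x)" using \<sigma>0 by (rule rel_entropy_fun_nonneg)
        moreover have "rel_entropy_fun (\<sigma> x) \<le> (1 - e) * rel_entropy_fun (\<rho> x)"
          using rel_entropy_fun_convex[of e "\<rho> x"] e D by (simp add: \<sigma>_def)
        ultimately show "norm (rel_entropy_fun (\<sigma> x)) \<le> norm ((1 - e) * rel_entropy_fun (\<rho> x))"
          by simp
      qed
    qed
    have \<sigma>: "finite_entropy_density \<sigma>"
      using int \<sigma>0 D by (simp add: finite_entropy_density_def \<sigma>_def prob_space)
    have iA: "integrable M (\<lambda>x. indicator A x * (e * ln e))"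
      by (intro integrable_mult_left integrable_real_indicator) (auto simp: emeasure_eq_measure)
    have "entropy_of \<sigma> \<le> (LINT x|M. (1 - e) * rel_entropy_fun (\<rho> x) + indicator A x * (e * ln e))"
      unfolding entropy_of_def using int D(4) pt iA by (intro integral_mono Bochner_Integration.integrable_add) auto
    also have "\<dots> = (1 - e) * entropy_of \<rho> + prob A * (e * ln e)"
      using D(4) iA by (subst Bochner_Integration.integral_add) (auto simp: entropy_of_def)
    also have "\<dots> \<le> entropy_of \<rho> + prob A * (e * ln e)"
      using entropy_of_nonneg[OF \<rho>] e by (simp add: algebra_simps)
    also have "prob A * (e * ln e) = - e * (4 * B * \<gamma> + 1)" using a by (simp add: lne)
    finally have "entropy_of \<sigma> / \<gamma> \<le> (entropy_of \<rho> + - e * (4 * B * \<gamma> + 1)) / \<gamma>"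
      using \<gamma> by (intro divide_right_mono) auto
    also have "\<dots> = entropy_of \<rho> / \<gamma> - 4 * B * e - e / \<gamma>"
      using \<gamma> by (simp add: field_simps)
    finally have E: "entropy_of \<sigma> / \<gamma> \<le> entropy_of \<rho> / \<gamma> - 4 * B * e - e / \<gamma>" .
    have "(LINT x|M. \<bar>\<sigma> x - \<rho> x\<bar>) \<le> (LINT x|M. e * \<rho> x + e)"
    proof (rule integral_mono)
      fix x
      have "\<sigma> x - \<rho> x = e - e * \<rho> x" by (simp add: \<sigma>_def algebra_simps)
      moreover have "0 \<le> e * \<rho> x" using e D by simp
      ultimately show "\<bar>\<sigma> x - \<rho> x\<bar> \<le> e * \<rho> x + e" using e by (simp add: abs_le_iff)
    qed (use D finite_entropy_densityD[OF \<sigma>] in auto)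
    also have "\<dots> = 2 * e" using D by (simp add: prob_space)
    finally have "B * (LINT x|M. \<bar>\<sigma> x - \<rho> x\<bar>) * 2 \<le> B * (2 * e) * 2"
      using B_nonneg by (intro mult_right_mono mult_left_mono) auto
    moreover have "\<bar>pairing \<sigma> \<sigma> - pairing \<rho> \<rho>\<bar> \<le> B * (LINT x|M. \<bar>\<sigma> x - \<rho> x\<bar>) * 2"
      using pairing_self_diff[of \<sigma> \<rho>] D finite_entropy_densityD[OF \<sigma>] by simp
    ultimately have "pairing \<sigma> \<sigma> / 2 \<le> pairing \<rho> \<rho> / 2 + 2 * B * e" by (simp add: abs_le_iff)
    then have "energy \<gamma> \<sigma> \<le> energy \<gamma> \<rho> - 2 * B * e - e / \<gamma>" using E by (simp add: energy_def)
    moreover have "e / \<gamma> > 0" "2 * B * e \<ge> 0" using e \<gamma> B_nonneg by auto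
    ultimately show False using min[OF \<sigma>] by linarith
  qed
  then have "A \<in> null_sets M" using A by (simp add: null_sets_def emeasure_eq_measure)
  then have "AE x in M. x \<notin> A" by (rule AE_not_in)
  then show ?thesis
    using AE_space
  proof eventually_elim
    case (elim x)
    then show ?case using D(1)[of x] by (auto simp: A_def less_le)
  qed
qed

end

section \<open>The range of parameters with a uniform minimizer\<close>

context mean_field begin

text \<open>The number \<open>c0 / 2\<close> is the energy of the uniform density for every \<open>\<gamma>\<close>.\<close>

definition uniform_minimal :: "real \<Rightarrow> bool" where
  "uniform_minimal \<gamma> \<longleftrightarrow> (\<forall>\<sigma>. finite_entropy_density \<sigma> \<longrightarrow> c0 / 2 \<le> energy \<gamma> \<sigma>)"

lemma energy_excess:
  assumes \<sigma>: "finite_entropy_density \<sigma>"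
  shows "energy \<gamma> \<sigma> - c0 / 2 = entropy_of \<sigma> / \<gamma> + pairing (\<lambda>x. \<sigma> x - 1) (\<lambda>x. \<sigma> x - 1) / 2"
proof -
  have "integrable M (\<lambda>x. \<sigma> x - 1)" "(LINT x|M. \<sigma> x - 1) = 0"
    using finite_entropy_densityD[OF \<sigma>] by (simp_all add: prob_space)
  from pairing_one_add[OF this(1)] this(2)
  have "pairing \<sigma> \<sigma> = c0 + pairing (\<lambda>x. \<sigma> x - 1) (\<lambda>x. \<sigma> x - 1)" by simp
  then show ?thesis unfolding energy_def by linarith
qed

text \<open>Entropy and interaction both compare with the square of the \<open>L\<^sub>1\<close> distance: the entropy from
  below by \<open>weak_pinsker\<close>, the interaction from above because the kernel is bounded.\<close>

lemma uniform_minimal_small: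
  assumes "\<gamma> > 0" "2 * B * \<gamma> \<le> 1"
  shows "uniform_minimal \<gamma>"
  unfolding uniform_minimal_def
proof (intro allI impI)
  fix \<sigma> assume \<sigma>: "finite_entropy_density \<sigma>"
  define h where "h = (LINT x|M. \<bar>\<sigma> x - 1\<bar>)"
  have "\<bar>pairing (\<lambda>x. \<sigma> x - 1) (\<lambda>x. \<sigma> x - 1)\<bar> \<le> B * h\<^sup>2"
    using pairing_bound[of "\<lambda>x. \<sigma> x - 1" "\<lambda>x. \<sigma> x - 1"] finite_entropy_densityD[OF \<sigma>]
    by (simp add: h_def power2_eq_square ac_simps)
  moreover have "B * h\<^sup>2 / 2 \<le> entropy_of \<sigma> / \<gamma>"
  proof -
    have "h\<^sup>2 \<le> 4 * entropy_of \<sigma>" unfolding h_def by (rule weak_pinsker[OF \<sigma>])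
    then have "(2 * B * \<gamma>) * h\<^sup>2 \<le> 1 * (4 * entropy_of \<sigma>)"
      using assms B_nonneg entropy_of_nonneg[OF \<sigma>] by (intro mult_mono) auto
    then show ?thesis using assms by (simp add: field_simps)
  qed
  ultimately show "c0 / 2 \<le> energy \<gamma> \<sigma>"
    using energy_excess[OF \<sigma>, of \<gamma>] unfolding abs_le_iff by linarith
qed

text \<open>Passing to a smaller parameter adds a positive multiple of the entropy. This gives both the
  monotonicity and the uniqueness of the minimizer below the transition.\<close>

lemma uniform_minimal_below:
  assumes "uniform_minimal \<gamma>'" "0 < \<gamma>" "\<gamma> < \<gamma>'" "finite_entropy_density \<sigma>"
  shows "c0 / 2 + entropy_of \<sigma> * (1 / \<gamma> - 1 / \<gamma>') \<le> energy \<gamma> \<sigma>"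
proof -
  have "c0 / 2 \<le> energy \<gamma>' \<sigma>" using assms(1,4) unfolding uniform_minimal_def by blast
  moreover have "entropy_of \<sigma> * (1 / \<gamma> - 1 / \<gamma>') = entropy_of \<sigma> / \<gamma> - entropy_of \<sigma> / \<gamma>'"
    by (simp add: right_diff_distrib)
  ultimately show ?thesis unfolding energy_def by linarith
qed

lemma uniform_minimal_antimono:
  assumes "uniform_minimal \<gamma>'" "0 < \<gamma>" "\<gamma> \<le> \<gamma>'"
  shows "uniform_minimal \<gamma>"
proof (cases "\<gamma> = \<gamma>'")
  case False
  show ?thesis unfolding uniform_minimal_def
  proof (intro allI impI)
    fix \<sigma> assume \<sigma>: "finite_entropy_density \<sigma>"
    have "0 \<le> entropy_of \<sigma> * (1 / \<gamma> - 1 / \<gamma>')"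
      using entropy_of_nonneg[OF \<sigma>] assms by (intro mult_nonneg_nonneg) (auto simp: field_simps)
    then show "c0 / 2 \<le> energy \<gamma> \<sigma>"
      using uniform_minimal_below[OF assms(1,2) _ \<sigma>] assms False by fastforce
  qed
qed (use assms in simp)

lemma uniform_minimal_closed:
  assumes \<gamma>: "0 < \<gamma>" and below: "\<And>\<gamma>'. 0 < \<gamma>' \<Longrightarrow> \<gamma>' < \<gamma> \<Longrightarrow> uniform_minimal \<gamma>'"
  shows "uniform_minimal \<gamma>"
  unfolding uniform_minimal_def
proof (intro allI impI)
  fix \<sigma> assume \<sigma>: "finite_entropy_density \<sigma>"
  define d where "d = c0 / 2 - pairing \<sigma> \<sigma> / 2"
  have "\<gamma> * d \<le> entropy_of \<sigma>"
  proof (rule field_le_mult_one_interval)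
    fix z :: real assume z: "0 < z" "z < 1"
    then have "uniform_minimal (z * \<gamma>)" using \<gamma> by (intro below) auto
    then have "c0 / 2 \<le> energy (z * \<gamma>) \<sigma>" using \<sigma> by (simp add: uniform_minimal_def)
    then have "d \<le> entropy_of \<sigma> / (z * \<gamma>)" unfolding energy_def d_def by linarith
    then have "d * (z * \<gamma>) \<le> entropy_of \<sigma>" using z \<gamma> by (subst (asm) pos_le_divide_eq) auto
    then show "z * (\<gamma> * d) \<le> entropy_of \<sigma>" by (simp add: ac_simps)
  qed
  then have "d \<le> entropy_of \<sigma> / \<gamma>" using \<gamma> by (subst pos_le_divide_eq) (auto simp: ac_simps)
  then show "c0 / 2 \<le> energy \<gamma> \<sigma>" unfolding energy_def d_def by linarith
qed

text \<open>At \<open>\<gamma> = 1 / lam\<close> the quadratic terms of entropy and interaction cancel in the direction \<open>v\<close>,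
  and a perturbation \<open>1 + e v\<close> with \<open>e\<close> small and of the sign of \<open>\<integral>v\<^sup>3\<close> lowers the energy by its
  cubic term.\<close>

lemma cubic_instability:
  assumes lam: "lam > 0"
    and v [measurable]: "v \<in> borel_measurable M" and V: "\<And>x. x \<in> space M \<Longrightarrow> \<bar>v x\<bar> \<le> V"
    and v1: "(LINT x|M. v x) = 0" and v2: "pairing v v = - lam * (LINT x|M. (v x)\<^sup>2)"
    and v3: "(LINT x|M. v x ^ 3) \<noteq> 0"
  shows "\<not> uniform_minimal (1 / lam)"
proof -
  have pow: "integrable M (\<lambda>x. v x ^ n)" for n
  proof (rule integrable_const_bound[where B = "V ^ n"])
    show "AE x in M. norm (v x ^ n) \<le> V ^ n"
      using V by (intro AE_I2) (simp add: power_abs power_mono)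
  qed simp
  have vi: "integrable M v" using pow[of 1] by simp
  define a b d where "a = (LINT x|M. v x ^ 2)" and "b = (LINT x|M. v x ^ 3)" and "d = (LINT x|M. v x ^ 4)"
  have d0: "0 \<le> d" unfolding d_def by (intro Bochner_Integration.integral_nonneg) simp
  \<comment> \<open>The first bound keeps the perturbed density above \<open>1/2\<close>, the second makes the quartic error
    smaller than the cubic term.\<close>
  define \<epsilon> where "\<epsilon> = min (1 / (2 * (\<bar>V\<bar> + 1))) (\<bar>b\<bar> / (4 * (d + 1)))"
  have \<epsilon>: "\<epsilon> > 0" using v3 d0 by (auto simp: \<epsilon>_def b_def)
  define e where "e = sgn b * \<epsilon>"
  have abs_e: "\<bar>e\<bar> = \<epsilon>" using v3 \<epsilon> by (simp add: e_def abs_mult b_def abs_sgn_eq)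
  have e2: "e\<^sup>2 = \<epsilon>\<^sup>2" "e ^ 4 = \<epsilon> ^ 4"
    using abs_e by (metis power2_abs, metis power_even_abs[of 4 e] even_numeral)
  have eb: "e ^ 3 * b = \<epsilon> ^ 3 * \<bar>b\<bar>"
    using v3 by (auto simp: e_def b_def sgn_if abs_if power3_eq_cube)
  have small: "\<bar>e * v x\<bar> \<le> 1 / 2" if "x \<in> space M" for x
  proof -
    have "\<bar>e * v x\<bar> \<le> (1 / (2 * (\<bar>V\<bar> + 1))) * (\<bar>V\<bar> + 1)"
      unfolding abs_mult abs_e using V[OF that] \<epsilon> by (intro mult_mono) (auto simp: \<epsilon>_def)
    also have "\<dots> = 1 / 2" by (simp add: add_nonneg_eq_0_iff divide_simps)
    finally show ?thesis .
  qed
  define \<sigma> where "\<sigma> = (\<lambda>x. max 0 (1 + e * v x))"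
  have \<sigma>eq: "\<sigma> x = 1 + e * v x" if "x \<in> space M" for x
  proof -
    have "0 \<le> 1 + e * v x" using small[OF that] by linarith
    then show ?thesis by (simp add: \<sigma>_def)
  qed
  have [measurable]: "\<sigma> \<in> borel_measurable M" unfolding \<sigma>_def by measurable
  define T where "T = (\<lambda>x. (e\<^sup>2 / 2) * v x ^ 2 - (e ^ 3 / 6) * v x ^ 3 + (e ^ 4 / 3) * v x ^ 4)"
  have Ti: "integrable M T" unfolding T_def using pow by simp
  have bound: "0 \<le> rel_entropy_fun (\<sigma> x)" "rel_entropy_fun (\<sigma> x) \<le> T x" if "x \<in> space M" for x
  proof -
    show "0 \<le> rel_entropy_fun (\<sigma> x)" by (intro rel_entropy_fun_nonneg) (simp add: \<sigma>_def)
    show "rel_entropy_fun (\<sigma> x) \<le> T x"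
    proof -
      have "-1 < e * v x" using small[OF that] by linarith
      from rel_entropy_fun_upper[OF this] show ?thesis
        by (simp add: \<sigma>eq[OF that] T_def power_mult_distrib)
    qed
  qed
  have Si: "integrable M (\<lambda>x. rel_entropy_fun (\<sigma> x))"
  proof (rule Bochner_Integration.integrable_bound[OF Ti])
    show "AE x in M. norm (rel_entropy_fun (\<sigma> x)) \<le> norm (T x)"
    proof (rule AE_I2)
      fix x assume "x \<in> space M"
      from bound[OF this] show "norm (rel_entropy_fun (\<sigma> x)) \<le> norm (T x)"
        unfolding real_norm_def by linarith
    qed
  qed simp
  have \<sigma>int: "integrable M \<sigma>"
    using vi by (subst Bochner_Integration.integrable_cong[OF refl \<sigma>eq]) auto
  have \<sigma>: "finite_entropy_density \<sigma>"
    unfolding finite_entropy_density_def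
  proof (intro conjI \<sigma>int Si)
    have "(LINT x|M. \<sigma> x) = (LINT x|M. 1 + e * v x)"
      by (intro Bochner_Integration.integral_cong refl \<sigma>eq)
    then show "(LINT x|M. \<sigma> x) = 1" using vi v1 by (simp add: prob_space)
  qed (simp add: \<sigma>_def)
  have "entropy_of \<sigma> \<le> integral\<^sup>L M T"
    unfolding entropy_of_def using Si Ti bound by (intro integral_mono) auto
  also have "integral\<^sup>L M T = e\<^sup>2 / 2 * a - e ^ 3 / 6 * b + e ^ 4 / 3 * d"
    unfolding T_def a_def b_def d_def using pow by simp
  also have "\<dots> = \<epsilon>\<^sup>2 / 2 * a - \<epsilon> ^ 3 * (\<bar>b\<bar> / 6 - \<epsilon> * d / 3)"
  proof -
    have "e ^ 3 / 6 * b = \<epsilon> ^ 3 * \<bar>b\<bar> / 6" using eb by simp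
    then show ?thesis unfolding e2 by (simp add: power3_eq_cube power4_eq_xxxx algebra_simps)
  qed
  finally have E: "entropy_of \<sigma> \<le> \<epsilon>\<^sup>2 / 2 * a - \<epsilon> ^ 3 * (\<bar>b\<bar> / 6 - \<epsilon> * d / 3)" .
  have "\<epsilon> * d \<le> \<bar>b\<bar> / (4 * (d + 1)) * (d + 1)"
    using \<epsilon> d0 by (intro mult_mono) (auto simp: \<epsilon>_def)
  also have "\<dots> = \<bar>b\<bar> / 4"
    using d0 by (subst times_divide_eq_left, subst nonzero_mult_divide_mult_cancel_right) auto
  finally have "\<bar>b\<bar> / 6 - \<epsilon> * d / 3 > 0" using v3 by (simp add: b_def)
  then have "\<epsilon> ^ 3 * (\<bar>b\<bar> / 6 - \<epsilon> * d / 3) > 0" using \<epsilon> by simp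
  then have E': "entropy_of \<sigma> < \<epsilon>\<^sup>2 / 2 * a" using E by linarith
  have "pairing (\<lambda>x. \<sigma> x - 1) (\<lambda>x. \<sigma> x - 1) = pairing (\<lambda>x. e * v x) (\<lambda>x. e * v x)"
    unfolding pairing_def potential_def
    by (intro Bochner_Integration.integral_cong refl arg_cong2[where f = "(*)"]) (auto simp: \<sigma>eq)
  also have "\<dots> = \<epsilon>\<^sup>2 * (- lam * a)"
    using pairing_lincomb_self[OF vi vi, of e 0] v2 by (simp add: e2 a_def)
  finally have "energy (1 / lam) \<sigma> - c0 / 2 = lam * (entropy_of \<sigma> - \<epsilon>\<^sup>2 / 2 * a)"
    using energy_excess[OF \<sigma>, of "1 / lam"] by (simp add: algebra_simps)
  also have "\<dots> < 0" using E' lam by (simp add: mult_pos_neg)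
  finally show ?thesis using \<sigma> unfolding uniform_minimal_def by (metis diff_less_0_iff_less not_le)
qed

text \<open>Split \<open>u = \<rho> - 1\<close> into \<open>u1 = min u d\<close>, which is bounded, and the excess \<open>u2\<close>. The hypothesis
  on the quadratic form applies to \<open>u1\<close>, whose contribution is beaten by the quadratic part of the
  entropy because \<open>lam * \<gamma> < 1\<close>. All terms with \<open>u2\<close>, including the mean of \<open>u1\<close>, are at most a
  multiple of \<open>\<parallel>u\<parallel>\<^sub>1 \<parallel>u2\<parallel>\<^sub>1\<close> and are beaten by the linear part of the entropy once \<open>\<parallel>u\<parallel>\<^sub>1\<close> is
  small.\<close>

lemma uniform_L1_local_minimal:
  assumes lam: "lam > 0" and C: "C \<ge> 0" and \<gamma>: "\<gamma> > 0" "lam * \<gamma> < 1"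
    and lower: "\<And>u. u \<in> borel_measurable M \<Longrightarrow> (\<And>x. \<bar>u x\<bar> \<le> 1) \<Longrightarrow>
      - lam * (LINT x|M. (u x)\<^sup>2) - C * (LINT x|M. u x)\<^sup>2 \<le> pairing u u"
  shows "\<exists>\<eta>>0. \<forall>\<rho>. finite_entropy_density \<rho> \<longrightarrow> (LINT x|M. \<bar>\<rho> x - 1\<bar>) < \<eta> \<longrightarrow> c0 / 2 \<le> energy \<gamma> \<rho>"
proof -
  \<comment> \<open>With this threshold \<open>(1 - d) / \<gamma>\<close> is \<open>lam\<close>, so the quadratic terms balance exactly.\<close>
  define d where "d = 1 - lam * \<gamma>"
  have d: "0 < d" "d \<le> 1" using lam \<gamma> by (auto simp: d_def)
  define c where "c = ln (1 + d)"
  have c: "c > 0" using d by (simp add: c_def)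
  define \<eta> where "\<eta> = 2 * c / (\<gamma> * (3 * B + C + 1))"
  have pos: "3 * B + C + 1 > 0" using B_nonneg C by simp
  have \<eta>: "\<eta> > 0" using c \<gamma> pos by (simp add: \<eta>_def)
  have "c0 / 2 \<le> energy \<gamma> \<rho>" if \<rho>: "finite_entropy_density \<rho>" and h: "(LINT x|M. \<bar>\<rho> x - 1\<bar>) < \<eta>" for \<rho>
  proof -
    note D = finite_entropy_densityD[OF \<rho>]
    have [measurable]: "\<rho> \<in> borel_measurable M" by (rule D)
    define u u1 u2 where "u = (\<lambda>x. \<rho> x - 1)" and "u1 = (\<lambda>x. min (u x) d)" and "u2 = (\<lambda>x. u x - u1 x)"
    have [measurable]: "u \<in> borel_measurable M" "u1 \<in> borel_measurable M" "u2 \<in> borel_measurable M"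
      unfolding u2_def u1_def u_def by measurable
    have um: "u x \<ge> -1" for x using D by (simp add: u_def)
    have u1b: "\<bar>u1 x\<bar> \<le> 1" for x using um[of x] d by (auto simp: u1_def min_def abs_le_iff)
    have ui: "integrable M u" using D by (simp add: u_def)
    have u1i: "integrable M u1" "integrable M (\<lambda>x. (u1 x)\<^sup>2)"
      using u1b by (auto intro!: integrable_const_bound[where B = 1] AE_I2 simp: power_le_one_iff abs_square_le_1)
    have u2i: "integrable M u2" using ui u1i by (simp add: u2_def)
    have u2p: "0 \<le> u2 x" "u2 x \<le> \<bar>u x\<bar>" for x using d by (auto simp: u2_def u1_def min_def)
    define hh a where "hh = (LINT x|M. \<bar>u x\<bar>)" and "a = (LINT x|M. u2 x)"
    have a0: "0 \<le> a" unfolding a_def using u2p by (intro Bochner_Integration.integral_nonneg)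
    have ah: "a \<le> hh" unfolding a_def hh_def using u2p u2i ui by (intro integral_mono) auto
    have "(LINT x|M. u x) = 0" using D by (simp add: u_def prob_space)
    then have m1: "(LINT x|M. u1 x) = - a" unfolding a_def u2_def using ui u1i by simp
    have abs2: "(LINT x|M. \<bar>u2 x\<bar>) = a" using u2p by (simp add: a_def)
    have "u1 = (\<lambda>x. 1 * u x + (-1) * u2 x)" by (auto simp: u2_def)
    then have "pairing u1 u1 = pairing u u - 2 * pairing u u2 + pairing u2 u2"
      using pairing_lincomb_self[OF ui u2i, of 1 "-1"] by simp
    moreover have "\<bar>pairing u u2\<bar> \<le> B * hh * a"
      using pairing_bound[OF ui u2i] by (simp add: hh_def abs2)
    moreover have "\<bar>pairing u2 u2\<bar> \<le> B * hh * a"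
    proof -
      have "\<bar>pairing u2 u2\<bar> \<le> B * a * a" using pairing_bound[OF u2i u2i] by (simp add: abs2)
      also have "\<dots> \<le> B * hh * a" using ah a0 B_nonneg by (intro mult_right_mono mult_left_mono)
      finally show ?thesis .
    qed
    moreover have "- lam * (LINT x|M. (u1 x)\<^sup>2) - C * a\<^sup>2 \<le> pairing u1 u1"
      using lower[of u1] u1b by (simp add: m1)
    moreover have "C * a\<^sup>2 \<le> C * hh * a"
      unfolding power2_eq_square mult.assoc using ah a0 C by (intro mult_left_mono mult_right_mono)
    ultimately have P: "- lam * (LINT x|M. (u1 x)\<^sup>2) - 3 * (B * hh * a) - C * hh * a \<le> pairing u u"
      by (simp add: abs_le_iff)
    have "(LINT x|M. (1 - d) / 2 * (u1 x)\<^sup>2 + c * u2 x) \<le> entropy_of \<rho>"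
      unfolding entropy_of_def
    proof (rule integral_mono)
      fix x show "(1 - d) / 2 * (u1 x)\<^sup>2 + c * u2 x \<le> rel_entropy_fun (\<rho> x)"
        using rel_entropy_fun_truncated_lower[OF d um[of x]] by (simp add: u1_def u2_def c_def u_def)
    qed (use u1i u2i D in auto)
    then have "lam * \<gamma> / 2 * (LINT x|M. (u1 x)\<^sup>2) + c * a \<le> entropy_of \<rho>"
      using u1i u2i by (simp add: a_def d_def)
    then have "(lam * \<gamma> / 2 * (LINT x|M. (u1 x)\<^sup>2) + c * a) / \<gamma> \<le> entropy_of \<rho> / \<gamma>"
      using \<gamma> by (intro divide_right_mono) auto
    then have E: "lam / 2 * (LINT x|M. (u1 x)\<^sup>2) + c / \<gamma> * a \<le> entropy_of \<rho> / \<gamma>"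
      using \<gamma> by (simp add: add_divide_distrib)
    have "hh * (3 * B + C) \<le> \<eta> * (3 * B + C + 1)"
      using h \<eta> B_nonneg C by (intro mult_mono) (auto simp: hh_def u_def)
    also have "\<dots> = 2 * (c / \<gamma>)" using pos \<gamma> by (simp add: \<eta>_def)
    finally have "hh * (3 * B + C) * a \<le> 2 * (c / \<gamma>) * a" using a0 by (rule mult_right_mono)
    then have "3 * (B * hh * a) + C * hh * a \<le> 2 * (c / \<gamma> * a)" by (simp add: algebra_simps)
    then have "0 \<le> entropy_of \<rho> / \<gamma> + pairing u u / 2" using E P by simp
    then show ?thesis using energy_excess[OF \<rho>, of \<gamma>] by (simp add: u_def)
  qed
  then show ?thesis using \<eta> by blast
qed

text \<open>The critical parameter is the supremum of the parameters with a uniform minimizer. Since it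
  lies strictly below \<open>1 / lam\<close>, local minimality still holds at some \<open>\<gamma>1 > \<gamma>c\<close>, and with it, by
  monotonicity in \<open>\<gamma>\<close>, on all of \<open>(\<gamma>c, \<gamma>1]\<close> with the same radius \<open>\<eta>\<close>.\<close>

theorem discontinuous_transition:
  assumes lam: "lam > 0" and C: "C \<ge> 0"
    and lower: "\<And>u. u \<in> borel_measurable M \<Longrightarrow> (\<And>x. \<bar>u x\<bar> \<le> 1) \<Longrightarrow>
      - lam * (LINT x|M. (u x)\<^sup>2) - C * (LINT x|M. u x)\<^sup>2 \<le> pairing u u"
    and v: "v \<in> borel_measurable M" and V: "\<And>x. x \<in> space M \<Longrightarrow> \<bar>v x\<bar> \<le> V"
    and v1: "(LINT x|M. v x) = 0" and v2: "pairing v v = - lam * (LINT x|M. (v x)\<^sup>2)"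
    and v3: "(LINT x|M. v x ^ 3) \<noteq> 0"
  obtains \<gamma>c \<gamma>1 \<eta> where "0 < \<gamma>c" "\<gamma>c < \<gamma>1" "\<gamma>1 < 1 / lam" "0 < \<eta>"
    "uniform_minimal \<gamma>c" "\<And>\<gamma>. \<gamma> > \<gamma>c \<Longrightarrow> \<not> uniform_minimal \<gamma>"
    "\<And>\<gamma> \<rho>. \<gamma>c < \<gamma> \<Longrightarrow> \<gamma> \<le> \<gamma>1 \<Longrightarrow> finite_entropy_density \<rho> \<Longrightarrow> energy \<gamma> \<rho> < c0 / 2 \<Longrightarrow>
      \<eta> \<le> (LINT x|M. \<bar>\<rho> x - 1\<bar>)"
proof -
  define S where "S = {\<gamma>. \<gamma> > 0 \<and> uniform_minimal \<gamma>}"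
  have not_sharp: "\<not> uniform_minimal (1 / lam)"
    using cubic_instability[OF lam v V v1 v2 v3] .
  have S_ub: "\<gamma> < 1 / lam" if "\<gamma> \<in> S" for \<gamma>
    using that not_sharp uniform_minimal_antimono[of \<gamma> "1 / lam"] lam by (force simp: S_def not_less)
  then have bdd: "bdd_above S" by (meson bdd_aboveI less_imp_le)
  have s0: "1 / (2 * B + 1) \<in> S"
    using B_nonneg uniform_minimal_small[of "1 / (2 * B + 1)"] by (auto simp: S_def field_simps)
  define \<gamma>c where "\<gamma>c = Sup S"
  have "1 / (2 * B + 1) \<le> \<gamma>c" unfolding \<gamma>c_def using s0 bdd by (rule cSup_upper)
  moreover have "1 / (2 * B + 1) > 0" using B_nonneg by simp
  ultimately have c0': "\<gamma>c > 0" by linarith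
  have cS: "uniform_minimal \<gamma>c"
  proof (rule uniform_minimal_closed[OF c0'])
    fix \<gamma> assume "0 < \<gamma>" "\<gamma> < \<gamma>c"
    then obtain \<gamma>' where "\<gamma>' \<in> S" "\<gamma> < \<gamma>'" unfolding \<gamma>c_def using s0 bdd
      by (metis empty_iff less_cSup_iff)
    then show "uniform_minimal \<gamma>" using uniform_minimal_antimono[of \<gamma>' \<gamma>] \<open>0 < \<gamma>\<close> by (simp add: S_def)
  qed
  have above: "\<not> uniform_minimal \<gamma>" if "\<gamma> > \<gamma>c" for \<gamma>
  proof
    assume "uniform_minimal \<gamma>"
    then have "\<gamma> \<in> S" using that c0' by (simp add: S_def)
    then have "\<gamma> \<le> \<gamma>c" unfolding \<gamma>c_def using bdd by (rule cSup_upper)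
    then show False using that by simp
  qed
  have "\<gamma>c \<in> S" using c0' cS by (simp add: S_def)
  then have "\<gamma>c < 1 / lam" by (rule S_ub)
  then obtain \<gamma>1 where \<gamma>1: "\<gamma>c < \<gamma>1" "\<gamma>1 < 1 / lam" using dense by blast
  have "lam * \<gamma>1 < 1" using \<gamma>1 lam by (simp add: field_simps)
  then have "\<exists>\<eta>>0. \<forall>\<rho>. finite_entropy_density \<rho> \<longrightarrow> (LINT x|M. \<bar>\<rho> x - 1\<bar>) < \<eta> \<longrightarrow> c0 / 2 \<le> energy \<gamma>1 \<rho>"
    by (intro uniform_L1_local_minimal[OF lam C less_trans[OF c0' \<gamma>1(1)]] lower)
  then obtain \<eta> where \<eta>: "\<eta> > 0"
    "\<forall>\<rho>. finite_entropy_density \<rho> \<longrightarrow> (LINT x|M. \<bar>\<rho> x - 1\<bar>) < \<eta> \<longrightarrow> c0 / 2 \<le> energy \<gamma>1 \<rho>"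
    by (elim exE conjE)
  have far: "\<eta> \<le> (LINT x|M. \<bar>\<rho> x - 1\<bar>)"
    if "\<gamma>c < \<gamma>" "\<gamma> \<le> \<gamma>1" "finite_entropy_density \<rho>" "energy \<gamma> \<rho> < c0 / 2" for \<gamma> \<rho>
  proof (rule ccontr)
    assume "\<not> ?thesis"
    then have "c0 / 2 \<le> energy \<gamma>1 \<rho>" using \<eta>(2) that by simp
    moreover have "entropy_of \<rho> / \<gamma>1 \<le> entropy_of \<rho> / \<gamma>"
      using that c0' entropy_of_nonneg by (intro divide_left_mono) auto
    ultimately show False using that(4) unfolding energy_def by linarith
  qed
  show ?thesis by (rule that[OF c0' \<gamma>1 \<eta>(1) cS above far])
qed

end

section \<open>Rotation invariance of the uniform measure\<close>

lemma nn_integral_lborel_reflect: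
  fixes g :: "'a::euclidean_space \<Rightarrow> ennreal"
  assumes [measurable]: "g \<in> borel_measurable borel"
  shows "(\<integral>\<^sup>+x. g (t - x) \<partial>lborel) = (\<integral>\<^sup>+x. g x \<partial>lborel)"
proof -
  have eq: "(lborel :: 'a measure) = distr lborel borel (\<lambda>x. t - x)"
    using lborel_affine[of "-1" t] by (simp add: density_1)
  show ?thesis
    by (subst (2) eq, subst nn_integral_distr) auto
qed

lemma nn_integral_lborel_translate:
  fixes g :: "'a::euclidean_space \<Rightarrow> ennreal"
  assumes [measurable]: "g \<in> borel_measurable borel"
  shows "(\<integral>\<^sup>+x. g (x - t) \<partial>lborel) = (\<integral>\<^sup>+x. g x \<partial>lborel)"
  using nn_integral_lborel_reflect[of "\<lambda>x. g (- x)" t] nn_integral_lborel_reflect[of "\<lambda>x. g x" 0] by simp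

lemma orthogonal_borel_measurable:
  fixes f :: "'a::euclidean_space \<Rightarrow> 'a"
  assumes "orthogonal_transformation f"
  shows "f \<in> borel_measurable borel"
  using orthogonal_transformation_linear[OF assms]
  by (intro borel_measurable_continuous_onI linear_continuous_on linear_conv_bounded_linear[THEN iffD1])

text \<open>Uniqueness of a translation invariant measure, in the form of Weil's argument: computing the
  convolution of \<open>A\<close> with the unit ball \<open>D\<close> in both orders of integration gives
  \<open>\<nu> A * lborel D = \<nu> D * lborel A\<close> for the image measure \<open>\<nu>\<close>, and \<open>\<nu> D = lborel D\<close> because \<open>f\<close>
  preserves the ball.\<close>

lemma distr_lborel_orthogonal:
  fixes f :: "'a::euclidean_space \<Rightarrow> 'a"
  assumes f: "orthogonal_transformation f"
  shows "distr lborel borel f = lborel"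
proof (rule measure_eqI)
  have lin: "linear f" using f by (rule orthogonal_transformation_linear)
  have [measurable]: "f \<in> borel_measurable borel" by (rule orthogonal_borel_measurable[OF f])
  obtain g where g: "\<And>y. f (g y) = y"
    using orthogonal_transformation_surj[OF f] by (metis surjD)
  fix A assume "A \<in> sets (distr lborel borel f)"
  then have A [measurable]: "A \<in> sets borel" by simp
  define D where "D = (ball 0 1 :: 'a set)"
  have [measurable]: "D \<in> sets borel" by (simp add: D_def)
  define \<nu> where "\<nu> = distr lborel borel f"
  have [measurable_cong]: "sets \<nu> = sets borel" by (simp add: \<nu>_def)
  have "f -` D = D" using f by (auto simp: D_def orthogonal_transformation)
  then have \<nu>D: "emeasure \<nu> D = emeasure lborel D" by (simp add: \<nu>_def emeasure_distr)
  have finD: "emeasure lborel D < \<infinity>"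
    unfolding D_def by (rule emeasure_bounded_finite) simp
  have posD: "emeasure lborel D \<noteq> 0"
    using content_ball_pos[of 1 "0::'a"] by (auto simp: D_def measure_def)
  have ball: "f -` ball 0 (real i) = ball 0 (real i)" for i :: nat
    using f by (auto simp: orthogonal_transformation)
  have fin: "emeasure lborel (ball 0 (real i) :: 'a set) \<noteq> top" for i :: nat
    using emeasure_bounded_finite[of "ball 0 (real i) :: 'a set"] by simp
  have "(\<Union>i::nat. ball 0 (real i)) = (UNIV :: 'a set)"
    by auto (metis reals_Archimedean2)
  then have "\<exists>B. countable B \<and> B \<subseteq> sets \<nu> \<and> \<Union>B = space \<nu> \<and> (\<forall>a\<in>B. emeasure \<nu> a \<noteq> \<infinity>)"
    by (intro exI[of _ "range (\<lambda>i::nat. ball 0 (real i))"])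
      (auto simp: \<nu>_def emeasure_distr ball fin)
  then interpret \<nu>: sigma_finite_measure \<nu> by unfold_locales
  interpret P: pair_sigma_finite \<nu> lborel ..
  have "emeasure \<nu> A * emeasure lborel D = (\<integral>\<^sup>+x. (\<integral>\<^sup>+y. indicator A x * indicator D (y - x) \<partial>lborel) \<partial>\<nu>)"
    by (subst nn_integral_cmult, simp, subst nn_integral_lborel_translate) (auto simp: nn_integral_multc)
  also have "\<dots> = (\<integral>\<^sup>+y. (\<integral>\<^sup>+x. indicator A x * indicator D (y - x) \<partial>\<nu>) \<partial>lborel)"
    by (subst P.Fubini'[symmetric]) auto
  also have "\<dots> = (\<integral>\<^sup>+y. (\<integral>\<^sup>+x. indicator A (y - x) * indicator D x \<partial>\<nu>) \<partial>lborel)"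
  proof (rule nn_integral_cong)
    fix y
    have fd: "y - f x = f (g y - x)" for x using linear_diff[OF lin, of "g y" x] g by simp
    have "(\<integral>\<^sup>+x. indicator A x * indicator D (y - x) \<partial>\<nu>) = (\<integral>\<^sup>+x. indicator A (f x) * indicator D (y - f x) \<partial>lborel)"
      unfolding \<nu>_def by (rule nn_integral_distr) auto
    also have "\<dots> = (\<integral>\<^sup>+x. indicator A (f (g y - x)) * indicator D (y - f (g y - x)) \<partial>lborel)"
      by (rule nn_integral_lborel_reflect[symmetric]) measurable
    also have "\<dots> = (\<integral>\<^sup>+x. indicator A (y - f x) * indicator D (f x) \<partial>lborel)"
      by (simp add: fd[symmetric])
    also have "\<dots> = (\<integral>\<^sup>+x. indicator A (y - x) * indicator D x \<partial>\<nu>)"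
      unfolding \<nu>_def by (rule nn_integral_distr[symmetric]) auto
    finally show "(\<integral>\<^sup>+x. indicator A x * indicator D (y - x) \<partial>\<nu>) = (\<integral>\<^sup>+x. indicator A (y - x) * indicator D x \<partial>\<nu>)" .
  qed
  also have "\<dots> = (\<integral>\<^sup>+x. (\<integral>\<^sup>+y. indicator A (y - x) * indicator D x \<partial>lborel) \<partial>\<nu>)"
    by (subst P.Fubini') auto
  also have "\<dots> = emeasure lborel A * emeasure \<nu> D"
    by (subst nn_integral_multc, simp, subst nn_integral_lborel_translate) (auto simp: nn_integral_cmult)
  finally have "emeasure \<nu> A * emeasure lborel D = emeasure lborel A * emeasure lborel D"
    by (simp add: \<nu>D)
  then show "emeasure (distr lborel borel f) A = emeasure lborel A"
    using finD posD by (auto simp: \<nu>_def mult.commute[of _ "emeasure lborel D"] ennreal_mult_cancel_left)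
qed simp

abbreviation punctured_ball :: "(real^'n) set" where
  "punctured_ball \<equiv> cball 0 1 - {0}"

lemma sets_surface_measure: "sets surface_measure = sets (restrict_space borel unit_sphere)"
  by (simp add: surface_measure_def)

lemma space_surface_measure: "space surface_measure = unit_sphere"
  by (simp add: surface_measure_def space_restrict_space space_scale_measure)

lemma radial_projection_measurable:
  "(\<lambda>x. x /\<^sub>R norm x) \<in> measurable (restrict_space lborel punctured_ball) (restrict_space borel (unit_sphere :: (real^'n) set))"
proof (rule measurable_restrict_space2)
  show "(\<lambda>x. x /\<^sub>R norm x) \<in> space (restrict_space lborel punctured_ball) \<rightarrow> (unit_sphere :: (real^'n) set)"
    by (auto simp: space_restrict_space)
  show "(\<lambda>x::real^'n. x /\<^sub>R norm x) \<in> borel_measurable (restrict_space lborel punctured_ball)"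
    by (rule measurable_restrict_space1) measurable
qed

lemma emeasure_surface_measure:
  assumes A: "A \<in> sets (restrict_space borel (unit_sphere :: (real^'n) set))"
  shows "emeasure surface_measure A = of_nat CARD('n) * emeasure lborel {x \<in> punctured_ball. x /\<^sub>R norm x \<in> A}"
proof -
  have "emeasure surface_measure A = of_nat CARD('n) * emeasure (restrict_space lborel punctured_ball)
      ((\<lambda>x. x /\<^sub>R norm x) -` A \<inter> space (restrict_space lborel punctured_ball))"
    unfolding surface_measure_def
    by (simp only: emeasure_scale_measure emeasure_distr[OF radial_projection_measurable A])
  also have "(\<lambda>x. x /\<^sub>R norm x) -` A \<inter> space (restrict_space lborel punctured_ball) = {x \<in> punctured_ball. x /\<^sub>R norm x \<in> A}"
    by (auto simp: space_restrict_space)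
  also have "emeasure (restrict_space lborel punctured_ball) \<dots> = emeasure lborel \<dots>"
    by (rule emeasure_restrict_space) auto
  finally show ?thesis .
qed

lemma sphere_area_pos: "0 < sphere_area TYPE('n::finite)"
  and emeasure_surface_space: "emeasure (surface_measure :: (real^'n::finite) measure) unit_sphere = ennreal (sphere_area TYPE('n))"
proof -
  have S: "unit_sphere \<in> sets (restrict_space borel (unit_sphere :: (real^'n) set))"
    using sets.top[of "restrict_space borel (unit_sphere :: (real^'n) set)"] by (simp add: space_restrict_space)
  have fin: "emeasure lborel (punctured_ball :: (real^'n) set) < \<infinity>"
    by (rule emeasure_bounded_finite) (auto intro: bounded_diff)
  have "{x \<in> punctured_ball. x /\<^sub>R norm x \<in> unit_sphere} = (punctured_ball :: (real^'n) set)" by auto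
  then have eq: "emeasure (surface_measure :: (real^'n) measure) unit_sphere = of_nat CARD('n) * emeasure lborel (punctured_ball :: (real^'n) set)"
    using emeasure_surface_measure[OF S] by simp
  have "emeasure lborel (ball 0 1 :: (real^'n) set) \<noteq> 0"
    using content_ball_pos[of 1 "0::real^'n"] by (auto simp: measure_def)
  moreover have "emeasure lborel (ball 0 1 :: (real^'n) set) \<le> emeasure lborel (punctured_ball \<union> {0} :: (real^'n) set)"
    by (intro emeasure_mono) auto
  moreover have "emeasure lborel (punctured_ball \<union> {0} :: (real^'n) set) = emeasure lborel (punctured_ball :: (real^'n) set)"
    by (intro emeasure_Un_null_set) auto
  ultimately have pos: "emeasure lborel (punctured_ball :: (real^'n) set) \<noteq> 0" by auto
  have "emeasure (surface_measure :: (real^'n) measure) unit_sphere < top"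
    unfolding eq using fin by (simp add: ennreal_mult_less_top of_nat_less_top)
  then show e: "emeasure (surface_measure :: (real^'n) measure) unit_sphere = ennreal (sphere_area TYPE('n))"
    unfolding sphere_area_def by (simp add: emeasure_eq_ennreal_measure)
  have "emeasure (surface_measure :: (real^'n) measure) unit_sphere \<noteq> 0"
    unfolding eq using pos by simp
  then show "0 < sphere_area TYPE('n)" unfolding e by (auto simp: ennreal_eq_0_iff not_le)
qed

lemma sets_uniform_sphere: "sets (uniform_sphere :: (real^'n) measure) = sets (restrict_space borel unit_sphere)"
  by (simp add: uniform_sphere_def sets_surface_measure)

lemma space_uniform_sphere: "space uniform_sphere = unit_sphere"
  by (simp add: uniform_sphere_def space_surface_measure space_scale_measure)

lemma prob_space_uniform_sphere: "prob_space (uniform_sphere :: (real^'n) measure)"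
proof
  show "emeasure (uniform_sphere :: (real^'n) measure) (space uniform_sphere) = 1"
    using sphere_area_pos[where 'n='n]
    by (simp add: space_uniform_sphere) (simp add: uniform_sphere_def emeasure_surface_space ennreal_mult[symmetric])
qed

interpretation sphere: prob_space "uniform_sphere :: (real^'n) measure"
  by (rule prob_space_uniform_sphere)

lemma id_measurable_sphere [measurable]: "(\<lambda>x. x) \<in> measurable (uniform_sphere :: (real^'n) measure) borel"
  by (subst measurable_cong_sets[OF sets_uniform_sphere refl]) (rule measurable_restrict_space1, simp)

lemma borel_measurable_sphere:
  assumes "f \<in> borel_measurable borel"
  shows "f \<in> borel_measurable (uniform_sphere :: (real^'n) measure)"
  using measurable_compose[OF id_measurable_sphere assms] .

lemma continuous_bounded_on_sphere:
  fixes f :: "real^'n \<Rightarrow> real"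
  assumes "continuous_on UNIV f"
  shows "\<exists>C. \<forall>x\<in>unit_sphere. \<bar>f x\<bar> \<le> C"
proof -
  have "bounded (f ` unit_sphere)"
    using assms by (intro compact_imp_bounded compact_continuous_image) (auto intro: continuous_on_subset)
  then obtain C where "\<forall>y\<in>f ` unit_sphere. norm y \<le> C" unfolding bounded_iff by blast
  then show ?thesis by (intro exI[of _ C]) auto
qed

lemma integrable_sphere:
  fixes f :: "real^'n \<Rightarrow> real"
  assumes f: "continuous_on UNIV f"
  shows "integrable uniform_sphere f"
proof -
  obtain C where "\<forall>x\<in>unit_sphere. \<bar>f x\<bar> \<le> C"
    using continuous_bounded_on_sphere[OF f] by blast
  then show ?thesis
    using f by (intro sphere.integrable_const_bound[where B = C] borel_measurable_sphere borel_measurable_continuous_onI)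
      (auto simp: space_uniform_sphere)
qed

lemma orthogonal_measurable_sphere:
  fixes R :: "real^'n \<Rightarrow> real^'n"
  assumes R: "orthogonal_transformation R"
  shows "R \<in> measurable uniform_sphere uniform_sphere"
proof (subst measurable_cong_sets[OF sets_uniform_sphere sets_uniform_sphere])
  show "R \<in> measurable (restrict_space borel unit_sphere) (restrict_space borel unit_sphere)"
    using R by (intro measurable_restrict_space2 measurable_restrict_space1 orthogonal_borel_measurable)
      (auto simp: space_restrict_space orthogonal_transformation)
qed

text \<open>An orthogonal map commutes with the radial projection and preserves the punctured ball, so
  its invariance passes from Lebesgue measure to the cone measure.\<close>

lemma distr_uniform_sphere_orthogonal:
  fixes R :: "real^'n \<Rightarrow> real^'n"
  assumes R: "orthogonal_transformation R"
  shows "distr uniform_sphere uniform_sphere R = uniform_sphere"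
proof -
  have lin: "linear R" using R by (rule orthogonal_transformation_linear)
  have norm: "norm (R x) = norm x" for x using R by (simp add: orthogonal_transformation)
  have Rb [measurable]: "R \<in> borel_measurable borel" by (rule orthogonal_borel_measurable[OF R])
  note Rm = orthogonal_measurable_sphere[OF R]
  show ?thesis
  proof (rule measure_eqI)
    fix A assume "A \<in> sets (distr uniform_sphere uniform_sphere R)"
    then have A: "A \<in> sets uniform_sphere" by simp
    then have A': "A \<in> sets (restrict_space borel unit_sphere)" by (simp add: sets_uniform_sphere)
    have RA: "R -` A \<inter> unit_sphere \<in> sets uniform_sphere"
      using measurable_sets[OF Rm A] by (simp add: space_uniform_sphere)
    then have RA': "R -` A \<inter> unit_sphere \<in> sets (restrict_space borel unit_sphere)" by (simp add: sets_uniform_sphere)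
    have SA: "{x \<in> punctured_ball. x /\<^sub>R norm x \<in> A} \<in> sets lborel"
    proof -
      have "(\<lambda>x. x /\<^sub>R norm x) -` A \<inter> space (restrict_space lborel punctured_ball) \<in> sets (restrict_space lborel punctured_ball)"
        using radial_projection_measurable A' by (rule measurable_sets)
      then have "(\<lambda>x. x /\<^sub>R norm x) -` A \<inter> punctured_ball \<in> sets lborel"
        by (subst (asm) sets_restrict_space_iff) (auto simp: space_restrict_space)
      moreover have "(\<lambda>x. x /\<^sub>R norm x) -` A \<inter> punctured_ball = {x \<in> punctured_ball. x /\<^sub>R norm x \<in> A}" by auto
      ultimately show ?thesis by simp
    qed
    have "{x \<in> punctured_ball. x /\<^sub>R norm x \<in> R -` A \<inter> unit_sphere} = R -` {x \<in> punctured_ball. x /\<^sub>R norm x \<in> A}"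
    proof (intro set_eqI)
      fix x
      have "R (x /\<^sub>R norm x) = R x /\<^sub>R norm (R x)" by (simp add: norm linear_scale[OF lin])
      moreover have "R x \<in> punctured_ball \<longleftrightarrow> x \<in> punctured_ball"
        using norm[of x] by (metis Diff_iff insert_iff empty_iff mem_cball_0 norm_eq_zero)
      moreover have "x /\<^sub>R norm x \<in> unit_sphere" if "x \<in> punctured_ball" using that by simp
      ultimately show "x \<in> {x \<in> punctured_ball. x /\<^sub>R norm x \<in> R -` A \<inter> unit_sphere} \<longleftrightarrow>
          x \<in> R -` {x \<in> punctured_ball. x /\<^sub>R norm x \<in> A}" by (simp only: mem_Collect_eq vimage_eq Int_iff) blast
    qed
    then have "emeasure lborel {x \<in> punctured_ball. x /\<^sub>R norm x \<in> R -` A \<inter> unit_sphere}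
        = emeasure (distr lborel borel R) {x \<in> punctured_ball. x /\<^sub>R norm x \<in> A}"
      using SA by (simp add: emeasure_distr)
    also have "\<dots> = emeasure lborel {x \<in> punctured_ball. x /\<^sub>R norm x \<in> A}"
      by (simp add: distr_lborel_orthogonal[OF R])
    finally have "emeasure surface_measure (R -` A \<inter> unit_sphere) = emeasure surface_measure A"
      using A' RA' by (simp add: emeasure_surface_measure)
    then have "emeasure uniform_sphere (R -` A \<inter> unit_sphere) = emeasure uniform_sphere A"
      by (simp add: uniform_sphere_def)
    then show "emeasure (distr uniform_sphere uniform_sphere R) A = emeasure uniform_sphere A"
      using A by (simp add: emeasure_distr[OF Rm] space_uniform_sphere)
  qed simp
qed

lemma integral_sphere_orthogonal:
  fixes f :: "real^'n \<Rightarrow> real" and R :: "real^'n \<Rightarrow> real^'n"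
  assumes R: "orthogonal_transformation R" and f: "f \<in> borel_measurable borel"
  shows "(LINT x|uniform_sphere. f (R x)) = (LINT x|uniform_sphere. f x)"
proof -
  note Rm = orthogonal_measurable_sphere[OF R]
  have "(LINT x|uniform_sphere. f (R x)) = (LINT x|distr uniform_sphere uniform_sphere R. f x)"
    by (rule integral_distr[symmetric, OF Rm borel_measurable_sphere[OF f]])
  then show ?thesis by (simp add: distr_uniform_sphere_orthogonal[OF R])
qed

section \<open>The divergence theorem on the sphere\<close>

text \<open>The infinitesimal form of rotation invariance. Along the rotation \<open>R \<theta>\<close> in the plane of \<open>e\<close>
  and \<open>f\<close> the integrand is the derivative of \<open>H (R \<theta> y)\<close>, which integrates to \<open>0\<close> over a full
  turn; by Fubini's theorem and invariance this integral is \<open>2\<pi>\<close> times the claimed one.\<close>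

lemma integral_rotation_generator:
  fixes H :: "real^'n \<Rightarrow> real" and G :: "real^'n \<Rightarrow> real^'n" and e f :: "real^'n"
  assumes H: "\<And>y. (H has_derivative (\<lambda>v. G y \<bullet> v)) (at y)"
    and G: "continuous_on UNIV G"
    and ef: "norm e = 1" "norm f = 1" "e \<bullet> f = 0"
  shows "(LINT y|uniform_sphere. G y \<bullet> ((y \<bullet> e) *\<^sub>R f - (y \<bullet> f) *\<^sub>R e)) = 0"
proof -
  have ee: "e \<bullet> e = 1" "f \<bullet> f = 1" "f \<bullet> e = 0" using ef by (simp_all add: norm_eq_1 inner_commute)
  define J where "J y = (y \<bullet> e) *\<^sub>R f - (y \<bullet> f) *\<^sub>R e" for y
  define P where "P y = (y \<bullet> e) *\<^sub>R e + (y \<bullet> f) *\<^sub>R f" for y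
  define R where "R \<theta> y = y + (cos \<theta> - 1) *\<^sub>R P y + sin \<theta> *\<^sub>R J y" for \<theta> y
  define D where "D y = G y \<bullet> J y" for y
  have orth: "orthogonal_transformation (R \<theta>)" for \<theta>
    unfolding orthogonal_transformation
  proof (intro conjI allI)
    show "linear (R \<theta>)"
      unfolding R_def P_def J_def
      by (rule linearI) (simp_all add: inner_add_left scaleR_add_left scaleR_add_right scaleR_diff_right mult.left_commute)
    fix y
    define a b c s where "a = y \<bullet> e" and "b = y \<bullet> f" and "c = cos \<theta> - 1" and "s = sin \<theta>"
    have "R \<theta> y \<bullet> R \<theta> y = y \<bullet> y + 2 * c * (a\<^sup>2 + b\<^sup>2) + (c\<^sup>2 + s\<^sup>2) * (a\<^sup>2 + b\<^sup>2)"
      unfolding R_def P_def J_def a_def[symmetric] b_def[symmetric] c_def[symmetric] s_def[symmetric]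
      by (simp add: inner_add_left inner_add_right inner_diff_left inner_diff_right ee ef(3)
          inner_commute[of e y] inner_commute[of f y] a_def[symmetric] b_def[symmetric] power2_eq_square algebra_simps)
    also have "\<dots> = y \<bullet> y + (a\<^sup>2 + b\<^sup>2) * (2 * c + c\<^sup>2 + s\<^sup>2)" by (simp add: algebra_simps)
    also have "2 * c + c\<^sup>2 + s\<^sup>2 = 0"
      unfolding c_def s_def using sin_cos_squared_add[of \<theta>] by (simp add: power2_eq_square algebra_simps)
    finally show "norm (R \<theta> y) = norm y" by (simp add: norm_eq_sqrt_inner)
  qed
  have JR: "J (R \<theta> y) = (- sin \<theta>) *\<^sub>R P y + cos \<theta> *\<^sub>R J y" for \<theta> y
  proof -
    have "R \<theta> y \<bullet> e = cos \<theta> * (y \<bullet> e) - sin \<theta> * (y \<bullet> f)" "R \<theta> y \<bullet> f = cos \<theta> * (y \<bullet> f) + sin \<theta> * (y \<bullet> e)"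
      by (simp_all add: R_def P_def J_def inner_add_left inner_diff_left ee ef(3) left_diff_distrib)
    then show ?thesis
      unfolding J_def[of "R \<theta> y"] by (simp add: J_def P_def scaleR_left_diff_distrib scaleR_add_left scaleR_diff_right scaleR_add_right)
  qed
  have Rd: "((\<lambda>\<theta>. R \<theta> y) has_vector_derivative J (R \<theta> y)) (at \<theta> within S)" for \<theta> y S
    unfolding JR unfolding R_def by (auto intro!: derivative_eq_intros)
  have cR: "continuous_on UNIV (\<lambda>p. R (snd p) (fst p))"
    unfolding R_def P_def J_def by (intro continuous_intros)
  have cD: "continuous_on UNIV D"
    unfolding D_def J_def by (intro continuous_intros G)
  have cDR: "continuous_on UNIV (\<lambda>p. D (R (snd p) (fst p)))"
    using continuous_on_compose2[OF cD cR] by simp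
  have Hd: "((\<lambda>\<theta>. H (R \<theta> y)) has_vector_derivative D (R \<theta> y)) (at \<theta> within S)" for \<theta> y S
  proof -
    have "((H \<circ> (\<lambda>\<theta>. R \<theta> y)) has_vector_derivative (G (R \<theta> y) \<bullet> J (R \<theta> y))) (at \<theta> within S)"
      by (rule vector_derivative_diff_chain_within[OF Rd has_derivative_at_withinI[OF H]])
    then show ?thesis by (simp add: D_def o_def)
  qed
  have zero: "(LINT \<theta>|lborel. indicator {0..2 * pi} \<theta> *\<^sub>R D (R \<theta> y)) = 0" for y
  proof -
    have "continuous_on UNIV (\<lambda>\<theta>. D (R \<theta> y))"
    proof -
      have "continuous_on UNIV (\<lambda>\<theta>::real. (y, \<theta>))" by (intro continuous_intros)
      from continuous_on_compose2[OF cDR this] show ?thesis by simp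
    qed
    then have "continuous_on {0..2*pi} (\<lambda>\<theta>. D (R \<theta> y))" by (rule continuous_on_subset) simp
    then have "(LINT \<theta>|lborel. indicator {0..2 * pi} \<theta> *\<^sub>R D (R \<theta> y)) = H (R (2 * pi) y) - H (R 0 y)"
      by (intro integral_FTC_atLeastAtMost Hd) auto
    then show ?thesis by (simp add: R_def)
  qed
  obtain C where C: "\<forall>y\<in>unit_sphere. \<bar>D y\<bar> \<le> C" using continuous_bounded_on_sphere[OF cD] by blast
  have nR: "norm (R \<theta> y) = norm y" for \<theta> y using orth by (simp add: orthogonal_transformation)
  interpret I: finite_measure "restrict_space lborel {0..2 * pi}"
    by (rule finite_measureI) (simp add: emeasure_restrict_space space_restrict_space)
  interpret P: pair_sigma_finite "uniform_sphere :: (real^'n) measure" "restrict_space lborel {0..2 * pi}" ..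
  interpret PF: finite_measure "(uniform_sphere :: (real^'n) measure) \<Otimes>\<^sub>M restrict_space lborel {0..2 * pi}"
    by (rule finite_measure_pair_measure) unfold_locales
  have meas: "(\<lambda>(y, \<theta>). D (R \<theta> y)) \<in> borel_measurable (uniform_sphere \<Otimes>\<^sub>M restrict_space lborel {0..2 * pi})"
  proof -
    have "(\<lambda>\<theta>. \<theta>) \<in> measurable (restrict_space lborel {0..2 * pi}) (borel :: real measure)"
      by (rule measurable_restrict_space1) simp
    then have "(\<lambda>p. (fst p, snd p)) \<in> measurable ((uniform_sphere :: (real^'n) measure) \<Otimes>\<^sub>M restrict_space lborel {0..2 * pi}) (borel \<Otimes>\<^sub>M borel)"
      by (intro measurable_Pair measurable_compose[OF measurable_fst id_measurable_sphere] measurable_compose[OF measurable_snd])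
    moreover have "(\<lambda>p. D (R (snd p) (fst p))) \<in> borel_measurable (borel \<Otimes>\<^sub>M borel)"
      using cDR unfolding borel_prod by (rule borel_measurable_continuous_onI)
    ultimately have "(\<lambda>p. D (R (snd (fst p, snd p)) (fst (fst p, snd p))))
      \<in> borel_measurable ((uniform_sphere :: (real^'n) measure) \<Otimes>\<^sub>M restrict_space lborel {0..2 * pi})"
      by (rule measurable_compose)
    then show ?thesis by (simp add: case_prod_beta)
  qed
  have int: "integrable (uniform_sphere \<Otimes>\<^sub>M restrict_space lborel {0..2 * pi}) (\<lambda>(y, \<theta>). D (R \<theta> y))"
    using C nR by (intro PF.integrable_const_bound[where B = C] meas)
      (auto simp: space_pair_measure space_uniform_sphere)
  have "0 = (LINT y|uniform_sphere. LINT \<theta>|restrict_space lborel {0..2 * pi}. D (R \<theta> y))"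
    by (subst integral_restrict_space) (auto simp: zero[unfolded real_scaleR_def])
  also have "\<dots> = (LINT \<theta>|restrict_space lborel {0..2 * pi}. LINT y|uniform_sphere. D (R \<theta> y))"
    using P.Fubini_integral[OF int] by simp
  also have "\<dots> = (LINT \<theta>|restrict_space lborel {0..2 * pi}. LINT y|uniform_sphere. D y)"
    using orth cD by (intro Bochner_Integration.integral_cong refl integral_sphere_orthogonal borel_measurable_continuous_onI)
  also have "\<dots> = 2 * pi * (LINT y|uniform_sphere. D y)"
    by (simp add: measure_restrict_space space_restrict_space)
  finally show ?thesis by (simp add: D_def J_def)
qed

text \<open>Sum \<open>integral_rotation_generator\<close> for \<open>(y \<bullet> f) h\<close> over the basis vectors \<open>f \<noteq> e\<close>, with the
  rotation in the plane of \<open>f\<close> and \<open>e\<close>; on the sphere \<open>y \<bullet> y = 1\<close> collapses the sums.\<close>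

lemma sphere_divergence_Basis:
  fixes h :: "real^'n \<Rightarrow> real" and g :: "real^'n \<Rightarrow> real^'n" and e :: "real^'n"
  assumes h: "\<And>y. (h has_derivative (\<lambda>v. g y \<bullet> v)) (at y)"
    and g: "continuous_on UNIV g" and e: "e \<in> Basis"
  shows "(LINT y|uniform_sphere. g y \<bullet> e - (y \<bullet> e) * (g y \<bullet> y) - (real CARD('n) - 1) * (y \<bullet> e) * h y) = 0"
proof -
  have ch: "continuous_on UNIV h"
    using h by (intro has_derivative_continuous_on[where f' = "\<lambda>y v. g y \<bullet> v"]) (auto intro: has_derivative_at_withinI)
  define F where "F f y = (h y *\<^sub>R f + (y \<bullet> f) *\<^sub>R g y) \<bullet> ((y \<bullet> f) *\<^sub>R e - (y \<bullet> e) *\<^sub>R f)" for f y :: "real^'n"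
  have cF: "continuous_on UNIV (F f)" for f
    unfolding F_def by (intro continuous_intros ch g)
  have F0: "(LINT y|uniform_sphere. F f y) = 0" if "f \<in> Basis - {e}" for f
    unfolding F_def
  proof (rule integral_rotation_generator[where H = "\<lambda>y. (y \<bullet> f) * h y"])
    fix y show "((\<lambda>y. (y \<bullet> f) * h y) has_derivative (\<lambda>v. (h y *\<^sub>R f + (y \<bullet> f) *\<^sub>R g y) \<bullet> v)) (at y)"
      using h[of y] by (auto intro!: derivative_eq_intros simp: inner_add_left algebra_simps inner_commute)
  next
    show "continuous_on UNIV (\<lambda>y. h y *\<^sub>R f + (y \<bullet> f) *\<^sub>R g y)" by (intro continuous_intros ch g)
  qed (use that e in \<open>auto simp: inner_Basis\<close>)
  have "(LINT y|uniform_sphere. g y \<bullet> e - (y \<bullet> e) * (g y \<bullet> y) - (real CARD('n) - 1) * (y \<bullet> e) * h y)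
      = (LINT y|uniform_sphere. (\<Sum>f\<in>Basis - {e}. F f y))"
  proof (intro Bochner_Integration.integral_cong refl)
    fix y :: "real^'n" assume "y \<in> space uniform_sphere"
    then have y: "y \<bullet> y = 1" by (simp add: space_uniform_sphere norm_eq_1)
    have Fe: "F f y = (g y \<bullet> e) * ((y \<bullet> f) * (y \<bullet> f)) - (y \<bullet> e) * ((y \<bullet> f) * (g y \<bullet> f)) - (y \<bullet> e) * h y" if "f \<in> Basis - {e}" for f
    proof -
      have "f \<bullet> e = 0" "f \<bullet> f = 1" using that e by (auto simp: inner_Basis)
      then show ?thesis by (simp add: F_def inner_add_left inner_diff_right algebra_simps)
    qed
    have s: "(\<Sum>f\<in>Basis - {e}. a f) = (\<Sum>f\<in>Basis. a f) - a e" for a :: "real^'n \<Rightarrow> real"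
      using e by (simp add: sum_diff1)
    have "(\<Sum>f\<in>Basis - {e}. F f y) = (\<Sum>f\<in>Basis - {e}. (g y \<bullet> e) * ((y \<bullet> f) * (y \<bullet> f)) - (y \<bullet> e) * ((y \<bullet> f) * (g y \<bullet> f)) - (y \<bullet> e) * h y)"
      using Fe by (intro sum.cong refl) auto
    also have "\<dots> = (g y \<bullet> e) * (\<Sum>f\<in>Basis - {e}. (y \<bullet> f) * (y \<bullet> f)) - (y \<bullet> e) * (\<Sum>f\<in>Basis - {e}. (y \<bullet> f) * (g y \<bullet> f))
         - real (card (Basis - {e})) * ((y \<bullet> e) * h y)"
      by (simp add: sum_subtractf sum_distrib_left)
    also have "(\<Sum>f\<in>Basis - {e}. (y \<bullet> f) * (y \<bullet> f)) = 1 - (y \<bullet> e) * (y \<bullet> e)"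
      using y by (simp add: s euclidean_inner[of y y])
    also have "(\<Sum>f\<in>Basis - {e}. (y \<bullet> f) * (g y \<bullet> f)) = y \<bullet> g y - (y \<bullet> e) * (g y \<bullet> e)"
      by (simp add: s euclidean_inner[of y "g y"])
    also have "real (card (Basis - {e})) = real CARD('n) - 1"
    proof -
      have "card (Basis - {e}) = CARD('n) - 1" using e by (simp add: card_Diff_singleton)
      moreover have "CARD('n) \<ge> 1" by (simp add: Suc_leI)
      ultimately show ?thesis by (simp add: of_nat_diff)
    qed
    finally show "g y \<bullet> e - (y \<bullet> e) * (g y \<bullet> y) - (real CARD('n) - 1) * (y \<bullet> e) * h y = (\<Sum>f\<in>Basis - {e}. F f y)"
      by (simp add: inner_commute[of y "g y"] algebra_simps)
  qed
  also have "\<dots> = (\<Sum>f\<in>Basis - {e}. LINT y|uniform_sphere. F f y)"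
    using cF by (intro Bochner_Integration.integral_sum integrable_sphere)
  also have "\<dots> = 0" using F0 by simp
  finally show ?thesis .
qed

text \<open>The divergence theorem for the tangential field \<open>h(y) (z - (z \<bullet> y) y)\<close>; the divergence of
  \<open>z - (z \<bullet> y) y\<close> on the sphere is \<open>- (n - 1) (z \<bullet> y)\<close>.\<close>

lemma sphere_divergence:
  fixes h :: "real^'n \<Rightarrow> real" and g :: "real^'n \<Rightarrow> real^'n" and z :: "real^'n"
  assumes h: "\<And>y. (h has_derivative (\<lambda>v. g y \<bullet> v)) (at y)"
    and g: "continuous_on UNIV g"
  shows "(LINT y|uniform_sphere. g y \<bullet> z - (z \<bullet> y) * (g y \<bullet> y) - (real CARD('n) - 1) * (z \<bullet> y) * h y) = 0"
proof -
  have ch: "continuous_on UNIV h"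
    using h by (intro has_derivative_continuous_on[where f' = "\<lambda>y v. g y \<bullet> v"]) (auto intro: has_derivative_at_withinI)
  define F where "F e y = g y \<bullet> e - (y \<bullet> e) * (g y \<bullet> y) - (real CARD('n) - 1) * (y \<bullet> e) * h y" for e y :: "real^'n"
  have cF: "continuous_on UNIV (F f)" for f
    unfolding F_def by (intro continuous_intros ch g)
  have "(LINT y|uniform_sphere. g y \<bullet> z - (z \<bullet> y) * (g y \<bullet> y) - (real CARD('n) - 1) * (z \<bullet> y) * h y)
     = (LINT y|uniform_sphere. (\<Sum>e\<in>Basis. (z \<bullet> e) * F e y))"
  proof (intro Bochner_Integration.integral_cong refl)
    fix y
    have "(\<Sum>e\<in>Basis. (z \<bullet> e) * F e y) = (\<Sum>e\<in>Basis. (g y \<bullet> e) * (z \<bullet> e)) - (\<Sum>e\<in>Basis. (z \<bullet> e) * (y \<bullet> e)) * (g y \<bullet> y)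
      - (real CARD('n) - 1) * (\<Sum>e\<in>Basis. (z \<bullet> e) * (y \<bullet> e)) * h y"
      by (simp add: F_def sum_subtractf sum.distrib sum_distrib_left sum_distrib_right algebra_simps)
    then show "g y \<bullet> z - (z \<bullet> y) * (g y \<bullet> y) - (real CARD('n) - 1) * (z \<bullet> y) * h y = (\<Sum>e\<in>Basis. (z \<bullet> e) * F e y)"
      by (simp add: euclidean_inner[of "g y" z] euclidean_inner[of z y])
  qed
  also have "\<dots> = (\<Sum>e\<in>Basis. LINT y|uniform_sphere. (z \<bullet> e) * F e y)"
    using cF by (intro Bochner_Integration.integral_sum integrable_sphere continuous_intros)
  also have "\<dots> = 0"
    using sphere_divergence_Basis[OF h g] by (simp add: F_def)
  finally show ?thesis .
qed

text \<open>With \<open>Q = pderiv R\<close> the second summand is \<open>P (x \<bullet> y)\<close> times the Laplace-Beltrami operator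
  applied to \<open>R (z \<bullet> y)\<close>, and the first is the Dirichlet form, symmetric in \<open>P\<close>, \<open>x\<close> and \<open>R\<close>, \<open>z\<close>.
  With powers it is a recursion for moments.\<close>

lemma sphere_divergence_zonal:
  fixes P Q :: "real poly" and x z :: "real^'n"
  assumes z: "norm z = 1"
  shows "(LINT y|uniform_sphere. poly (pderiv P) (x \<bullet> y) * poly Q (z \<bullet> y) * (x \<bullet> z - (x \<bullet> y) * (z \<bullet> y))
    + poly P (x \<bullet> y) * (poly (pderiv Q) (z \<bullet> y) * (1 - (z \<bullet> y)\<^sup>2) - (real CARD('n) - 1) * (z \<bullet> y) * poly Q (z \<bullet> y))) = 0"
proof -
  define h where "h y = poly P (x \<bullet> y) * poly Q (z \<bullet> y)" for y
  define g where "g y = (poly (pderiv P) (x \<bullet> y) * poly Q (z \<bullet> y)) *\<^sub>R x + (poly P (x \<bullet> y) * poly (pderiv Q) (z \<bullet> y)) *\<^sub>R z" for y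
  have zz: "z \<bullet> z = 1" using z by (simp add: norm_eq_1)
  have pd: "((\<lambda>y. poly P (x \<bullet> y)) has_derivative (\<lambda>v. (x \<bullet> v) * poly (pderiv P) (x \<bullet> y))) (at y)" for P and x y :: "real^'n"
  proof -
    have "((\<lambda>y. x \<bullet> y) has_derivative (\<lambda>v. x \<bullet> v)) (at y)" by (intro derivative_intros)
    moreover have "(poly P has_derivative (\<lambda>t. t * poly (pderiv P) (x \<bullet> y))) (at (x \<bullet> y))"
      using poly_DERIV[of P "x \<bullet> y"] by (simp add: has_field_derivative_def mult.commute[of "poly (pderiv P) (x \<bullet> y)"] mult_commute_abs)
    ultimately show ?thesis using has_derivative_compose[of "\<lambda>y. x \<bullet> y" "\<lambda>v. x \<bullet> v" y UNIV "poly P"] by simp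
  qed
  have "(h has_derivative (\<lambda>v. g y \<bullet> v)) (at y)" for y
    unfolding h_def
    by (rule has_derivative_eq_rhs[OF has_derivative_mult[OF pd pd]]) (auto simp: g_def inner_add_left algebra_simps)
  moreover have "continuous_on UNIV g" unfolding g_def by (intro continuous_intros)
  ultimately have "(LINT y|uniform_sphere. g y \<bullet> z - (z \<bullet> y) * (g y \<bullet> y) - (real CARD('n) - 1) * (z \<bullet> y) * h y) = 0"
    by (rule sphere_divergence)
  then show ?thesis
    by (simp add: g_def h_def inner_add_left zz algebra_simps power2_eq_square)
qed

section \<open>Gegenbauer polynomials\<close>

text \<open>The Gegenbauer functions as formal polynomials, so that degrees and derivatives are
  available.\<close>

fun gegenbauer_poly :: "real \<Rightarrow> nat \<Rightarrow> real poly" where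
  "gegenbauer_poly a 0 = 1"
| "gegenbauer_poly a (Suc 0) = [:0, 2 * a:]"
| "gegenbauer_poly a (Suc (Suc k)) = smult (1 / (real k + 2))
     (smult (2 * (a + real k + 1)) ([:0, 1:] * gegenbauer_poly a (Suc k)) - smult (2 * a + real k) (gegenbauer_poly a k))"

lemma poly_gegenbauer: "poly (gegenbauer_poly a k) t = gegenbauer a k t"
  by (induction a k rule: gegenbauer_poly.induct) simp_all

lemma gegenbauer_poly_three_term:
  "smult (real k + 2) (gegenbauer_poly a (Suc (Suc k))) =
    smult (2 * (a + real k + 1)) ([:0, 1:] * gegenbauer_poly a (Suc k)) - smult (2 * a + real k) (gegenbauer_poly a k)"
proof -
  have "(real k + 2) * (1 / (real k + 2)) = 1" by simp
  then show ?thesis by (simp only: gegenbauer_poly.simps smult_smult smult_1_left)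
qed

lemma poly_pderiv_mult: "poly (pderiv (p * q)) t = poly (pderiv p) t * poly q t + poly p t * poly (pderiv q) t"
  for p q :: "real poly"
  by (simp add: pderiv_mult algebra_simps)

lemma gegenbauer_poly_rec:
  "(real k + 2) * poly (gegenbauer_poly a (Suc (Suc k))) t =
    2 * (a + real k + 1) * t * poly (gegenbauer_poly a (Suc k)) t - (2 * a + real k) * poly (gegenbauer_poly a k) t"
  using arg_cong[OF gegenbauer_poly_three_term[of k a], of "\<lambda>p. poly p t"]
  by (simp del: gegenbauer_poly.simps add: mult.assoc)

lemma pderiv_gegenbauer_poly_rec:
  "(real k + 2) * poly (pderiv (gegenbauer_poly a (Suc (Suc k)))) t =
    2 * (a + real k + 1) * (poly (gegenbauer_poly a (Suc k)) t + t * poly (pderiv (gegenbauer_poly a (Suc k))) t)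
    - (2 * a + real k) * poly (pderiv (gegenbauer_poly a k)) t"
  using arg_cong[OF gegenbauer_poly_three_term[of k a], of "\<lambda>p. poly (pderiv p) t"]
  by (simp del: gegenbauer_poly.simps mult_pCons_left add: pderiv_smult pderiv_diff poly_pderiv_mult pderiv_pCons)

text \<open>The two relations must be proved together: each induction step uses both for the smaller
  index and the differentiated three-term recursion.\<close>

lemma gegenbauer_derivative_relations:
  fixes a t :: real
  defines "c k \<equiv> poly (gegenbauer_poly a k) t" and "d k \<equiv> poly (pderiv (gegenbauer_poly a k)) t"
  shows "d (Suc k) - t * d k = (real k + 2 * a) * c k \<and> t * d (Suc k) - d k = (real k + 1) * c (Suc k)"
proof (induction k)
  case 0
  show ?case by (simp add: c_def d_def pderiv_pCons)
next
  case (Suc k)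
  have r: "(real k + 2) * c (Suc (Suc k)) = 2 * (a + real k + 1) * t * c (Suc k) - (2 * a + real k) * c k"
    unfolding c_def by (rule gegenbauer_poly_rec)
  have r': "(real k + 2) * d (Suc (Suc k)) = 2 * (a + real k + 1) * (c (Suc k) + t * d (Suc k)) - (2 * a + real k) * d k"
    unfolding c_def d_def by (rule pderiv_gegenbauer_poly_rec)
  have i1: "d (Suc k) - t * d k = (real k + 2 * a) * c k" and i2: "t * d (Suc k) - d k = (real k + 1) * c (Suc k)"
    using Suc by auto
  have dk: "d k = t * d (Suc k) - (real k + 1) * c (Suc k)" using i2 by simp
  have "(real k + 2) * d (Suc (Suc k)) = (real k + 2) * (t * d (Suc k) + (real k + 1 + 2 * a) * c (Suc k))"
    unfolding r' dk by (simp add: algebra_simps)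
  then have j1: "d (Suc (Suc k)) = t * d (Suc k) + (real k + 1 + 2 * a) * c (Suc k)"
    by (simp add: add_nonneg_eq_0_iff)
  have "(2 * a + real k) * c k = d (Suc k) - t * (t * d (Suc k) - (real k + 1) * c (Suc k))"
    using i1 dk by (simp add: add.commute)
  then have j2: "t * d (Suc (Suc k)) - d (Suc k) = (real k + 2) * c (Suc (Suc k))"
    unfolding r j1 by (simp add: algebra_simps)
  show ?case using j1 j2 by (simp add: algebra_simps)
qed

lemma gegenbauer_one_minus_sq_deriv:
  "[:1, 0, -1:] * pderiv (gegenbauer_poly a (Suc k)) =
    smult (2 * a + real k) (gegenbauer_poly a k) - smult (real k + 1) ([:0, 1:] * gegenbauer_poly a (Suc k))"
proof (rule poly_ext)
  fix t
  define c d where "c k = poly (gegenbauer_poly a k) t" and "d k = poly (pderiv (gegenbauer_poly a k)) t" for k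
  have i1: "d (Suc k) - t * d k = (real k + 2 * a) * c k" and i2: "t * d (Suc k) - d k = (real k + 1) * c (Suc k)"
    using gegenbauer_derivative_relations[of a k t] by (auto simp: c_def d_def)
  have dk: "d k = t * d (Suc k) - (real k + 1) * c (Suc k)" using i2 by simp
  have "(1 - t * t) * d (Suc k) = (2 * a + real k) * c k - (real k + 1) * (t * c (Suc k))"
    using i1 unfolding dk by (simp add: algebra_simps)
  then show "poly ([:1, 0, -1:] * pderiv (gegenbauer_poly a (Suc k))) t =
      poly (smult (2 * a + real k) (gegenbauer_poly a k) - smult (real k + 1) ([:0, 1:] * gegenbauer_poly a (Suc k))) t"
    by (simp add: c_def d_def algebra_simps)
qed

text \<open>Differentiate \<open>gegenbauer_one_minus_sq_deriv\<close> and eliminate the derivative of the lower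
  polynomial. For \<open>a = (n - 2) / 2\<close> this is the eigenvalue equation of the Laplace-Beltrami
  operator on zonal functions.\<close>

lemma gegenbauer_ode:
  "(1 - t\<^sup>2) * poly (pderiv (pderiv (gegenbauer_poly a k))) t - (2 * a + 1) * t * poly (pderiv (gegenbauer_poly a k)) t
    = - (real k * (real k + 2 * a)) * poly (gegenbauer_poly a k) t"
proof (cases k)
  case (Suc m)
  define c d e where "c k = poly (gegenbauer_poly a k) t" and "d k = poly (pderiv (gegenbauer_poly a k)) t"
    and "e k = poly (pderiv (pderiv (gegenbauer_poly a k))) t" for k
  have dk: "d m = t * d (Suc m) - (real m + 1) * c (Suc m)"
    using gegenbauer_derivative_relations[of a m t] by (simp add: c_def d_def)
  have P: "poly (pderiv ([:1, 0, -1:] * q)) t = (1 - t * t) * poly (pderiv q) t - 2 * t * poly q t" for q :: "real poly"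
    unfolding poly_pderiv_mult by (simp add: pderiv_pCons algebra_simps)
  have X: "poly (pderiv ([:0, 1:] * q)) t = poly q t + t * poly (pderiv q) t" for q :: "real poly"
    unfolding poly_pderiv_mult by (simp add: pderiv_pCons)
  have "poly (pderiv ([:1, 0, -1:] * pderiv (gegenbauer_poly a (Suc m)))) t =
      poly (pderiv (smult (2 * a + real m) (gegenbauer_poly a m) - smult (real m + 1) ([:0, 1:] * gegenbauer_poly a (Suc m)))) t"
    by (simp only: gegenbauer_one_minus_sq_deriv)
  then have "(1 - t * t) * e (Suc m) - 2 * t * d (Suc m) = (2 * a + real m) * d m - (real m + 1) * (c (Suc m) + t * d (Suc m))"
    unfolding P pderiv_diff pderiv_smult poly_diff poly_smult X c_def d_def e_def .
  then have "(1 - t * t) * e (Suc m) - (2 * a + 1) * t * d (Suc m) = - ((real m + 1) * (real m + 1 + 2 * a)) * c (Suc m)"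
    unfolding dk by (simp add: algebra_simps)
  then show ?thesis by (simp add: Suc c_def d_def e_def power2_eq_square add.commute)
qed simp

text \<open>At \<open>1\<close> the identity \<open>gegenbauer_one_minus_sq_deriv\<close> reduces to a two-term recursion with
  positive coefficients.\<close>

lemma gegenbauer_at_1_pos:
  assumes "a > 0"
  shows "poly (gegenbauer_poly a k) 1 > 0"
proof (induction k)
  case (Suc k)
  have "poly ([:1, 0, -1:] * pderiv (gegenbauer_poly a (Suc k))) 1 = poly (smult (2 * a + real k) (gegenbauer_poly a k) - smult (real k + 1) ([:0, 1:] * gegenbauer_poly a (Suc k))) 1"
    by (simp only: gegenbauer_one_minus_sq_deriv)
  then have "(real k + 1) * poly (gegenbauer_poly a (Suc k)) 1 = (2 * a + real k) * poly (gegenbauer_poly a k) 1"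
    by simp
  also have "\<dots> > 0" using Suc assms by (intro mult_pos_pos add_pos_nonneg) auto
  finally show ?case by (simp add: zero_less_mult_iff)
qed simp

lemma gegenbauer_poly_degree:
  assumes "a > 0"
  shows "degree (gegenbauer_poly a k) \<le> k \<and> coeff (gegenbauer_poly a k) k > 0"
  using assms
proof (induction a k rule: gegenbauer_poly.induct)
  case (3 a k)
  have d1: "degree ([:0, 1:] * gegenbauer_poly a (Suc k)) \<le> Suc (Suc k)"
    using 3 by (intro order_trans[OF degree_mult_le]) auto
  have d0: "degree (gegenbauer_poly a k) \<le> Suc (Suc k)" using 3 by auto
  have "coeff (gegenbauer_poly a k) (Suc (Suc k)) = 0" using 3 by (intro coeff_eq_0) auto
  then have "coeff (gegenbauer_poly a (Suc (Suc k))) (Suc (Suc k)) = 2 * (a + real k + 1) / (real k + 2) * coeff (gegenbauer_poly a (Suc k)) (Suc k)"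
    by simp
  moreover have "2 * (a + real k + 1) / (real k + 2) > 0" using 3 by (intro divide_pos_pos) auto
  moreover have "coeff (gegenbauer_poly a (Suc k)) (Suc k) > 0" using 3 by blast
  ultimately have "coeff (gegenbauer_poly a (Suc (Suc k))) (Suc (Suc k)) > 0"
    by (simp only: mult_pos_pos)
  moreover have "degree (gegenbauer_poly a (Suc (Suc k))) \<le> Suc (Suc k)"
    unfolding gegenbauer_poly.simps using d0 d1
    by (intro order_trans[OF degree_smult_le] degree_diff_le) (auto intro: order_trans[OF degree_smult_le])
  ultimately show ?case by blast
qed auto

lemma gegenbauer_span:
  assumes a: "a > 0"
  shows "degree p \<le> m \<Longrightarrow> \<exists>b. p = (\<Sum>j\<le>m. smult (b j) (gegenbauer_poly a j))"
proof (induction m arbitrary: p)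
  case 0
  then obtain c where "p = [:c:]" using degree_eq_zeroE by auto
  then show ?case by (intro exI[of _ "\<lambda>_. c"]) simp
next
  case (Suc m)
  let ?C = "gegenbauer_poly a (Suc m)"
  define r where "r = coeff p (Suc m) / coeff ?C (Suc m)"
  have C: "degree ?C \<le> Suc m" "coeff ?C (Suc m) > 0" using gegenbauer_poly_degree[OF a] by blast+
  have "degree (p - smult r ?C) \<le> m"
  proof (rule degree_le, intro allI impI)
    fix i assume "m < i"
    show "coeff (p - smult r ?C) i = 0"
    proof (cases "i = Suc m")
      case True
      then show ?thesis using C by (simp add: r_def)
    next
      case False
      then have "degree p < i" "degree ?C < i" using \<open>m < i\<close> Suc.prems C(1) by linarith+
      then show ?thesis by (simp add: coeff_eq_0 del: gegenbauer_poly.simps)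
    qed
  qed
  from Suc.IH[OF this] obtain b where b: "p - smult r ?C = (\<Sum>j\<le>m. smult (b j) (gegenbauer_poly a j))" by blast
  have "p = (\<Sum>j\<le>m. smult (b j) (gegenbauer_poly a j)) + smult r ?C"
    unfolding b[symmetric] by simp
  also have "(\<Sum>j\<le>m. smult (b j) (gegenbauer_poly a j)) = (\<Sum>j\<le>m. smult ((b(Suc m := r)) j) (gegenbauer_poly a j))"
    by (intro sum.cong) auto
  also have "\<dots> + smult r ?C = (\<Sum>j\<le>Suc m. smult ((b(Suc m := r)) j) (gegenbauer_poly a j))"
    by (simp del: gegenbauer_poly.simps)
  finally show ?case by blast
qed

section \<open>The one-dimensional weight\<close>

lemma poly_uniform_approx:
  fixes f :: "real \<Rightarrow> real"
  assumes "continuous_on {-1..1} f" "0 < \<epsilon>"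
  obtains p where "\<forall>t\<in>{-1..1}. \<bar>f t - poly p t\<bar> < \<epsilon>"
proof -
  obtain g where g: "real_polynomial_function g" "\<And>t. t \<in> {-1..1} \<Longrightarrow> \<bar>f t - g t\<bar> < \<epsilon>"
    using Stone_Weierstrass_real_polynomial_function[OF compact_Icc assms] by metis
  from g(1) obtain a n where "g = (\<lambda>x. \<Sum>i\<le>n. a i * x ^ i)"
    unfolding real_polynomial_function_iff_sum by blast
  then have "g t = poly (\<Sum>i\<le>n. monom (a i) i) t" for t by (simp add: poly_sum poly_monom)
  then show ?thesis using g(2) by (intro that[of "\<Sum>i\<le>n. monom (a i) i"]) auto
qed

definition jacobi_const :: "nat \<Rightarrow> real" where
  "jacobi_const n = Gamma (real n / 2) / (sqrt pi * Gamma ((real n - 1) / 2))"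

text \<open>The law of \<open>x \<bullet> y\<close> under the uniform measure has the density
  \<open>jacobi_const n * (1 - t\<^sup>2) powr ((n - 3) / 2)\<close>; see \<open>zonal_integral\<close>.\<close>

definition jacobi_integral :: "nat \<Rightarrow> (real \<Rightarrow> real) \<Rightarrow> real" where
  "jacobi_integral n f = jacobi_const n * (LINT t:{-1..1}|lborel. f t * (1 - t\<^sup>2) powr ((real n - 3) / 2))"

lemma jacobi_integrable:
  assumes n: "n \<ge> 3" and f: "continuous_on {-1..1} f"
  shows "set_integrable lborel {-1..1} (\<lambda>t. f t * (1 - t\<^sup>2) powr ((real n - 3) / 2))"
proof -
  have "bounded (f ` {-1..1})" using f by (intro compact_imp_bounded compact_continuous_image) auto
  then obtain C where C: "\<forall>y\<in>f ` {-1..1}. norm y \<le> C" unfolding bounded_iff by blast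
  show ?thesis
  proof (rule set_integrable_bound)
    show "set_integrable lborel {-1..1} (\<lambda>t::real. C)"
      by (simp add: set_integrable_def)
    have [measurable]: "(\<lambda>t. indicator {-1..1} t *\<^sub>R f t) \<in> borel_measurable borel"
      using f by (intro borel_measurable_continuous_on_indicator) auto
    have "(\<lambda>t. (indicator {-1..1} t *\<^sub>R f t) * (1 - t\<^sup>2) powr ((real n - 3) / 2)) \<in> borel_measurable borel"
      by measurable
    then show "set_borel_measurable lborel {-1..1} (\<lambda>t. f t * (1 - t\<^sup>2) powr ((real n - 3) / 2))"
      by (simp add: set_borel_measurable_def mult.assoc)
    show "AE t in lborel. t \<in> {-1..1} \<longrightarrow> norm (f t * (1 - t\<^sup>2) powr ((real n - 3) / 2)) \<le> norm C"
    proof (intro AE_I2 impI)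
      fix t :: real assume t: "t \<in> {-1..1}"
      then have "t\<^sup>2 \<le> 1" by (simp add: abs_square_le_1 abs_le_iff)
      then have "(1 - t\<^sup>2) powr ((real n - 3) / 2) \<le> 1"
        using n by (intro powr_le1) auto
      then have "\<bar>f t\<bar> * (1 - t\<^sup>2) powr ((real n - 3) / 2) \<le> \<bar>f t\<bar> * 1"
        by (intro mult_left_mono) auto
      also have "\<dots> \<le> norm C" using C t by force
      finally show "norm (f t * (1 - t\<^sup>2) powr ((real n - 3) / 2)) \<le> norm C" by (simp add: abs_mult)
    qed
  qed
qed

lemma jacobi_const_pos: "n \<ge> 3 \<Longrightarrow> 0 < jacobi_const n"
  unfolding jacobi_const_def by (intro divide_pos_pos mult_pos_pos Gamma_real_pos) auto

lemma jacobi_integral_linear: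
  assumes n: "n \<ge> 3" and f: "continuous_on {-1..1} f" and g: "continuous_on {-1..1} g"
  shows "jacobi_integral n (\<lambda>t. a * f t + b * g t) = a * jacobi_integral n f + b * jacobi_integral n g"
proof -
  have "(LINT t:{-1..1}|lborel. (a * f t + b * g t) * (1 - t\<^sup>2) powr ((real n - 3) / 2)) =
    (LINT t:{-1..1}|lborel. a * (f t * (1 - t\<^sup>2) powr ((real n - 3) / 2)) + b * (g t * (1 - t\<^sup>2) powr ((real n - 3) / 2)))"
    by (simp add: algebra_simps)
  also have "\<dots> = a * (LINT t:{-1..1}|lborel. f t * (1 - t\<^sup>2) powr ((real n - 3) / 2)) + b * (LINT t:{-1..1}|lborel. g t * (1 - t\<^sup>2) powr ((real n - 3) / 2))"
    using jacobi_integrable[OF n f] jacobi_integrable[OF n g]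
    by (subst set_integral_add) auto
  finally show ?thesis by (simp add: jacobi_integral_def algebra_simps)
qed

text \<open>The Beta integral with exponent \<open>n - 3\<close>; it is known for powers of \<open>sqrt (1 - t\<^sup>2)\<close>, which
  differ from the weight here only at the endpoints.\<close>

lemma jacobi_integral_one:
  assumes n: "n \<ge> 3"
  shows "jacobi_integral n (\<lambda>_. 1) = 1"
proof -
  obtain m where m: "n = m + 3" using n by (metis le_add_diff_inverse2)
  have sq: "indicator {-1..1} t * sqrt (1 - t\<^sup>2) ^ m = indicator {-1..1} t * (1 - t\<^sup>2) powr ((real n - 3) / 2)"
    if "t \<noteq> 1" "t \<noteq> -1" for t :: real
  proof (cases "t \<in> {-1..1}")
    case True
    then have "t\<^sup>2 < 1" using that by (simp add: abs_square_less_1 abs_less_iff)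
    then have "sqrt (1 - t\<^sup>2) ^ m = (1 - t\<^sup>2) powr ((real n - 3) / 2)"
      by (simp add: m powr_half_sqrt[symmetric] powr_realpow[symmetric] powr_powr)
    then show ?thesis by simp
  qed simp
  have int: "integrable lborel (\<lambda>t. indicator {-1..1} t * (1 - t\<^sup>2) powr ((real n - 3) / 2))"
    using jacobi_integrable[OF n, of "\<lambda>_. 1"] by (simp add: set_integrable_def)
  have "ennreal (LINT t|lborel. indicator {-1..1} t * (1 - t\<^sup>2) powr ((real n - 3) / 2))
    = (\<integral>\<^sup>+t. ennreal (indicator {-1..1} t * (1 - t\<^sup>2) powr ((real n - 3) / 2)) \<partial>lborel)"
    using int by (intro nn_integral_eq_integral[symmetric]) auto
  also have "\<dots> = (\<integral>\<^sup>+t. ennreal (indicator {-1..1} t * sqrt (1 - t\<^sup>2) ^ m) \<partial>lborel)"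
  proof (rule nn_integral_cong_AE)
    show "AE t in lborel. ennreal (indicator {-1..1} t * (1 - t\<^sup>2) powr ((real n - 3) / 2)) = ennreal (indicator {-1..1} t * sqrt (1 - t\<^sup>2) ^ m)"
      using AE_lborel_singleton[of "1::real"] AE_lborel_singleton[of "-1::real"]
      by eventually_elim (rule arg_cong[where f = ennreal], rule sq[symmetric])
  qed
  also have "\<dots> = ennreal (Beta (1 / 2) (real m / 2 + 1))" by (rule emeasure_cball_aux_integral)
  finally have "(LINT t|lborel. indicator {-1..1} t * (1 - t\<^sup>2) powr ((real n - 3) / 2)) = Beta (1 / 2) (real m / 2 + 1)"
    by (subst (asm) ennreal_inj) (auto intro!: Bochner_Integration.integral_nonneg simp: Beta_def Gamma_real_pos less_imp_le)
  moreover have "real m / 2 + 1 = (real n - 1) / 2" by (simp add: m field_simps)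
  moreover have "1 / 2 + (real n - 1) / 2 = real n / 2" by (simp add: field_simps)
  ultimately have "(LINT t:{-1..1}|lborel. 1 * (1 - t\<^sup>2) powr ((real n - 3) / 2)) = sqrt pi * Gamma ((real n - 1) / 2) / Gamma (real n / 2)"
    by (simp add: set_lebesgue_integral_def Beta_def Gamma_one_half_real)
  moreover have "Gamma (real n / 2) > 0" "Gamma ((real n - 1) / 2) > 0" using n by (auto intro!: Gamma_real_pos)
  ultimately show ?thesis by (simp add: jacobi_integral_def jacobi_const_def)
qed

text \<open>The function \<open>t ^ m * (1 - t\<^sup>2) powr ((n - 1) / 2)\<close> vanishes at both endpoints, so its
  derivative integrates to \<open>0\<close>. This is the recursion of the sphere moments \<open>sphere_moment_rec\<close>
  for \<open>b = 0\<close>.\<close>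

lemma jacobi_integral_parts:
  assumes n: "n \<ge> 3"
  shows "(real n - 1 + real m) * jacobi_integral n (\<lambda>t. t ^ Suc m) = real m * jacobi_integral n (\<lambda>t. t ^ (m - 1))"
proof -
  define w where "w t = (1 - t\<^sup>2) powr ((real n - 3) / 2)" for t :: real
  define F where "F t = t ^ m * (1 - t\<^sup>2) powr ((real n - 1) / 2)" for t :: real
  define f where "f t = (- (real n - 1 + real m)) * t ^ Suc m + real m * t ^ (m - 1)" for t :: real
  have "((\<lambda>t. f t * w t) has_integral (F 1 - F (-1))) {-1..1}"
  proof (rule fundamental_theorem_of_calculus_interior)
    show "continuous_on {-1..1} F"
      unfolding F_def using n
      by (intro continuous_intros continuous_on_powr') (auto simp: abs_square_le_1 abs_le_iff)
    fix t :: real assume t: "t \<in> {-1<..<1}"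
    then have t2: "1 - t\<^sup>2 > 0" by (simp add: abs_square_less_1 abs_less_iff)
    have p1: "(1 - t\<^sup>2) powr ((real n - 1) / 2) = (1 - t\<^sup>2) * w t"
    proof -
      have "(1 - t\<^sup>2) * w t = (1 - t\<^sup>2) powr 1 * (1 - t\<^sup>2) powr ((real n - 3) / 2)" using t2 by (simp add: w_def)
      also have "\<dots> = (1 - t\<^sup>2) powr (1 + (real n - 3) / 2)" by (rule powr_add[symmetric])
      also have "1 + (real n - 3) / 2 = (real n - 1) / 2" by (simp add: field_simps)
      finally show ?thesis by simp
    qed
    have p2: "(1 - t\<^sup>2) powr ((real n - 1) / 2 - 1) = w t"
    proof -
      have "(real n - 1) / 2 - 1 = (real n - 3) / 2" by (simp add: field_simps)
      then show ?thesis by (simp only: w_def)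
    qed
    have "((\<lambda>t. (1 - t\<^sup>2) powr ((real n - 1) / 2)) has_real_derivative ((real n - 1) / 2 * w t * (- 2 * t))) (at t)"
      using t2 by (auto intro!: derivative_eq_intros simp: p2)
    then have "(F has_real_derivative (real m * t ^ (m - 1) * (1 - t\<^sup>2) powr ((real n - 1) / 2) + (real n - 1) / 2 * w t * (- 2 * t) * t ^ m)) (at t)"
      unfolding F_def by (intro DERIV_mult) (auto intro!: derivative_eq_intros)
    moreover have "real m * t ^ (m - 1) * (1 - t\<^sup>2) powr ((real n - 1) / 2) + (real n - 1) / 2 * w t * (- 2 * t) * t ^ m = f t * w t"
      unfolding p1 f_def by (cases m) (simp_all add: field_simps power2_eq_square)
    ultimately show "(F has_vector_derivative f t * w t) (at t)"
      by (simp add: has_real_derivative_iff_has_vector_derivative)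
  qed simp
  then have "integral {-1..1} (\<lambda>t. f t * w t) = 0" using n by (simp add: F_def integral_unique)
  moreover have "continuous_on {-1..1} f" unfolding f_def by (intro continuous_intros)
  then have "set_integrable lborel {-1..1} (\<lambda>t. f t * w t)" unfolding w_def by (rule jacobi_integrable[OF n])
  then have "(LINT t:{-1..1}|lborel. f t * w t) = integral {-1..1} (\<lambda>t. f t * w t)"
    by (rule set_borel_integral_eq_integral)
  ultimately have "jacobi_integral n f = 0" by (simp add: jacobi_integral_def w_def)
  then show ?thesis unfolding f_def
    by (subst (asm) jacobi_integral_linear[OF n]) (auto intro!: continuous_intros simp: algebra_simps)
qed

lemma jacobi_integral_sum:
  assumes n: "n \<ge> 3" and f: "\<And>i. continuous_on {-1..1} (f i)" and "finite S"
  shows "jacobi_integral n (\<lambda>t. \<Sum>i\<in>S. c i * f i t) = (\<Sum>i\<in>S. c i * jacobi_integral n (f i))"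
  using \<open>finite S\<close>
proof induction
  case empty
  then show ?case by (simp add: jacobi_integral_def)
next
  case (insert i S)
  have "continuous_on {-1..1} (\<lambda>t. \<Sum>i\<in>S. c i * f i t)" by (intro continuous_intros f)
  from jacobi_integral_linear[OF n f[of i] this, of "c i" 1] insert show ?case by simp
qed

lemma jacobi_integral_mono:
  assumes n: "n \<ge> 3" and f: "continuous_on {-1..1} f" and g: "continuous_on {-1..1} g"
    and le: "\<And>t. t \<in> {-1..1} \<Longrightarrow> f t \<le> g t"
  shows "jacobi_integral n f \<le> jacobi_integral n g"
proof -
  have "(LINT t:{-1..1}|lborel. f t * (1 - t\<^sup>2) powr ((real n - 3) / 2)) \<le> (LINT t:{-1..1}|lborel. g t * (1 - t\<^sup>2) powr ((real n - 3) / 2))"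
    using jacobi_integrable[OF n f] jacobi_integrable[OF n g] le
    by (intro set_integral_mono mult_right_mono) auto
  then show ?thesis unfolding jacobi_integral_def using jacobi_const_pos[OF n] by (intro mult_left_mono) auto
qed

lemma jacobi_integral_bound:
  assumes n: "n \<ge> 3" and f: "continuous_on {-1..1} f" and le: "\<And>t. t \<in> {-1..1} \<Longrightarrow> \<bar>f t\<bar> \<le> C"
  shows "\<bar>jacobi_integral n f\<bar> \<le> C"
proof -
  have const: "jacobi_integral n (\<lambda>_. c) = c" for c
    using jacobi_integral_linear[OF n, of "\<lambda>_. 1" "\<lambda>_. 1" c 0] jacobi_integral_one[OF n] by simp
  have "jacobi_integral n f \<le> jacobi_integral n (\<lambda>_. C)"
    using le by (intro jacobi_integral_mono n f) (auto simp: abs_le_iff)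
  moreover have "jacobi_integral n (\<lambda>_. - C) \<le> jacobi_integral n f"
    using le by (intro jacobi_integral_mono n f) (force simp: abs_le_iff)+
  ultimately show ?thesis by (simp add: const abs_le_iff)
qed

text \<open>The weight is positive inside the interval and a nonzero polynomial has only finitely many
  zeros.\<close>

lemma jacobi_integral_square_pos:
  assumes n: "n \<ge> 3" and p: "p \<noteq> 0"
  shows "0 < jacobi_integral n (\<lambda>t. (poly p t)\<^sup>2)"
proof -
  define w where "w t = (1 - t\<^sup>2) powr ((real n - 3) / 2)" for t :: real
  define F where "F t = indicator {-1..1} t *\<^sub>R ((poly p t)\<^sup>2 * w t)" for t :: real
  have F0: "0 \<le> F t" for t by (simp add: F_def w_def)
  have int: "integrable lborel F"
    using jacobi_integrable[OF n, of "\<lambda>t. (poly p t)\<^sup>2"] unfolding F_def w_def set_integrable_def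
    by (simp add: continuous_intros)
  have ge: "0 \<le> integral\<^sup>L lborel F" using F0 by (intro Bochner_Integration.integral_nonneg)
  have "integral\<^sup>L lborel F \<noteq> 0"
  proof
    assume "integral\<^sup>L lborel F = 0"
    then have ae: "AE t in lborel. F t = 0"
      using integral_nonneg_eq_0_iff_AE[OF int] F0 by simp
    have "finite {t. poly p t = 0}" using p by (rule poly_roots_finite)
    then have "{t. poly p t = 0} \<in> null_sets lborel" by (intro finite_imp_null_set_lborel)
    then have "AE t in lborel. t \<notin> {t. poly p t = 0}" by (rule AE_not_in)
    with ae have "AE t in lborel. t \<notin> {-1<..<1::real}"
    proof eventually_elim
      case (elim t)
      show ?case
      proof
        assume t: "t \<in> {-1<..<1}"
        then have "t\<^sup>2 < 1" by (simp add: abs_square_less_1 abs_less_iff)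
        then have "F t > 0" using t elim by (simp add: F_def w_def)
        then show False using elim by simp
      qed
    qed
    then have "{-1<..<1::real} \<in> null_sets lborel"
      by (subst AE_iff_null_sets) auto
    then have "emeasure lborel {-1<..<1::real} = 0" by (rule null_setsD1)
    then show False by simp
  qed
  with ge have "integral\<^sup>L lborel F > 0" by simp
  then have "0 < jacobi_const n * integral\<^sup>L lborel F" using jacobi_const_pos[OF n] by simp
  then show ?thesis by (simp add: jacobi_integral_def set_lebesgue_integral_def F_def[abs_def] w_def)
qed

section \<open>Moments and zonal integrals\<close>

lemma inner_unit_range:
  fixes x y :: "'a::real_inner"
  assumes "norm x = 1" "norm y = 1"
  shows "x \<bullet> y \<in> {-1..1}"
  using Cauchy_Schwarz_ineq2[of x y] assms by (auto simp: abs_le_iff)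

lemma integrable_zonal_product:
  fixes x z :: "real^'n"
  shows "integrable uniform_sphere (\<lambda>y. poly P (x \<bullet> y) * poly Q (z \<bullet> y))"
  by (intro integrable_sphere continuous_intros)

definition sphere_moment :: "real^'n \<Rightarrow> real^'n \<Rightarrow> nat \<Rightarrow> nat \<Rightarrow> real" where
  "sphere_moment x z a b = (LINT y|uniform_sphere. (x \<bullet> y) ^ a * (z \<bullet> y) ^ b)"

text \<open>The case of powers in \<open>sphere_divergence_zonal\<close>. For \<open>a = 0\<close> or \<open>b = 0\<close> the truncated
  exponents \<open>a - 1\<close>, \<open>b - 1\<close> are harmless, as the factor in front is zero.\<close>

lemma sphere_moment_rec:
  fixes x z :: "real^'n"
  assumes x: "norm x = 1"
  shows "(real CARD('n) - 1 + real a + real b) * sphere_moment x z (Suc a) b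
    = real a * sphere_moment x z (a - 1) b + real b * (x \<bullet> z) * sphere_moment x z a (b - 1)"
proof -
  have pd: "poly (pderiv (monom 1 m)) t = real m * t ^ (m - 1)" for m and t :: real
    by (simp add: pderiv_monom poly_monom)
  have pw: "real m * t ^ (m - 1) * t = real m * t ^ m" for m and t :: real
    by (cases m) auto
  have int: "integrable uniform_sphere (\<lambda>y. (x \<bullet> y) ^ a * (z \<bullet> y) ^ b)" for a b
    by (intro integrable_sphere continuous_intros)
  have "0 = (LINT y|uniform_sphere. poly (pderiv (monom 1 b)) (z \<bullet> y) * poly (monom 1 a) (x \<bullet> y) * (z \<bullet> x - (z \<bullet> y) * (x \<bullet> y))
    + poly (monom 1 b) (z \<bullet> y) * (poly (pderiv (monom 1 a)) (x \<bullet> y) * (1 - (x \<bullet> y)\<^sup>2) - (real CARD('n) - 1) * (x \<bullet> y) * poly (monom 1 a) (x \<bullet> y)))"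
    by (rule sphere_divergence_zonal[OF x, symmetric])
  also have "\<dots> = (LINT y|uniform_sphere. real a * ((x \<bullet> y) ^ (a - 1) * (z \<bullet> y) ^ b) + real b * (x \<bullet> z) * ((x \<bullet> y) ^ a * (z \<bullet> y) ^ (b - 1))
      - (real CARD('n) - 1 + real a + real b) * ((x \<bullet> y) ^ Suc a * (z \<bullet> y) ^ b))"
  proof (intro Bochner_Integration.integral_cong refl)
    fix y :: "real^'n"
    define s t where "s = x \<bullet> y" and "t = z \<bullet> y"
    have "real b * t ^ (b - 1) * s ^ a * (x \<bullet> z - t * s) + t ^ b * (real a * s ^ (a - 1) * (1 - s\<^sup>2) - (real CARD('n) - 1) * s * s ^ a)
      = real b * (x \<bullet> z) * (s ^ a * t ^ (b - 1)) + real a * (s ^ (a - 1) * t ^ b)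
        - (real b * t ^ (b - 1) * t) * s ^ Suc a - (real a * s ^ (a - 1) * s) * s * t ^ b - (real CARD('n) - 1) * s ^ Suc a * t ^ b"
      by (simp add: algebra_simps power2_eq_square)
    also have "\<dots> = real a * (s ^ (a - 1) * t ^ b) + real b * (x \<bullet> z) * (s ^ a * t ^ (b - 1))
      - (real CARD('n) - 1 + real a + real b) * (s ^ Suc a * t ^ b)"
      unfolding pw by (simp add: algebra_simps)
    finally show "poly (pderiv (monom 1 b)) (z \<bullet> y) * poly (monom 1 a) (x \<bullet> y) * (z \<bullet> x - (z \<bullet> y) * (x \<bullet> y))
    + poly (monom 1 b) (z \<bullet> y) * (poly (pderiv (monom 1 a)) (x \<bullet> y) * (1 - (x \<bullet> y)\<^sup>2) - (real CARD('n) - 1) * (x \<bullet> y) * poly (monom 1 a) (x \<bullet> y))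
      = real a * ((x \<bullet> y) ^ (a - 1) * (z \<bullet> y) ^ b) + real b * (x \<bullet> z) * ((x \<bullet> y) ^ a * (z \<bullet> y) ^ (b - 1))
      - (real CARD('n) - 1 + real a + real b) * ((x \<bullet> y) ^ Suc a * (z \<bullet> y) ^ b)"
      unfolding pd by (simp add: poly_monom s_def t_def inner_commute[of z x])
  qed
  also have "\<dots> = real a * sphere_moment x z (a - 1) b + real b * (x \<bullet> z) * sphere_moment x z a (b - 1)
      - (real CARD('n) - 1 + real a + real b) * sphere_moment x z (Suc a) b"
    unfolding sphere_moment_def using int
    by (subst Bochner_Integration.integral_diff Bochner_Integration.integral_add; (intro Bochner_Integration.integrable_add integrable_mult_right)?)+ (simp_all del: power_Suc)
  finally show ?thesis by simp
qed

lemma sphere_moment_power: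
  fixes x z :: "real^'n"
  assumes n: "CARD('n) \<ge> 3" and x: "norm x = 1"
  shows "sphere_moment x z m 0 = jacobi_integral CARD('n) (\<lambda>t. t ^ m)"
proof (induction m rule: less_induct)
  case (less m)
  show ?case
  proof (cases m)
    case 0
    then show ?thesis using jacobi_integral_one[OF n] sphere.prob_space by (simp add: sphere_moment_def)
  next
    case (Suc a)
    have pos: "real CARD('n) - 1 + real a > 0" using n by simp
    have "(real CARD('n) - 1 + real a) * sphere_moment x z (Suc a) 0 = real a * sphere_moment x z (a - 1) 0"
      using sphere_moment_rec[OF x, of a 0 z] by simp
    also have "\<dots> = real a * jacobi_integral CARD('n) (\<lambda>t. t ^ (a - 1))"
      using less[of "a - 1"] Suc by simp
    also have "\<dots> = (real CARD('n) - 1 + real a) * jacobi_integral CARD('n) (\<lambda>t. t ^ Suc a)"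
      by (rule jacobi_integral_parts[OF n, symmetric])
    finally have "sphere_moment x z (Suc a) 0 = jacobi_integral CARD('n) (\<lambda>t. t ^ Suc a)"
      using pos by (subst (asm) mult_cancel_left) auto
    then show ?thesis by (simp only: Suc)
  qed
qed

text \<open>By \<open>sphere_moment_rec\<close>; the degree in \<open>x \<bullet> z\<close> increases only when the exponent \<open>b\<close> drops, so
  it never exceeds \<open>b\<close>.\<close>

lemma sphere_moment_poly:
  assumes n: "CARD('n::finite) \<ge> 3"
  shows "\<exists>q. degree q \<le> b \<and> (\<forall>x z :: real^'n. norm x = 1 \<longrightarrow> norm z = 1 \<longrightarrow> sphere_moment x z a b = poly q (x \<bullet> z))"
proof (induction a arbitrary: b rule: less_induct)
  case (less a)
  show ?case
  proof (cases a)
    case 0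
    have "sphere_moment x z 0 b = sphere_moment z x b 0" for x z :: "real^'n"
      by (simp add: sphere_moment_def)
    then show ?thesis using sphere_moment_power[where 'n='n, OF n] 0
      by (intro exI[of _ "[:jacobi_integral CARD('n) (\<lambda>t. t ^ b):]"]) simp
  next
    case (Suc a')
    have "a' - 1 < a" "a' < a" using Suc by auto
    from less[OF this(1), of b] less[OF this(2), of "b - 1"]
    obtain q1 q2 where q1: "degree q1 \<le> b"
      "\<forall>x z :: real^'n. norm x = 1 \<longrightarrow> norm z = 1 \<longrightarrow> sphere_moment x z (a' - 1) b = poly q1 (x \<bullet> z)"
      and q2: "degree q2 \<le> b - 1"
      "\<forall>x z :: real^'n. norm x = 1 \<longrightarrow> norm z = 1 \<longrightarrow> sphere_moment x z a' (b - 1) = poly q2 (x \<bullet> z)"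
      by (elim exE conjE)
    define N where "N = real CARD('n) - 1 + real a' + real b"
    have N: "N > 0" using n by (simp add: N_def)
    define q where "q = smult (1 / N) (smult (real a') q1 + smult (real b) ([:0, 1:] * q2))"
    have d: "degree (smult (real b) ([:0, 1:] * q2)) \<le> b"
    proof (cases "b = 0")
      case False
      have "degree ([:0, 1:] * q2) \<le> 1 + (b - 1)"
        using q2(1) by (intro order_trans[OF degree_mult_le] add_mono) auto
      then show ?thesis using False by (intro order_trans[OF degree_smult_le]) simp
    qed simp
    have "degree q \<le> b"
      unfolding q_def
      by (rule order_trans[OF degree_smult_le], rule degree_add_le, rule order_trans[OF degree_smult_le q1(1)], rule d)
    moreover have "sphere_moment x z a b = poly q (x \<bullet> z)" if "norm x = 1" "norm z = 1" for x z :: "real^'n"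
    proof -
      have "N * sphere_moment x z (Suc a') b = real a' * poly q1 (x \<bullet> z) + real b * (x \<bullet> z) * poly q2 (x \<bullet> z)"
        using sphere_moment_rec[OF that(1), of a' b z] q1(2) q2(2) that by (simp add: N_def)
      then have "sphere_moment x z (Suc a') b = (real a' * poly q1 (x \<bullet> z) + real b * (x \<bullet> z) * poly q2 (x \<bullet> z)) / N"
        using N by (simp add: field_simps)
      then show ?thesis by (simp add: Suc q_def mult.assoc)
    qed
    ultimately show ?thesis by blast
  qed
qed

text \<open>Convolving a zonal polynomial with an arbitrary zonal kernel does not raise its degree.
  Together with orthogonality this identifies the eigenfunctions in \<open>funk_hecke_poly\<close>.\<close>

lemma zonal_convolution_poly:
  fixes W Q :: "real poly"
  assumes n: "CARD('n::finite) \<ge> 3"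
  shows "\<exists>q. degree q \<le> degree Q \<and> (\<forall>x z :: real^'n. norm x = 1 \<longrightarrow> norm z = 1 \<longrightarrow>
    (LINT y|uniform_sphere. poly W (x \<bullet> y) * poly Q (z \<bullet> y)) = poly q (x \<bullet> z))"
proof -
  define q where "q a b = (SOME q. degree q \<le> b \<and> (\<forall>x z :: real^'n. norm x = 1 \<longrightarrow> norm z = 1 \<longrightarrow> sphere_moment x z a b = poly q (x \<bullet> z)))" for a b
  have qq: "degree (q a b) \<le> b \<and> (\<forall>x z :: real^'n. norm x = 1 \<longrightarrow> norm z = 1 \<longrightarrow> sphere_moment x z a b = poly (q a b) (x \<bullet> z))" for a b
    unfolding q_def by (rule someI_ex) (rule sphere_moment_poly[OF n])
  then have q: "\<And>a b. degree (q a b) \<le> b" "\<And>a b (x::real^'n) z. norm x = 1 \<Longrightarrow> norm z = 1 \<Longrightarrow> sphere_moment x z a b = poly (q a b) (x \<bullet> z)"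
    by auto
  define r where "r = (\<Sum>i\<le>degree W. \<Sum>j\<le>degree Q. smult (coeff W i * coeff Q j) (q i j))"
  have "degree r \<le> degree Q"
    unfolding r_def using q(1) by (intro degree_sum_le order_trans[OF degree_smult_le]) (auto intro: order_trans)
  moreover have "(LINT y|uniform_sphere. poly W (x \<bullet> y) * poly Q (z \<bullet> y)) = poly r (x \<bullet> z)"
    if "norm x = 1" "norm z = 1" for x z :: "real^'n"
  proof -
    have int: "integrable uniform_sphere (\<lambda>y. (x \<bullet> y) ^ a * (z \<bullet> y) ^ b)" for a b
      by (intro integrable_sphere continuous_intros)
    have "(LINT y|uniform_sphere. poly W (x \<bullet> y) * poly Q (z \<bullet> y)) =
      (LINT y|uniform_sphere. (\<Sum>i\<le>degree W. \<Sum>j\<le>degree Q. (coeff W i * coeff Q j) * ((x \<bullet> y) ^ i * (z \<bullet> y) ^ j)))"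
      unfolding poly_altdef sum_product
      by (intro Bochner_Integration.integral_cong sum.cong refl) (simp add: ac_simps)
    also have "\<dots> = (\<Sum>i\<le>degree W. \<Sum>j\<le>degree Q. (coeff W i * coeff Q j) * sphere_moment x z i j)"
      unfolding sphere_moment_def using int
      by (subst Bochner_Integration.integral_sum; (intro Bochner_Integration.integrable_sum integrable_mult_right)?)+ simp_all
    also have "\<dots> = poly r (x \<bullet> z)" using q(2)[OF that] by (simp add: r_def poly_sum)
    finally show ?thesis .
  qed
  ultimately show ?thesis by blast
qed

lemma zonal_integral_poly:
  fixes x :: "real^'n"
  assumes n: "CARD('n) \<ge> 3" and x: "norm x = 1"
  shows "(LINT y|uniform_sphere. poly p (x \<bullet> y)) = jacobi_integral CARD('n) (poly p)"
proof -
  have int: "integrable uniform_sphere (\<lambda>y. (x \<bullet> y) ^ a)" for a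
    by (intro integrable_sphere continuous_intros)
  have "(LINT y|uniform_sphere. poly p (x \<bullet> y)) = (LINT y|uniform_sphere. (\<Sum>i\<le>degree p. coeff p i * (x \<bullet> y) ^ i))"
    by (simp add: poly_altdef)
  also have "\<dots> = (\<Sum>i\<le>degree p. coeff p i * sphere_moment x x i 0)"
    unfolding sphere_moment_def using int by (subst Bochner_Integration.integral_sum) auto
  also have "\<dots> = (\<Sum>i\<le>degree p. coeff p i * jacobi_integral CARD('n) (\<lambda>t. t ^ i))"
    by (simp only: sphere_moment_power[OF n x])
  also have "\<dots> = jacobi_integral CARD('n) (\<lambda>t. \<Sum>i\<le>degree p. coeff p i * t ^ i)"
    by (rule jacobi_integral_sum[OF n, symmetric]) (auto intro!: continuous_intros)
  also have "\<dots> = jacobi_integral CARD('n) (poly p)" by (simp add: poly_altdef[abs_def])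
  finally show ?thesis .
qed

lemma continuous_on_zonal:
  fixes x :: "real^'n"
  assumes "continuous_on UNIV f"
  shows "continuous_on UNIV (\<lambda>y. f (x \<bullet> y) :: real)"
  by (rule continuous_on_compose2[OF assms]) (auto intro!: continuous_intros)

text \<open>Both sides are positive normalized functionals that satisfy the same moment recursion; they
  agree on polynomials and hence on continuous functions.\<close>

lemma zonal_integral:
  fixes x :: "real^'n"
  assumes n: "CARD('n) \<ge> 3" and x: "norm x = 1" and f: "continuous_on UNIV f"
  shows "(LINT y|uniform_sphere. f (x \<bullet> y)) = jacobi_integral CARD('n) f"
proof -
  have f1: "continuous_on {-1..1} f" using f by (rule continuous_on_subset) simp
  have "\<bar>(LINT y|uniform_sphere. f (x \<bullet> y)) - jacobi_integral CARD('n) f\<bar> \<le> 0 + e" if e: "e > 0" for e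
  proof -
    obtain p where p: "\<forall>t\<in>{-1..1}. \<bar>f t - poly p t\<bar> < e / 2" using poly_uniform_approx[OF f1, of "e / 2"] e by auto
    have "\<bar>jacobi_integral CARD('n) (\<lambda>t. 1 * f t + (-1) * poly p t)\<bar> \<le> e / 2"
      using p by (intro jacobi_integral_bound n continuous_intros f1) (auto simp: less_imp_le)
    then have 1: "\<bar>jacobi_integral CARD('n) f - jacobi_integral CARD('n) (poly p)\<bar> \<le> e / 2"
      by (subst (asm) jacobi_integral_linear[OF n f1]) (auto intro!: continuous_intros)
    have i: "integrable uniform_sphere (\<lambda>y. f (x \<bullet> y))" "integrable uniform_sphere (\<lambda>y. poly p (x \<bullet> y))"
      by (intro integrable_sphere continuous_on_zonal f continuous_intros)+
    have "\<bar>(LINT y|uniform_sphere. f (x \<bullet> y) - poly p (x \<bullet> y))\<bar> \<le> (LINT y|uniform_sphere. \<bar>f (x \<bullet> y) - poly p (x \<bullet> y)\<bar>)"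
      by (rule integral_abs_bound)
    also have "\<dots> \<le> (LINT y|(uniform_sphere :: (real^'n) measure). e / 2)"
    proof (rule integral_mono)
      fix y assume "y \<in> space (uniform_sphere :: (real^'n) measure)"
      then have "x \<bullet> y \<in> {-1..1}" using x by (intro inner_unit_range) (auto simp: space_uniform_sphere)
      then show "\<bar>f (x \<bullet> y) - poly p (x \<bullet> y)\<bar> \<le> e / 2" using p by (auto simp: less_imp_le)
    qed (use i in auto)
    also have "\<dots> = e / 2" by (simp add: sphere.prob_space)
    finally have 2: "\<bar>(LINT y|uniform_sphere. f (x \<bullet> y)) - (LINT y|uniform_sphere. poly p (x \<bullet> y))\<bar> \<le> e / 2"
      using i by simp
    show ?thesis using 1 2 zonal_integral_poly[OF n x, of p] by linarith
  qed
  then have "\<bar>(LINT y|uniform_sphere. f (x \<bullet> y)) - jacobi_integral CARD('n) f\<bar> \<le> 0" by (rule field_le_epsilon)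
  then show ?thesis by simp
qed

section \<open>Orthogonality and the Funk-Hecke formula\<close>

abbreviation geg :: "nat \<Rightarrow> nat \<Rightarrow> real poly" where
  "geg n k \<equiv> gegenbauer_poly ((real n - 2) / 2) k"

text \<open>By \<open>sphere_divergence_zonal\<close> and \<open>gegenbauer_ode\<close> the integral multiplied by either of the
  eigenvalues \<open>l (l + n - 2)\<close> and \<open>m (m + n - 2)\<close> equals the symmetric Dirichlet form, and the two
  eigenvalues are different. The poles \<open>x\<close> and \<open>z\<close> are arbitrary, so this is orthogonality of
  whole eigenspaces and not only of polynomials on the interval.\<close>

lemma geg_orthogonal:
  fixes x z :: "real^'n"
  assumes n: "CARD('n) \<ge> 3" and x: "norm x = 1" and z: "norm z = 1" and lm: "l \<noteq> m"
  shows "(LINT y|uniform_sphere. poly (geg CARD('n) l) (x \<bullet> y) * poly (geg CARD('n) m) (z \<bullet> y)) = 0"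
proof -
  let ?N = "CARD('n)"
  have *: "real m * (real m + real ?N - 2) * (LINT y|uniform_sphere. poly (geg ?N l) (x \<bullet> y) * poly (geg ?N m) (z \<bullet> y))
    = (LINT y|uniform_sphere. poly (pderiv (geg ?N l)) (x \<bullet> y) * poly (pderiv (geg ?N m)) (z \<bullet> y) * (x \<bullet> z - (x \<bullet> y) * (z \<bullet> y)))"
    if z: "norm z = 1" for x z :: "real^'n" and l m
  proof -
    define E where "E = (\<lambda>y. poly (pderiv (geg ?N l)) (x \<bullet> y) * poly (pderiv (geg ?N m)) (z \<bullet> y) * (x \<bullet> z - (x \<bullet> y) * (z \<bullet> y)))"
    define P where "P = (\<lambda>y. poly (geg ?N l) (x \<bullet> y) * poly (geg ?N m) (z \<bullet> y))"
    have i: "integrable uniform_sphere E" "integrable uniform_sphere P"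
      unfolding E_def P_def by (intro integrable_sphere continuous_intros)+
    have "0 = (LINT y|uniform_sphere. poly (pderiv (geg ?N l)) (x \<bullet> y) * poly (pderiv (geg ?N m)) (z \<bullet> y) * (x \<bullet> z - (x \<bullet> y) * (z \<bullet> y))
      + poly (geg ?N l) (x \<bullet> y) * (poly (pderiv (pderiv (geg ?N m))) (z \<bullet> y) * (1 - (z \<bullet> y)\<^sup>2) - (real ?N - 1) * (z \<bullet> y) * poly (pderiv (geg ?N m)) (z \<bullet> y)))"
      by (rule sphere_divergence_zonal[OF z, symmetric])
    also have "\<dots> = (LINT y|uniform_sphere. E y - (real m * (real m + real ?N - 2)) * P y)"
    proof (intro Bochner_Integration.integral_cong refl)
      fix y
      have "poly (pderiv (pderiv (geg ?N m))) (z \<bullet> y) * (1 - (z \<bullet> y)\<^sup>2) - (real ?N - 1) * (z \<bullet> y) * poly (pderiv (geg ?N m)) (z \<bullet> y)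
          = - (real m * (real m + real ?N - 2)) * poly (geg ?N m) (z \<bullet> y)"
      proof -
        have e: "2 * ((real ?N - 2) / 2) + 1 = real ?N - 1" "real m + 2 * ((real ?N - 2) / 2) = real m + real ?N - 2"
          by (simp_all add: field_simps)
        show ?thesis
          using gegenbauer_ode[of "z \<bullet> y" "(real ?N - 2) / 2" m] unfolding e by (simp only: mult.commute)
      qed
      then show "poly (pderiv (geg ?N l)) (x \<bullet> y) * poly (pderiv (geg ?N m)) (z \<bullet> y) * (x \<bullet> z - (x \<bullet> y) * (z \<bullet> y))
      + poly (geg ?N l) (x \<bullet> y) * (poly (pderiv (pderiv (geg ?N m))) (z \<bullet> y) * (1 - (z \<bullet> y)\<^sup>2) - (real ?N - 1) * (z \<bullet> y) * poly (pderiv (geg ?N m)) (z \<bullet> y))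
        = E y - (real m * (real m + real ?N - 2)) * P y"
        by (simp add: E_def P_def)
    qed
    also have "\<dots> = integral\<^sup>L uniform_sphere E - (real m * (real m + real ?N - 2)) * integral\<^sup>L uniform_sphere P"
      using i by simp
    finally show ?thesis by (simp add: E_def P_def)
  qed
  define I where "I = (LINT y|uniform_sphere. poly (geg ?N l) (x \<bullet> y) * poly (geg ?N m) (z \<bullet> y))"
  have "real m * (real m + real ?N - 2) * I = real l * (real l + real ?N - 2) * I"
    unfolding I_def using *[OF z, of m l x] *[OF x, of l m z] by (simp add: mult_ac inner_commute[of z x])
  then have "I * ((real m - real l) * (real m + real l + real ?N - 2)) = 0"
    by (simp add: algebra_simps)
  then have "I = 0 \<or> (real m - real l) * (real m + real l + real ?N - 2) = 0"
    by (simp only: mult_eq_0_iff)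
  moreover have "real m + real l + real ?N - 2 > 0" using n by simp
  ultimately show ?thesis using lm by (simp add: I_def)
qed

lemma integral_geg_square_pos:
  fixes x :: "real^'n"
  assumes n: "CARD('n) \<ge> 3" and x: "norm x = 1"
  shows "0 < (LINT y|uniform_sphere. poly (geg CARD('n) l) (x \<bullet> y) * poly (geg CARD('n) l) (x \<bullet> y))"
proof -
  have "geg CARD('n) l \<noteq> 0"
    using gegenbauer_at_1_pos[of "(real CARD('n) - 2) / 2" l] n by auto
  from jacobi_integral_square_pos[OF n this]
  have "0 < jacobi_integral CARD('n) (\<lambda>t. (poly (geg CARD('n) l) t)\<^sup>2)" .
  also have "(\<lambda>t. (poly (geg CARD('n) l) t)\<^sup>2) = poly (geg CARD('n) l * geg CARD('n) l)"
    by (auto simp: power2_eq_square)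
  finally show ?thesis
    unfolding zonal_integral_poly[OF n x, symmetric] by simp
qed

lemma integral_geg_expansion:
  fixes x z :: "real^'n"
  assumes n: "CARD('n) \<ge> 3" and x: "norm x = 1" and z: "norm z = 1"
  shows "(LINT y|uniform_sphere. poly (\<Sum>j\<le>m. smult (b j) (geg CARD('n) j)) (x \<bullet> y) * poly (geg CARD('n) l) (z \<bullet> y))
    = (if l \<le> m then b l * (LINT y|uniform_sphere. poly (geg CARD('n) l) (x \<bullet> y) * poly (geg CARD('n) l) (z \<bullet> y)) else 0)"
proof -
  have "(LINT y|uniform_sphere. poly (\<Sum>j\<le>m. smult (b j) (geg CARD('n) j)) (x \<bullet> y) * poly (geg CARD('n) l) (z \<bullet> y))
    = (LINT y|uniform_sphere. (\<Sum>j\<le>m. b j * (poly (geg CARD('n) j) (x \<bullet> y) * poly (geg CARD('n) l) (z \<bullet> y))))"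
    by (simp add: poly_sum sum_distrib_right mult.assoc)
  also have "\<dots> = (\<Sum>j\<le>m. b j * (LINT y|uniform_sphere. poly (geg CARD('n) j) (x \<bullet> y) * poly (geg CARD('n) l) (z \<bullet> y)))"
    using integrable_zonal_product by (subst Bochner_Integration.integral_sum) auto
  also have "\<dots> = (\<Sum>j\<le>m. if j = l then b l * (LINT y|uniform_sphere. poly (geg CARD('n) l) (x \<bullet> y) * poly (geg CARD('n) l) (z \<bullet> y)) else 0)"
    using geg_orthogonal[OF n x z] by (intro sum.cong refl) auto
  also have "\<dots> = (if l \<le> m then b l * (LINT y|uniform_sphere. poly (geg CARD('n) l) (x \<bullet> y) * poly (geg CARD('n) l) (z \<bullet> y)) else 0)"
    by simp
  finally show ?thesis .
qed

text \<open>A class of test functions on which all integrals exist and which is stable under products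
  and zonal operators.\<close>

definition bounded_on_sphere :: "(real^'n \<Rightarrow> real) \<Rightarrow> bool" where
  "bounded_on_sphere u \<longleftrightarrow> u \<in> borel_measurable uniform_sphere \<and> (\<exists>C. \<forall>x\<in>unit_sphere. \<bar>u x\<bar> \<le> C)"

lemma bounded_on_sphere_continuous: "continuous_on UNIV u \<Longrightarrow> bounded_on_sphere u"
  using continuous_bounded_on_sphere[of u]
  by (simp add: bounded_on_sphere_def borel_measurable_sphere borel_measurable_continuous_onI)

lemma integrable_bounded_on_sphere:
  assumes "bounded_on_sphere u"
  shows "integrable uniform_sphere u"
proof -
  obtain C where "\<forall>x\<in>unit_sphere. \<bar>u x\<bar> \<le> C" using assms by (auto simp: bounded_on_sphere_def)
  then show ?thesis using assms
    by (intro sphere.integrable_const_bound[where B = C]) (auto simp: bounded_on_sphere_def space_uniform_sphere)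
qed

lemma bounded_on_sphere_mult:
  assumes "bounded_on_sphere u" "bounded_on_sphere w"
  shows "bounded_on_sphere (\<lambda>x. u x * w x)"
proof -
  obtain C D where "\<forall>x\<in>unit_sphere. \<bar>u x\<bar> \<le> C" "\<forall>x\<in>unit_sphere. \<bar>w x\<bar> \<le> D"
    using assms by (auto simp: bounded_on_sphere_def)
  then have "\<forall>x\<in>unit_sphere. \<bar>u x * w x\<bar> \<le> \<bar>C\<bar> * \<bar>D\<bar>"
    unfolding abs_mult by (intro ballI mult_mono) force+
  then show ?thesis using assms unfolding bounded_on_sphere_def by auto
qed

interpretation sphere2: pair_prob_space "uniform_sphere :: (real^'n) measure" "uniform_sphere :: (real^'n) measure" ..

lemma zonal_kernel_measurable:
  assumes f: "continuous_on UNIV (f :: real \<Rightarrow> real)"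
  shows "(\<lambda>(x, y). f (x \<bullet> y)) \<in> borel_measurable ((uniform_sphere :: (real^'n) measure) \<Otimes>\<^sub>M uniform_sphere)"
proof -
  have [measurable]: "f \<in> borel_measurable borel" using f by (rule borel_measurable_continuous_onI)
  have "(\<lambda>p. fst p \<bullet> snd p) \<in> borel_measurable ((uniform_sphere :: (real^'n) measure) \<Otimes>\<^sub>M uniform_sphere)"
    by (intro borel_measurable_inner measurable_compose[OF measurable_fst id_measurable_sphere] measurable_compose[OF measurable_snd id_measurable_sphere])
  then have "(\<lambda>p. f (fst p \<bullet> snd p)) \<in> borel_measurable ((uniform_sphere :: (real^'n) measure) \<Otimes>\<^sub>M uniform_sphere)"
    by (rule measurable_compose) measurable
  then show ?thesis by (simp add: case_prod_beta)
qed

lemma zonal_kernel_bounded: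
  assumes f: "continuous_on UNIV (f :: real \<Rightarrow> real)"
  shows "\<exists>C. \<forall>x\<in>unit_sphere. \<forall>y\<in>unit_sphere. \<bar>f ((x :: real^'n) \<bullet> y)\<bar> \<le> C"
proof -
  have "bounded (f ` {-1..1})"
    using f by (intro compact_imp_bounded compact_continuous_image) (auto intro: continuous_on_subset)
  then obtain C where "\<forall>y\<in>f ` {-1..1}. norm y \<le> C" unfolding bounded_iff by blast
  then have "\<bar>f t\<bar> \<le> C" if "t \<in> {-1..1}" for t using that by force
  moreover have "x \<bullet> y \<in> {-1..1}" if "x \<in> unit_sphere" "y \<in> unit_sphere" for x y :: "real^'n"
    using that by (intro inner_unit_range) auto
  ultimately show ?thesis by blast
qed

lemma integrable_zonal_kernel:
  assumes f: "continuous_on UNIV (f :: real \<Rightarrow> real)" and u: "bounded_on_sphere u" and w: "bounded_on_sphere w"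
  shows "integrable ((uniform_sphere :: (real^'n) measure) \<Otimes>\<^sub>M uniform_sphere) (\<lambda>(x, y). w x * (f (x \<bullet> y) * u y))"
proof -
  obtain A C D where b: "\<forall>x\<in>unit_sphere. \<forall>y\<in>unit_sphere. \<bar>f ((x :: real^'n) \<bullet> y)\<bar> \<le> A"
    "\<forall>x\<in>unit_sphere. \<bar>u x\<bar> \<le> C" "\<forall>x\<in>unit_sphere. \<bar>w x\<bar> \<le> D"
    using zonal_kernel_bounded[OF f] u w by (auto simp: bounded_on_sphere_def)
  have [measurable]: "u \<in> borel_measurable uniform_sphere" "w \<in> borel_measurable uniform_sphere"
    using u w by (auto simp: bounded_on_sphere_def)
  note [measurable] = zonal_kernel_measurable[OF f]
  show ?thesis
  proof (rule sphere2.P.integrable_const_bound[where B = "\<bar>D\<bar> * (\<bar>A\<bar> * \<bar>C\<bar>)"])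
    show "AE p in uniform_sphere \<Otimes>\<^sub>M uniform_sphere. norm (case p of (x, y) \<Rightarrow> w x * (f (x \<bullet> y) * u y)) \<le> \<bar>D\<bar> * (\<bar>A\<bar> * \<bar>C\<bar>)"
    proof (rule AE_I2, clarsimp simp: space_pair_measure space_uniform_sphere)
      fix x y :: "real^'n" assume "norm x = 1" "norm y = 1"
      then have "\<bar>f (x \<bullet> y)\<bar> \<le> \<bar>A\<bar>" "\<bar>u y\<bar> \<le> \<bar>C\<bar>" "\<bar>w x\<bar> \<le> \<bar>D\<bar>"
        using b by (auto intro!: order_trans[OF _ abs_ge_self])
      then show "\<bar>w x * (f (x \<bullet> y) * u y)\<bar> \<le> \<bar>D\<bar> * (\<bar>A\<bar> * \<bar>C\<bar>)"
        unfolding abs_mult by (intro mult_mono) auto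
    qed
    have "(\<lambda>p. w (fst p) * ((\<lambda>(x, y). f (x \<bullet> y)) p * u (snd p))) \<in> borel_measurable (uniform_sphere \<Otimes>\<^sub>M uniform_sphere)"
      by measurable
    then show "(\<lambda>(x, y). w x * (f (x \<bullet> y) * u y)) \<in> borel_measurable (uniform_sphere \<Otimes>\<^sub>M uniform_sphere)"
      by (simp add: case_prod_beta)
  qed
qed

definition zonal_op :: "(real \<Rightarrow> real) \<Rightarrow> (real^'n \<Rightarrow> real) \<Rightarrow> real^'n \<Rightarrow> real" where
  "zonal_op f u x = (LINT y|uniform_sphere. f (x \<bullet> y) * u y)"

lemma integrable_zonal_op:
  fixes x :: "real^'n"
  assumes f: "continuous_on UNIV (f :: real \<Rightarrow> real)" and u: "bounded_on_sphere u"
  shows "integrable uniform_sphere (\<lambda>y. f (x \<bullet> y) * u y)"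
  by (intro integrable_bounded_on_sphere bounded_on_sphere_mult u bounded_on_sphere_continuous continuous_on_zonal f)

lemma bounded_on_sphere_zonal_op:
  assumes f: "continuous_on UNIV (f :: real \<Rightarrow> real)" and u: "bounded_on_sphere (u :: real^'n \<Rightarrow> real)"
  shows "bounded_on_sphere (zonal_op f u)"
proof -
  obtain A C where b: "\<forall>x\<in>unit_sphere. \<forall>y\<in>unit_sphere. \<bar>f ((x :: real^'n) \<bullet> y)\<bar> \<le> A" "\<forall>x\<in>unit_sphere. \<bar>u x\<bar> \<le> C"
    using zonal_kernel_bounded[OF f] u by (auto simp: bounded_on_sphere_def)
  have [measurable]: "u \<in> borel_measurable uniform_sphere" using u by (auto simp: bounded_on_sphere_def)
  note [measurable] = zonal_kernel_measurable[OF f]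
  have "(\<lambda>p. (\<lambda>(x, y). f (x \<bullet> y)) p * u (snd p)) \<in> borel_measurable (uniform_sphere \<Otimes>\<^sub>M uniform_sphere)"
    by measurable
  then have "(\<lambda>(x, y). f (x \<bullet> y) * u y) \<in> borel_measurable (uniform_sphere \<Otimes>\<^sub>M uniform_sphere)"
    by (simp add: case_prod_beta)
  then have m: "zonal_op f u \<in> borel_measurable uniform_sphere"
    unfolding zonal_op_def[abs_def] by (rule sphere.borel_measurable_lebesgue_integral)
  have "\<bar>zonal_op f u x\<bar> \<le> \<bar>A\<bar> * \<bar>C\<bar>" if "x \<in> unit_sphere" for x
  proof -
    have "\<bar>zonal_op f u x\<bar> \<le> (LINT y|uniform_sphere. \<bar>f (x \<bullet> y) * u y\<bar>)"
      unfolding zonal_op_def by (rule integral_abs_bound)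
    also have "\<dots> \<le> (LINT y|(uniform_sphere :: (real^'n) measure). \<bar>A\<bar> * \<bar>C\<bar>)"
    proof (rule integral_mono)
      show "integrable uniform_sphere (\<lambda>y. \<bar>f (x \<bullet> y) * u y\<bar>)"
        using integrable_zonal_op[OF f u] by (rule integrable_abs)
      fix y assume "y \<in> space (uniform_sphere :: (real^'n) measure)"
      then show "\<bar>f (x \<bullet> y) * u y\<bar> \<le> \<bar>A\<bar> * \<bar>C\<bar>"
        unfolding abs_mult using b that by (intro mult_mono) (force simp: space_uniform_sphere)+
    qed simp
    finally show ?thesis by (simp add: sphere.prob_space)
  qed
  with m show ?thesis unfolding bounded_on_sphere_def by blast
qed

lemma zonal_op_selfadjoint:
  assumes f: "continuous_on UNIV (f :: real \<Rightarrow> real)" and u: "bounded_on_sphere u" and w: "bounded_on_sphere w"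
  shows "(LINT x|uniform_sphere. w x * zonal_op f u x) = (LINT x|uniform_sphere. zonal_op f w x * u x)"
proof -
  have "(LINT x|uniform_sphere. w x * zonal_op f u x) = (LINT x|uniform_sphere. LINT y|uniform_sphere. w x * (f (x \<bullet> y) * u y))"
    by (simp add: zonal_op_def)
  also have "\<dots> = (LINT y|uniform_sphere. LINT x|uniform_sphere. w x * (f (x \<bullet> y) * u y))"
    by (rule sphere2.Fubini_integral[symmetric]) (rule integrable_zonal_kernel[OF f u w])
  also have "\<dots> = (LINT y|uniform_sphere. zonal_op f w y * u y)"
  proof (intro Bochner_Integration.integral_cong refl)
    fix y
    have "(LINT x|uniform_sphere. w x * (f (x \<bullet> y) * u y)) = (LINT x|uniform_sphere. (f (y \<bullet> x) * w x) * u y)"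
      by (intro Bochner_Integration.integral_cong refl) (simp add: inner_commute[of _ y] ac_simps)
    then show "(LINT x|uniform_sphere. w x * (f (x \<bullet> y) * u y)) = zonal_op f w y * u y"
      by (simp add: zonal_op_def)
  qed
  finally show ?thesis .
qed

lemma zonal_op_compose:
  fixes x :: "real^'n"
  assumes f: "continuous_on UNIV (f :: real \<Rightarrow> real)" and g: "continuous_on UNIV (g :: real \<Rightarrow> real)" and u: "bounded_on_sphere u"
  shows "zonal_op f (zonal_op g u) x = (LINT z|uniform_sphere. (LINT y|uniform_sphere. f (x \<bullet> y) * g (z \<bullet> y)) * u z)"
proof -
  have fx: "bounded_on_sphere (\<lambda>y. f (x \<bullet> y))" by (intro bounded_on_sphere_continuous continuous_on_zonal f)
  have "zonal_op f (zonal_op g u) x = (LINT y|uniform_sphere. f (x \<bullet> y) * zonal_op g u y)" by (simp add: zonal_op_def)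
  also have "\<dots> = (LINT z|uniform_sphere. zonal_op g (\<lambda>y. f (x \<bullet> y)) z * u z)"
    by (rule zonal_op_selfadjoint[OF g u fx])
  finally show ?thesis by (simp add: zonal_op_def mult.commute)
qed

lemma exists_unit_vector: "\<exists>e :: real^'n. norm e = 1"
  by (intro exI[of _ "axis undefined 1"]) simp

text \<open>By \<open>zonal_convolution_poly\<close> the convolution is a zonal polynomial of degree at most \<open>l\<close>. Its
  component along a polynomial of lower index \<open>j\<close> vanishes: by symmetry it is the component along
  index \<open>l\<close> of a convolution with index \<open>j\<close>, which has degree at most \<open>j < l\<close>.\<close>

lemma funk_hecke_poly:
  assumes n: "CARD('n::finite) \<ge> 3"
  shows "\<exists>c. \<forall>x z :: real^'n. norm x = 1 \<longrightarrow> norm z = 1 \<longrightarrow>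
    (LINT y|uniform_sphere. poly W (x \<bullet> y) * poly (geg CARD('n) l) (z \<bullet> y)) = c * poly (geg CARD('n) l) (x \<bullet> z)"
proof -
  let ?C = "geg CARD('n)"
  have a: "(real CARD('n) - 2) / 2 > 0" using n by simp
  have deg: "degree (?C l) \<le> l" for l using gegenbauer_poly_degree[OF a] by blast
  obtain q where q: "degree q \<le> degree (?C l)" "\<forall>x z :: real^'n. norm x = 1 \<longrightarrow> norm z = 1 \<longrightarrow>
    (LINT y|uniform_sphere. poly W (x \<bullet> y) * poly (?C l) (z \<bullet> y)) = poly q (x \<bullet> z)"
    using zonal_convolution_poly[where 'n='n, OF n] by blast
  obtain b where b: "q = (\<Sum>j\<le>l. smult (b j) (?C j))"
    using gegenbauer_span[OF a, of q l] q(1) deg[of l] by auto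
  obtain e :: "real^'n" where e: "norm e = 1" using exists_unit_vector by blast
  have cont: "continuous_on UNIV (poly p)" for p :: "real poly" by (intro continuous_intros)
  have bnd: "bounded_on_sphere (\<lambda>y :: real^'n. poly p (e \<bullet> y))" for p :: "real poly"
    by (intro bounded_on_sphere_continuous continuous_intros)
  have "b j = 0" if j: "j < l" for j
  proof -
    obtain q' where q': "degree q' \<le> degree (?C j)" "\<forall>x z :: real^'n. norm x = 1 \<longrightarrow> norm z = 1 \<longrightarrow>
      (LINT y|uniform_sphere. poly W (x \<bullet> y) * poly (?C j) (z \<bullet> y)) = poly q' (x \<bullet> z)"
      using zonal_convolution_poly[where 'n='n, OF n] by blast
    obtain b' where b': "q' = (\<Sum>i\<le>j. smult (b' i) (?C i))"
      using gegenbauer_span[OF a, of q' j] q'(1) deg[of j] by auto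
    have "b j * (LINT y|uniform_sphere. poly (?C j) (e \<bullet> y) * poly (?C j) (e \<bullet> y)) = (LINT x|uniform_sphere. poly q (e \<bullet> x) * poly (?C j) (e \<bullet> x))"
      unfolding b integral_geg_expansion[OF n e e] using j by simp
    also have "\<dots> = (LINT x|uniform_sphere. zonal_op (poly W) (\<lambda>y. poly (?C l) (e \<bullet> y)) x * poly (?C j) (e \<bullet> x))"
    proof (intro Bochner_Integration.integral_cong refl)
      fix x :: "real^'n" assume "x \<in> space uniform_sphere"
      then have "poly q (e \<bullet> x) = zonal_op (poly W) (\<lambda>y. poly (?C l) (e \<bullet> y)) x"
        using q(2) e by (simp add: zonal_op_def space_uniform_sphere inner_commute[of e x])
      then show "poly q (e \<bullet> x) * poly (?C j) (e \<bullet> x) = zonal_op (poly W) (\<lambda>y. poly (?C l) (e \<bullet> y)) x * poly (?C j) (e \<bullet> x)" by simp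
    qed
    also have "\<dots> = (LINT x|uniform_sphere. poly (?C l) (e \<bullet> x) * zonal_op (poly W) (\<lambda>y. poly (?C j) (e \<bullet> y)) x)"
      by (rule zonal_op_selfadjoint[OF cont bnd bnd, symmetric])
    also have "\<dots> = (LINT x|uniform_sphere. poly q' (e \<bullet> x) * poly (?C l) (e \<bullet> x))"
    proof (intro Bochner_Integration.integral_cong refl)
      fix x :: "real^'n" assume "x \<in> space uniform_sphere"
      then have "poly q' (e \<bullet> x) = zonal_op (poly W) (\<lambda>y. poly (?C j) (e \<bullet> y)) x"
        using q'(2) e by (simp add: zonal_op_def space_uniform_sphere inner_commute[of e x])
      then show "poly (?C l) (e \<bullet> x) * zonal_op (poly W) (\<lambda>y. poly (?C j) (e \<bullet> y)) x = poly q' (e \<bullet> x) * poly (?C l) (e \<bullet> x)" by simp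
    qed
    also have "\<dots> = 0" unfolding b' integral_geg_expansion[OF n e e] using j by simp
    finally show ?thesis using integral_geg_square_pos[OF n e, of j] by simp
  qed
  then have "q = (\<Sum>j\<le>l. if j = l then smult (b l) (?C l) else 0)"
    unfolding b by (intro sum.cong refl) auto
  then have "q = smult (b l) (?C l)" by simp
  then show ?thesis using q(2) by (intro exI[of _ "b l"]) simp
qed

lemma gegenbauer_coeff_eq:
  "gegenbauer_coeff n W l = jacobi_integral n (\<lambda>t. W t * (poly (geg n l) t / poly (geg n l) 1))"
  by (simp add: gegenbauer_coeff_def jacobi_integral_def jacobi_const_def poly_gegenbauer)

lemma geg_1_pos: "n \<ge> 3 \<Longrightarrow> poly (geg n l) 1 > 0"
  by (intro gegenbauer_at_1_pos) simp

lemma gegenbauer_coeff_diff_bound: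
  assumes n: "n \<ge> 3" and f: "continuous_on {-1..1} f" and g: "continuous_on {-1..1} g"
    and le: "\<And>t. t \<in> {-1..1} \<Longrightarrow> \<bar>(f t - g t) * (poly (geg n l) t / poly (geg n l) 1)\<bar> \<le> C"
  shows "\<bar>gegenbauer_coeff n f l - gegenbauer_coeff n g l\<bar> \<le> C"
proof -
  have c: "continuous_on {-1..1} (\<lambda>t. h t * (poly (geg n l) t / poly (geg n l) 1))" if "continuous_on {-1..1} h" for h
    using that geg_1_pos[OF n, of l] by (intro continuous_intros) auto
  have "gegenbauer_coeff n f l - gegenbauer_coeff n g l =
    jacobi_integral n (\<lambda>t. 1 * (f t * (poly (geg n l) t / poly (geg n l) 1)) + (-1) * (g t * (poly (geg n l) t / poly (geg n l) 1)))"
    unfolding gegenbauer_coeff_eq by (subst jacobi_integral_linear[OF n c[OF f] c[OF g]]) simp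
  also have "\<bar>\<dots>\<bar> \<le> C"
  proof (rule jacobi_integral_bound[OF n])
    show "continuous_on {-1..1} (\<lambda>t. 1 * (f t * (poly (geg n l) t / poly (geg n l) 1)) + (-1) * (g t * (poly (geg n l) t / poly (geg n l) 1)))"
      by (intro continuous_on_add continuous_on_mult continuous_on_const c[OF f] c[OF g])
    fix t :: real assume "t \<in> {-1..1}"
    then show "\<bar>1 * (f t * (poly (geg n l) t / poly (geg n l) 1)) + (-1) * (g t * (poly (geg n l) t / poly (geg n l) 1))\<bar> \<le> C"
    proof -
      have eq: "1 * (f t * r) + (-1) * (g t * r) = (f t - g t) * r" for r by (simp add: algebra_simps)
      show ?thesis unfolding eq using \<open>t \<in> {-1..1}\<close> by (rule le)
    qed
  qed
  finally show ?thesis .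
qed

text \<open>The constant in \<open>funk_hecke_poly\<close> is found by setting \<open>x = z\<close> and evaluating the zonal
  integral.\<close>

lemma funk_hecke_poly_coeff:
  fixes x z :: "real^'n"
  assumes n: "CARD('n) \<ge> 3" and x: "norm x = 1" and z: "norm z = 1"
  shows "(LINT y|uniform_sphere. poly W (x \<bullet> y) * poly (geg CARD('n) l) (z \<bullet> y))
    = gegenbauer_coeff CARD('n) (poly W) l * poly (geg CARD('n) l) (x \<bullet> z)"
proof -
  let ?C = "geg CARD('n)"
  obtain c where c: "\<forall>x z :: real^'n. norm x = 1 \<longrightarrow> norm z = 1 \<longrightarrow>
    (LINT y|uniform_sphere. poly W (x \<bullet> y) * poly (?C l) (z \<bullet> y)) = c * poly (?C l) (x \<bullet> z)"
    using funk_hecke_poly[where 'n='n, OF n] by blast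
  have "x \<bullet> x = 1" using x by (simp add: norm_eq_1)
  then have "c * poly (?C l) 1 = (LINT y|uniform_sphere. poly W (x \<bullet> y) * poly (?C l) (x \<bullet> y))"
    using c x by simp
  also have "\<dots> = (LINT y|uniform_sphere. poly (?C l) 1 * poly (smult (1 / poly (?C l) 1) (W * ?C l)) (x \<bullet> y))"
    using geg_1_pos[OF n, of l] by simp
  also have "\<dots> = poly (?C l) 1 * jacobi_integral CARD('n) (poly (smult (1 / poly (?C l) 1) (W * ?C l)))"
    by (simp only: integral_mult_right_zero zonal_integral_poly[OF n x])
  also have "poly (smult (1 / poly (?C l) 1) (W * ?C l)) = (\<lambda>t. poly W t * (poly (?C l) t / poly (?C l) 1))"
    by (auto simp: fun_eq_iff)
  finally have "c = gegenbauer_coeff CARD('n) (poly W) l"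
    using geg_1_pos[OF n, of l] by (simp add: gegenbauer_coeff_eq)
  then show ?thesis using c x z by blast
qed

text \<open>Uniform approximation of \<open>W\<close> by polynomials; both sides are continuous in \<open>W\<close> for the
  supremum norm on \<open>[-1, 1]\<close>.\<close>

lemma funk_hecke:
  fixes x z :: "real^'n"
  assumes n: "CARD('n) \<ge> 3" and W: "continuous_on UNIV W" and x: "norm x = 1" and z: "norm z = 1"
  shows "(LINT y|uniform_sphere. W (x \<bullet> y) * poly (geg CARD('n) l) (z \<bullet> y))
    = gegenbauer_coeff CARD('n) W l * poly (geg CARD('n) l) (x \<bullet> z)"
proof -
  let ?N = "CARD('n)" let ?C = "geg CARD('n) l"
  have W1: "continuous_on {-1..1} W" using W by (rule continuous_on_subset) simp
  have "bounded (poly ?C ` {-1..1})" by (intro compact_imp_bounded compact_continuous_image continuous_intros) auto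
  then obtain S where S: "\<forall>y\<in>poly ?C ` {-1..1}. norm y \<le> S" and S0: "S > 0" unfolding bounded_pos by blast
  have Sb: "\<bar>poly ?C t\<bar> \<le> S" if "t \<in> {-1..1}" for t using S that by force
  define c where "c = poly ?C 1"
  have c: "c > 0" unfolding c_def by (rule geg_1_pos[OF n])
  define D where "D = S + S / c * S"
  have D: "D > 0" using S0 c by (simp add: D_def add_pos_pos)
  define X where "X = (LINT y|uniform_sphere. W (x \<bullet> y) * poly ?C (z \<bullet> y)) - gegenbauer_coeff ?N W l * poly ?C (x \<bullet> z)"
  have "\<bar>X\<bar> \<le> 0 + e" if e: "e > 0" for e
  proof -
    define \<epsilon> where "\<epsilon> = e / D"
    have \<epsilon>: "\<epsilon> > 0" using e D by (simp add: \<epsilon>_def)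
    obtain p where p: "\<forall>t\<in>{-1..1}. \<bar>W t - poly p t\<bar> < \<epsilon>" using poly_uniform_approx[OF W1 \<epsilon>] by blast
    have pc: "continuous_on UNIV (poly p)" "continuous_on {-1..1} (poly p)" by (intro continuous_intros)+
    have Cb: "bounded_on_sphere (\<lambda>y. poly ?C (z \<bullet> y))" by (intro bounded_on_sphere_continuous continuous_intros)
    have "\<bar>(LINT y|uniform_sphere. W (x \<bullet> y) * poly ?C (z \<bullet> y)) - (LINT y|uniform_sphere. poly p (x \<bullet> y) * poly ?C (z \<bullet> y))\<bar>
      = \<bar>LINT y|uniform_sphere. W (x \<bullet> y) * poly ?C (z \<bullet> y) - poly p (x \<bullet> y) * poly ?C (z \<bullet> y)\<bar>"
      by (subst Bochner_Integration.integral_diff[OF integrable_zonal_op[OF W Cb] integrable_zonal_op[OF pc(1) Cb]]) simp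
    also have "\<dots> \<le> (LINT y|uniform_sphere. \<bar>W (x \<bullet> y) * poly ?C (z \<bullet> y) - poly p (x \<bullet> y) * poly ?C (z \<bullet> y)\<bar>)"
      by (rule integral_abs_bound)
    also have "\<dots> \<le> (LINT y|(uniform_sphere :: (real^'n) measure). \<epsilon> * S)"
    proof (rule integral_mono)
      show "integrable uniform_sphere (\<lambda>y. \<bar>W (x \<bullet> y) * poly ?C (z \<bullet> y) - poly p (x \<bullet> y) * poly ?C (z \<bullet> y)\<bar>)"
        by (intro integrable_abs Bochner_Integration.integrable_diff integrable_zonal_op[OF W Cb] integrable_zonal_op[OF pc(1) Cb])
      fix y assume "y \<in> space (uniform_sphere :: (real^'n) measure)"
      then have "norm y = 1" by (simp add: space_uniform_sphere)
      then have "x \<bullet> y \<in> {-1..1}" "z \<bullet> y \<in> {-1..1}" using x z by (auto intro: inner_unit_range simp del: atLeastAtMost_iff)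
      then have "\<bar>W (x \<bullet> y) - poly p (x \<bullet> y)\<bar> * \<bar>poly ?C (z \<bullet> y)\<bar> \<le> \<epsilon> * S"
        using p Sb \<epsilon> by (intro mult_mono) (auto simp: less_imp_le)
      then show "\<bar>W (x \<bullet> y) * poly ?C (z \<bullet> y) - poly p (x \<bullet> y) * poly ?C (z \<bullet> y)\<bar> \<le> \<epsilon> * S"
        by (simp add: abs_mult[symmetric] left_diff_distrib)
    qed simp
    also have "\<dots> = \<epsilon> * S" by (simp add: sphere.prob_space)
    finally have 1: "\<bar>(LINT y|uniform_sphere. W (x \<bullet> y) * poly ?C (z \<bullet> y)) - gegenbauer_coeff ?N (poly p) l * poly ?C (x \<bullet> z)\<bar> \<le> \<epsilon> * S"
      unfolding funk_hecke_poly_coeff[OF n x z] .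
    have "\<bar>gegenbauer_coeff ?N W l - gegenbauer_coeff ?N (poly p) l\<bar> \<le> \<epsilon> * (S / c)"
    proof (rule gegenbauer_coeff_diff_bound[OF n W1 pc(2)])
      fix t :: real assume t: "t \<in> {-1..1}"
      have "\<bar>W t - poly p t\<bar> * (\<bar>poly ?C t\<bar> / c) \<le> \<epsilon> * (S / c)"
        using p t Sb[OF t] \<epsilon> c by (intro mult_mono divide_right_mono) (auto simp: less_imp_le)
      then show "\<bar>(W t - poly p t) * (poly ?C t / poly ?C 1)\<bar> \<le> \<epsilon> * (S / c)"
        using c by (simp add: abs_mult c_def)
    qed
    then have "\<bar>gegenbauer_coeff ?N W l - gegenbauer_coeff ?N (poly p) l\<bar> * \<bar>poly ?C (x \<bullet> z)\<bar> \<le> \<epsilon> * (S / c) * S"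
      using Sb[OF inner_unit_range[OF x z]] \<epsilon> S0 c by (intro mult_mono) auto
    then have 2: "\<bar>gegenbauer_coeff ?N W l * poly ?C (x \<bullet> z) - gegenbauer_coeff ?N (poly p) l * poly ?C (x \<bullet> z)\<bar> \<le> \<epsilon> * (S / c) * S"
      by (simp add: abs_mult[symmetric] left_diff_distrib)
    have "\<bar>X\<bar> \<le> \<epsilon> * S + \<epsilon> * (S / c) * S" unfolding X_def using 1 2 by linarith
    also have "\<dots> = \<epsilon> * D" by (simp add: D_def algebra_simps)
    also have "\<dots> = e" using D by (simp add: \<epsilon>_def)
    finally show ?thesis by simp
  qed
  then have "\<bar>X\<bar> \<le> 0" by (rule field_le_epsilon)
  then show ?thesis by (simp add: X_def)
qed

section \<open>Lower bound of the quadratic form\<close>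

text \<open>The eigenvalue of convolution with the polynomial itself: the kernel divided by it is an
  orthogonal projection, by \<open>zonal_op_geg_compose\<close>.\<close>

definition geg_norm :: "nat \<Rightarrow> nat \<Rightarrow> real" where
  "geg_norm n l = gegenbauer_coeff n (poly (geg n l)) l"

lemma geg_reproducing:
  fixes x z :: "real^'n"
  assumes n: "CARD('n) \<ge> 3" and x: "norm x = 1" and z: "norm z = 1"
  shows "(LINT y|uniform_sphere. poly (geg CARD('n) l) (x \<bullet> y) * poly (geg CARD('n) m) (z \<bullet> y))
    = (if l = m then geg_norm CARD('n) l * poly (geg CARD('n) l) (x \<bullet> z) else 0)"
  using geg_orthogonal[OF n x z] funk_hecke_poly_coeff[OF n x z, of "geg CARD('n) l" l]
  by (auto simp: geg_norm_def)

lemma geg_norm_pos: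
  assumes n: "CARD('n::finite) \<ge> 3"
  shows "geg_norm CARD('n) l > 0"
proof -
  obtain e :: "real^'n" where e: "norm e = 1" using exists_unit_vector by blast
  then have "e \<bullet> e = 1" by (simp add: norm_eq_1)
  then have "0 < geg_norm CARD('n) l * poly (geg CARD('n) l) 1"
    using integral_geg_square_pos[OF n e, of l] geg_reproducing[OF n e e, of l l] by simp
  then show ?thesis using geg_1_pos[OF n, of l] by (simp add: zero_less_mult_iff)
qed

text \<open>Apply \<open>2 a b \<le> a\<^sup>2 + b\<^sup>2\<close> under the integral in the reproducing formula \<open>geg_reproducing\<close>,
  whose left-hand side at \<open>x = z\<close> is the integral of a square.\<close>

lemma geg_inner_le_at_1:
  fixes x z :: "real^'n"
  assumes n: "CARD('n) \<ge> 3" and x: "norm x = 1" and z: "norm z = 1"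
  shows "\<bar>poly (geg CARD('n) l) (x \<bullet> z)\<bar> \<le> poly (geg CARD('n) l) 1"
proof -
  let ?C = "poly (geg CARD('n) l)" let ?h = "geg_norm CARD('n) l"
  have sq: "(LINT y|uniform_sphere. ?C (x \<bullet> y) * ?C (x \<bullet> y)) = ?h * ?C 1" if "norm x = 1" for x :: "real^'n"
    using geg_reproducing[OF n that that, of l l] that by (simp add: norm_eq_1[THEN iffD1])
  have i: "integrable uniform_sphere (\<lambda>y. ?C (x \<bullet> y) * ?C (z \<bullet> y))" for x z :: "real^'n"
    by (rule integrable_zonal_product)
  have "?h * \<bar>?C (x \<bullet> z)\<bar> = \<bar>LINT y|uniform_sphere. ?C (x \<bullet> y) * ?C (z \<bullet> y)\<bar>"
    using geg_reproducing[OF n x z, of l l] geg_norm_pos[OF n, of l] by (simp add: abs_mult)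
  also have "\<dots> \<le> (LINT y|uniform_sphere. \<bar>?C (x \<bullet> y) * ?C (z \<bullet> y)\<bar>)" by (rule integral_abs_bound)
  also have "\<dots> \<le> (LINT y|uniform_sphere. 1/2 * (?C (x \<bullet> y) * ?C (x \<bullet> y)) + 1/2 * (?C (z \<bullet> y) * ?C (z \<bullet> y)))"
  proof (rule integral_mono)
    fix y
    have "0 \<le> (\<bar>?C (x \<bullet> y)\<bar> - \<bar>?C (z \<bullet> y)\<bar>)\<^sup>2" by simp
    then show "\<bar>?C (x \<bullet> y) * ?C (z \<bullet> y)\<bar> \<le> 1/2 * (?C (x \<bullet> y) * ?C (x \<bullet> y)) + 1/2 * (?C (z \<bullet> y) * ?C (z \<bullet> y))"
      by (simp add: power2_eq_square abs_mult algebra_simps)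
  qed (use i in auto)
  also have "\<dots> = ?h * ?C 1" using i sq[OF x] sq[OF z] by simp
  finally show ?thesis using geg_norm_pos[OF n, of l] by simp
qed

lemma zonal_op_geg_compose:
  fixes x :: "real^'n"
  assumes n: "CARD('n) \<ge> 3" and u: "bounded_on_sphere u" and x: "norm x = 1"
  shows "zonal_op (poly (geg CARD('n) l)) (zonal_op (poly (geg CARD('n) m)) u) x
    = (if l = m then geg_norm CARD('n) l * zonal_op (poly (geg CARD('n) l)) u x else 0)"
proof -
  have c: "continuous_on UNIV (poly p)" for p :: "real poly" by (intro continuous_intros)
  have "zonal_op (poly (geg CARD('n) l)) (zonal_op (poly (geg CARD('n) m)) u) x
    = (LINT z|uniform_sphere. (if l = m then geg_norm CARD('n) l * poly (geg CARD('n) l) (x \<bullet> z) else 0) * u z)"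
    unfolding zonal_op_compose[OF c c u]
    using geg_reproducing[OF n x] by (intro Bochner_Integration.integral_cong refl) (simp add: space_uniform_sphere)
  then show ?thesis by (auto simp: zonal_op_def mult.assoc)
qed

text \<open>The quotient \<open>A l / geg_norm n l\<close> is the squared norm of the projection of \<open>u\<close> to the
  eigenspace of index \<open>l\<close>, because these projections are symmetric, idempotent and mutually
  orthogonal. The inequality expresses that \<open>u\<close> minus its partial expansion \<open>w\<close> has nonnegative
  square integral.\<close>

lemma zonal_bessel:
  fixes u :: "real^'n \<Rightarrow> real"
  assumes n: "CARD('n) \<ge> 3" and u: "bounded_on_sphere u"
  defines "A l \<equiv> (LINT x|uniform_sphere. u x * zonal_op (poly (geg CARD('n) l)) u x)"
  shows "0 \<le> A l" "(\<Sum>l\<le>N. A l / geg_norm CARD('n) l) \<le> (LINT x|uniform_sphere. (u x)\<^sup>2)"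
proof -
  let ?C = "\<lambda>l. poly (geg CARD('n) l)" let ?h = "geg_norm CARD('n)"
  have c: "continuous_on UNIV (poly p)" for p :: "real poly" by (intro continuous_intros)
  have b: "bounded_on_sphere (zonal_op (?C l) u)" for l by (rule bounded_on_sphere_zonal_op[OF c u])
  have TT: "(LINT x|uniform_sphere. zonal_op (?C l) u x * zonal_op (?C m) u x) = (if l = m then ?h l * A l else 0)" for l m
  proof -
    have "(LINT x|uniform_sphere. zonal_op (?C l) u x * zonal_op (?C m) u x)
       = (LINT x|uniform_sphere. u x * zonal_op (?C l) (zonal_op (?C m) u) x)"
      by (rule zonal_op_selfadjoint[OF c b u, symmetric])
    also have "\<dots> = (LINT x|uniform_sphere. u x * (if l = m then ?h l * zonal_op (?C l) u x else 0))"
      using zonal_op_geg_compose[OF n u] by (intro Bochner_Integration.integral_cong refl) (simp add: space_uniform_sphere)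
    also have "\<dots> = (if l = m then ?h l * A l else 0)"
      by (auto simp: A_def mult.left_commute[of _ "?h m"])
    finally show ?thesis .
  qed
  have h: "?h l > 0" for l by (rule geg_norm_pos[OF n])
  have "0 \<le> (LINT x|uniform_sphere. zonal_op (?C l) u x * zonal_op (?C l) u x)"
    by (intro Bochner_Integration.integral_nonneg) simp
  then show "0 \<le> A l" using TT[of l l] h[of l] by (simp add: zero_le_mult_iff)
  define w where "w x = (\<Sum>l\<le>N. (1 / ?h l) * zonal_op (?C l) u x)" for x
  have i1: "integrable uniform_sphere (\<lambda>x. u x * u x)" by (intro integrable_bounded_on_sphere bounded_on_sphere_mult u)
  have i2: "integrable uniform_sphere (\<lambda>x. u x * zonal_op (?C l) u x)" for l
    by (intro integrable_bounded_on_sphere bounded_on_sphere_mult u b)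
  have i3: "integrable uniform_sphere (\<lambda>x. zonal_op (?C l) u x * zonal_op (?C m) u x)" for l m
    by (intro integrable_bounded_on_sphere bounded_on_sphere_mult b)
  have uw: "u x * w x = (\<Sum>l\<le>N. (1 / ?h l) * (u x * zonal_op (?C l) u x))" for x
    by (simp add: w_def sum_distrib_left mult.left_commute)
  have ww: "w x * w x = (\<Sum>l\<le>N. \<Sum>m\<le>N. ((1 / ?h l) * (1 / ?h m)) * (zonal_op (?C l) u x * zonal_op (?C m) u x))" for x
    unfolding w_def sum_product by (intro sum.cong refl) (simp only: ac_simps)
  have iu: "integrable uniform_sphere (\<lambda>x. u x * w x)" unfolding uw using i2 by (intro Bochner_Integration.integrable_sum integrable_mult_right)
  have iw: "integrable uniform_sphere (\<lambda>x. w x * w x)" unfolding ww using i3 by (intro Bochner_Integration.integrable_sum integrable_mult_right)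
  have 1: "(LINT x|uniform_sphere. u x * w x) = (\<Sum>l\<le>N. A l / ?h l)"
    unfolding uw using i2 by (subst Bochner_Integration.integral_sum) (auto simp: A_def)
  have "(LINT x|uniform_sphere. w x * w x) = (\<Sum>l\<le>N. \<Sum>m\<le>N. ((1 / ?h l) * (1 / ?h m)) * (if l = m then ?h l * A l else 0))"
  proof -
    have "(LINT x|uniform_sphere. w x * w x) = (\<Sum>l\<le>N. LINT x|uniform_sphere.
        (\<Sum>m\<le>N. ((1 / ?h l) * (1 / ?h m)) * (zonal_op (?C l) u x * zonal_op (?C m) u x)))"
      unfolding ww using i3 by (intro Bochner_Integration.integral_sum Bochner_Integration.integrable_sum integrable_mult_right)
    also have "\<dots> = (\<Sum>l\<le>N. \<Sum>m\<le>N. LINT x|uniform_sphere. ((1 / ?h l) * (1 / ?h m)) * (zonal_op (?C l) u x * zonal_op (?C m) u x))"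
      using i3 by (intro sum.cong refl Bochner_Integration.integral_sum integrable_mult_right)
    finally show ?thesis by (simp only: integral_mult_right_zero TT)
  qed
  also have "\<dots> = (\<Sum>l\<le>N. \<Sum>m\<le>N. if l = m then A l / ?h l else 0)"
    using h[THEN less_imp_neq] by (intro sum.cong refl) auto
  also have "\<dots> = (\<Sum>l\<le>N. A l / ?h l)" by simp
  finally have 2: "(LINT x|uniform_sphere. w x * w x) = (\<Sum>l\<le>N. A l / ?h l)" .
  have "0 \<le> (LINT x|uniform_sphere. u x * u x - 2 * (u x * w x) + w x * w x)"
  proof (intro Bochner_Integration.integral_nonneg)
    fix x
    have "0 \<le> (u x - w x)\<^sup>2" by simp
    then show "0 \<le> u x * u x - 2 * (u x * w x) + w x * w x" by (simp add: power2_eq_square algebra_simps)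
  qed
  also have "\<dots> = (LINT x|uniform_sphere. u x * u x) - 2 * (LINT x|uniform_sphere. u x * w x) + (LINT x|uniform_sphere. w x * w x)"
    using i1 iu iw by simp
  finally show "(\<Sum>l\<le>N. A l / ?h l) \<le> (LINT x|uniform_sphere. (u x)\<^sup>2)"
    unfolding 1 2 by (simp add: power2_eq_square)
qed

text \<open>A continuous path of unit vectors that realizes every inner product \<open>t\<close> with a fixed unit
  vector.\<close>

definition tilted_unit :: "'n \<Rightarrow> 'n \<Rightarrow> real \<Rightarrow> real^'n" where
  "tilted_unit i j t = t *\<^sub>R axis i 1 + sqrt (1 - t\<^sup>2) *\<^sub>R axis j 1"

lemma tilted_unit:
  assumes "i \<noteq> j" "t \<in> {-1..1}"
  shows "norm (tilted_unit i j t) = 1" "axis i 1 \<bullet> tilted_unit i j t = t"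
proof -
  have "t\<^sup>2 \<le> 1" using assms by (simp add: abs_square_le_1 abs_le_iff)
  then have "tilted_unit i j t \<bullet> tilted_unit i j t = 1"
    using assms by (simp add: tilted_unit_def inner_add_left inner_add_right inner_axis_axis power2_eq_square[symmetric])
  then show "norm (tilted_unit i j t) = 1" by (simp add: norm_eq_1)
  show "axis i 1 \<bullet> tilted_unit i j t = t"
    using assms by (simp add: tilted_unit_def inner_add_right inner_axis_axis)
qed

lemma two_indices:
  assumes "CARD('n::finite) \<ge> 3"
  shows "\<exists>i j :: 'n. i \<noteq> j"
proof (rule ccontr)
  assume "\<not> ?thesis"
  then have "card (UNIV :: 'n set) \<le> Suc 0" by (subst card_le_Suc0_iff_eq) auto
  then show False using assms by simp
qed

lemma geg_le_at_1:
  assumes n: "CARD('n::finite) \<ge> 3" and t: "t \<in> {-1..1}"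
  shows "\<bar>poly (geg CARD('n) l) t\<bar> \<le> poly (geg CARD('n) l) 1"
proof -
  obtain i j :: 'n where "i \<noteq> j" using two_indices[OF n] by blast
  from geg_inner_le_at_1[OF n _ tilted_unit(1)[OF this t], of "axis i 1" l] tilted_unit(2)[OF this t]
  show ?thesis by simp
qed

text \<open>The bound does not depend on \<open>l\<close>, thanks to \<open>geg_le_at_1\<close>; this uniformity lets one
  polynomial approximation serve all indices at once in \<open>zonal_quadratic_form_lower\<close>.\<close>

lemma gegenbauer_coeff_approx:
  assumes n: "CARD('n::finite) \<ge> 3" and f: "continuous_on {-1..1} f" and g: "continuous_on {-1..1} g"
    and le: "\<And>t. t \<in> {-1..1} \<Longrightarrow> \<bar>f t - g t\<bar> \<le> C"
  shows "\<bar>gegenbauer_coeff CARD('n) f l - gegenbauer_coeff CARD('n) g l\<bar> \<le> C"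
proof (rule gegenbauer_coeff_diff_bound[OF n f g])
  fix t :: real assume t: "t \<in> {-1..1}"
  have C: "0 \<le> C" using le[OF t] by linarith
  have "\<bar>poly (geg CARD('n) l) t / poly (geg CARD('n) l) 1\<bar> \<le> 1"
    using geg_le_at_1[OF n t, of l] geg_1_pos[OF n, of l] by simp
  then have "\<bar>f t - g t\<bar> * \<bar>poly (geg CARD('n) l) t / poly (geg CARD('n) l) 1\<bar> \<le> C * 1"
    using le[OF t] C by (intro mult_mono) auto
  then show "\<bar>(f t - g t) * (poly (geg CARD('n) l) t / poly (geg CARD('n) l) 1)\<bar> \<le> C"
    by (simp only: abs_mult mult_1_right)
qed

lemma zonal_op_bound:
  fixes u :: "real^'n \<Rightarrow> real"
  assumes f: "continuous_on UNIV f" and u: "bounded_on_sphere u" and u1: "\<And>x. \<bar>u x\<bar> \<le> 1"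
    and x: "norm x = 1" and le: "\<And>t. t \<in> {-1..1} \<Longrightarrow> \<bar>f t\<bar> \<le> C"
  shows "\<bar>zonal_op f u x\<bar> \<le> C"
proof -
  have C: "0 \<le> C" using le[of 0] by simp
  have "\<bar>zonal_op f u x\<bar> \<le> (LINT y|uniform_sphere. \<bar>f (x \<bullet> y) * u y\<bar>)"
    unfolding zonal_op_def by (rule integral_abs_bound)
  also have "\<dots> \<le> (LINT y|(uniform_sphere :: (real^'n) measure). C)"
  proof (rule integral_mono)
    show "integrable uniform_sphere (\<lambda>y. \<bar>f (x \<bullet> y) * u y\<bar>)"
      using integrable_zonal_op[OF f u] by (rule integrable_abs)
    fix y assume "y \<in> space (uniform_sphere :: (real^'n) measure)"
    then have "x \<bullet> y \<in> {-1..1}" using x by (intro inner_unit_range) (auto simp: space_uniform_sphere)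
    then have "\<bar>f (x \<bullet> y)\<bar> * \<bar>u y\<bar> \<le> C * 1" using le u1 C by (intro mult_mono) auto
    then show "\<bar>f (x \<bullet> y) * u y\<bar> \<le> C" by (simp add: abs_mult)
  qed simp
  finally show ?thesis by (simp add: sphere.prob_space)
qed

text \<open>Replace \<open>W\<close> by a polynomial \<open>p\<close> that is uniformly close. Its quadratic form is a finite sum
  of its coefficients, which are close to those of \<open>W\<close>, times the squared norms of the projections
  of \<open>u\<close>. The indices \<open>l \<ge> 1\<close> contribute at least \<open>- lam\<close> times the square integral of \<open>u\<close> by
  Bessel's inequality, as \<open>- lam\<close> is negative, and the index \<open>0\<close> contributes a multiple of the
  square of the mean.\<close>

lemma zonal_quadratic_form_lower:
  fixes u :: "real^'n \<Rightarrow> real"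
  assumes n: "CARD('n) \<ge> 3" and W: "continuous_on UNIV W" and B: "\<And>t. \<bar>W t\<bar> \<le> B"
    and lam: "0 < lam" "\<And>l. l \<ge> 1 \<Longrightarrow> - lam \<le> gegenbauer_coeff CARD('n) W l"
    and um: "u \<in> borel_measurable uniform_sphere" and u1: "\<And>x. \<bar>u x\<bar> \<le> 1"
  shows "- lam * (LINT x|uniform_sphere. (u x)\<^sup>2) - B * (LINT x|uniform_sphere. u x)\<^sup>2
    \<le> (LINT x|uniform_sphere. u x * zonal_op W u x)"
proof (rule field_le_epsilon)
  let ?C = "geg CARD('n)" let ?h = "geg_norm CARD('n)"
  have u: "bounded_on_sphere u" using um u1 by (auto simp: bounded_on_sphere_def)
  have a: "(real CARD('n) - 2) / 2 > 0" using n by simp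
  obtain x0 :: "real^'n" where x0: "norm x0 = 1" using exists_unit_vector by blast
  have W1: "continuous_on {-1..1} W" using W by (rule continuous_on_subset) simp
  define I m where "I = (LINT x|uniform_sphere. (u x)\<^sup>2)" and "m = (LINT x|uniform_sphere. u x)"
  have B0: "0 \<le> B" using B[of 0] by linarith
  have ui: "integrable uniform_sphere u" by (rule integrable_bounded_on_sphere[OF u])
  have u2i: "integrable uniform_sphere (\<lambda>x. (u x)\<^sup>2)"
    unfolding power2_eq_square by (intro integrable_bounded_on_sphere bounded_on_sphere_mult u)
  have "I \<le> (LINT x|(uniform_sphere :: (real^'n) measure). 1)"
    unfolding I_def using u2i u1 by (intro integral_mono) (auto simp: abs_square_le_1)
  then have I1: "I \<le> 1" by (simp add: sphere.prob_space)
  have "\<bar>m\<bar> \<le> (LINT x|uniform_sphere. \<bar>u x\<bar>)" unfolding m_def by (rule integral_abs_bound)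
  also have "\<dots> \<le> (LINT x|(uniform_sphere :: (real^'n) measure). 1)"
    using ui u1 by (intro integral_mono) auto
  finally have m1: "m\<^sup>2 \<le> 1" by (simp add: sphere.prob_space abs_square_le_1)
  define A where "A l = (LINT x|uniform_sphere. u x * zonal_op (poly (?C l)) u x)" for l
  fix e :: real assume e: "e > 0"
  define \<epsilon> where "\<epsilon> = e / 3"
  have \<epsilon>: "\<epsilon> > 0" using e by (simp add: \<epsilon>_def)
  obtain p where p: "\<forall>t\<in>{-1..1}. \<bar>W t - poly p t\<bar> < \<epsilon>" using poly_uniform_approx[OF W1 \<epsilon>] by blast
  have pc: "continuous_on UNIV (poly p)" "continuous_on {-1..1} (poly p)" by (intro continuous_intros)+
  define N where "N = degree p"
  obtain b where b: "p = (\<Sum>j\<le>N. smult (b j) (?C j))" using gegenbauer_span[OF a, of p N] by (auto simp: N_def)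
  have cf: "gegenbauer_coeff CARD('n) (poly p) l = b l * ?h l" if "l \<le> N" for l
  proof -
    have "x0 \<bullet> x0 = 1" using x0 by (simp add: norm_eq_1)
    then have "gegenbauer_coeff CARD('n) (poly p) l * poly (?C l) 1 = (LINT y|uniform_sphere. poly p (x0 \<bullet> y) * poly (?C l) (x0 \<bullet> y))"
      using funk_hecke_poly_coeff[OF n x0 x0, of p l] by simp
    also have "\<dots> = b l * (?h l * poly (?C l) 1)"
      unfolding b integral_geg_expansion[OF n x0 x0] geg_reproducing[OF n x0 x0] using that \<open>x0 \<bullet> x0 = 1\<close> by simp
    finally show ?thesis using geg_1_pos[OF n, of l] by simp
  qed
  have h: "?h l > 0" for l by (rule geg_norm_pos[OF n])
  have "poly (gegenbauer_poly r 0) t = 1" for r t :: real by simp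
  then have h0: "?h 0 = 1" "A 0 = m\<^sup>2"
    using geg_reproducing[OF n x0 x0, of 0 0] by (simp_all add: sphere.prob_space A_def zonal_op_def m_def power2_eq_square)
  have Tp: "zonal_op (poly p) u x = (\<Sum>l\<le>N. b l * zonal_op (poly (?C l)) u x)" for x
  proof -
    have "zonal_op (poly p) u x = (LINT y|uniform_sphere. (\<Sum>l\<le>N. b l * (poly (?C l) (x \<bullet> y) * u y)))"
      unfolding zonal_op_def by (subst b) (simp add: poly_sum sum_distrib_right mult.assoc)
    also have "\<dots> = (\<Sum>l\<le>N. LINT y|uniform_sphere. b l * (poly (?C l) (x \<bullet> y) * u y))"
      by (intro Bochner_Integration.integral_sum integrable_mult_right integrable_zonal_op u continuous_intros)
    finally show ?thesis by (simp add: zonal_op_def)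
  qed
  have "(LINT x|uniform_sphere. u x * zonal_op (poly p) u x) = (LINT x|uniform_sphere. (\<Sum>l\<le>N. b l * (u x * zonal_op (poly (?C l)) u x)))"
    unfolding Tp by (simp add: sum_distrib_left mult.left_commute)
  also have "\<dots> = (\<Sum>l\<le>N. LINT x|uniform_sphere. b l * (u x * zonal_op (poly (?C l)) u x))"
    by (intro Bochner_Integration.integral_sum integrable_mult_right integrable_bounded_on_sphere
        bounded_on_sphere_mult bounded_on_sphere_zonal_op u continuous_intros)
  also have "\<dots> = (\<Sum>l\<le>N. gegenbauer_coeff CARD('n) (poly p) l * (A l / ?h l))"
    using cf h[THEN less_imp_neq] by (intro sum.cong refl) (simp add: A_def)
  also have "\<dots> \<ge> (\<Sum>l\<le>N. - (lam + \<epsilon>) * (A l / ?h l) - (if l = 0 then (B + \<epsilon>) * m\<^sup>2 else 0))"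
  proof (rule sum_mono)
    fix l assume "l \<in> {..N}"
    have close: "\<bar>gegenbauer_coeff CARD('n) W l - gegenbauer_coeff CARD('n) (poly p) l\<bar> \<le> \<epsilon>"
      using p by (intro gegenbauer_coeff_approx n W1 pc) (auto simp: less_imp_le)
    have Al: "0 \<le> A l / ?h l" unfolding A_def using zonal_bessel(1)[OF n u, of l] h[of l] by simp
    show "- (lam + \<epsilon>) * (A l / ?h l) - (if l = 0 then (B + \<epsilon>) * m\<^sup>2 else 0) \<le> gegenbauer_coeff CARD('n) (poly p) l * (A l / ?h l)"
    proof (cases "l = 0")
      case True
      have "gegenbauer_coeff CARD('n) (\<lambda>_. 0) 0 = 0" by (simp add: gegenbauer_coeff_def)
      then have "\<bar>gegenbauer_coeff CARD('n) W 0\<bar> \<le> B"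
        using gegenbauer_coeff_approx[OF n W1 continuous_on_const, of 0 B 0] B by simp
      then have "- (B + \<epsilon>) \<le> gegenbauer_coeff CARD('n) (poly p) 0" using close True by (simp add: abs_le_iff)
      then have "- (B + \<epsilon>) * m\<^sup>2 \<le> gegenbauer_coeff CARD('n) (poly p) 0 * m\<^sup>2" by (intro mult_right_mono) auto
      moreover have "0 \<le> (lam + \<epsilon>) * m\<^sup>2" using lam \<epsilon> by simp
      moreover have "- (B + \<epsilon>) * m\<^sup>2 = - ((B + \<epsilon>) * m\<^sup>2)" "- (lam + \<epsilon>) * m\<^sup>2 = - ((lam + \<epsilon>) * m\<^sup>2)"
        by (simp_all only: mult_minus_left)
      ultimately have "- (lam + \<epsilon>) * m\<^sup>2 - (B + \<epsilon>) * m\<^sup>2 \<le> gegenbauer_coeff CARD('n) (poly p) 0 * m\<^sup>2"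
        by linarith
      then show ?thesis unfolding True h0 by simp
    next
      case False
      then have "- lam \<le> gegenbauer_coeff CARD('n) W l" using lam(2)[of l] by simp
      then have "- (lam + \<epsilon>) \<le> gegenbauer_coeff CARD('n) (poly p) l" using close by (simp add: abs_le_iff)
      then show ?thesis using False Al mult_right_mono by fastforce
    qed
  qed
  also have "(\<Sum>l\<le>N. - (lam + \<epsilon>) * (A l / ?h l) - (if l = 0 then (B + \<epsilon>) * m\<^sup>2 else 0)) = - (lam + \<epsilon>) * (\<Sum>l\<le>N. A l / ?h l) - (B + \<epsilon>) * m\<^sup>2"
    by (simp add: sum_subtractf sum_distrib_left)
  finally have 1: "- (lam + \<epsilon>) * (\<Sum>l\<le>N. A l / ?h l) - (B + \<epsilon>) * m\<^sup>2 \<le> (LINT x|uniform_sphere. u x * zonal_op (poly p) u x)" .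
  have "(\<Sum>l\<le>N. A l / ?h l) \<le> I" unfolding I_def A_def by (rule zonal_bessel(2)[OF n u])
  then have 2: "(lam + \<epsilon>) * (\<Sum>l\<le>N. A l / ?h l) \<le> (lam + \<epsilon>) * I" using lam \<epsilon> by (intro mult_left_mono) auto
  have iW: "integrable uniform_sphere (\<lambda>x. u x * zonal_op W u x)" "integrable uniform_sphere (\<lambda>x. u x * zonal_op (poly p) u x)"
    by (intro integrable_bounded_on_sphere bounded_on_sphere_mult bounded_on_sphere_zonal_op u W pc)+
  have "\<bar>LINT x|uniform_sphere. u x * zonal_op W u x - u x * zonal_op (poly p) u x\<bar>
     \<le> (LINT x|uniform_sphere. \<bar>u x * zonal_op W u x - u x * zonal_op (poly p) u x\<bar>)"
    by (rule integral_abs_bound)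
  also have "\<dots> \<le> (LINT x|(uniform_sphere :: (real^'n) measure). \<epsilon>)"
  proof (rule integral_mono)
    fix x assume "x \<in> space (uniform_sphere :: (real^'n) measure)"
    then have x: "norm x = 1" by (simp add: space_uniform_sphere)
    have "zonal_op W u x - zonal_op (poly p) u x = zonal_op (\<lambda>t. W t - poly p t) u x"
      unfolding zonal_op_def left_diff_distrib
      by (rule Bochner_Integration.integral_diff[symmetric, OF integrable_zonal_op[OF W u] integrable_zonal_op[OF pc(1) u]])
    moreover have "\<bar>zonal_op (\<lambda>t. W t - poly p t) u x\<bar> \<le> \<epsilon>"
      using p by (intro zonal_op_bound u u1 x continuous_intros W) (auto simp: less_imp_le)
    ultimately have "\<bar>u x\<bar> * \<bar>zonal_op W u x - zonal_op (poly p) u x\<bar> \<le> 1 * \<epsilon>"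
      using u1 by (intro mult_mono) auto
    then show "\<bar>u x * zonal_op W u x - u x * zonal_op (poly p) u x\<bar> \<le> \<epsilon>"
      by (simp add: abs_mult[symmetric] right_diff_distrib)
  qed (use iW in auto)
  also have "\<dots> = \<epsilon>" by (simp add: sphere.prob_space)
  finally have 3: "(LINT x|uniform_sphere. u x * zonal_op (poly p) u x) - \<epsilon> \<le> (LINT x|uniform_sphere. u x * zonal_op W u x)"
    using iW by (simp add: abs_le_iff)
  have "\<epsilon> * I \<le> \<epsilon>" "\<epsilon> * m\<^sup>2 \<le> \<epsilon>" using I1 m1 \<epsilon> by simp_all
  moreover have "- (lam + \<epsilon>) * (\<Sum>l\<le>N. A l / ?h l) \<ge> - lam * I - \<epsilon> * I" using 2 by (simp add: algebra_simps)
  moreover have "(B + \<epsilon>) * m\<^sup>2 = B * m\<^sup>2 + \<epsilon> * m\<^sup>2" by (simp add: algebra_simps)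
  ultimately have "- lam * I - B * m\<^sup>2 \<le> (LINT x|uniform_sphere. u x * zonal_op W u x) + 3 * \<epsilon>"
    using 1 3 by linarith
  then show "- lam * (LINT x|uniform_sphere. (u x)\<^sup>2) - B * (LINT x|uniform_sphere. u x)\<^sup>2
    \<le> (LINT x|uniform_sphere. u x * zonal_op W u x) + e"
    by (simp add: I_def m_def \<epsilon>_def)
qed

section \<open>The mean-field model on the sphere\<close>

lemma sphere_mean_field:
  assumes n: "CARD('n::finite) \<ge> 3" and W: "continuous_on UNIV W" and B: "\<And>t. \<bar>W t\<bar> \<le> B"
  shows "mean_field (uniform_sphere :: (real^'n) measure) (\<lambda>x y. W (x \<bullet> y)) B (jacobi_integral CARD('n) W)"
proof unfold_locales
  show "(\<lambda>(x, y). W (x \<bullet> y)) \<in> borel_measurable ((uniform_sphere :: (real^'n) measure) \<Otimes>\<^sub>M uniform_sphere)"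
    by (rule zonal_kernel_measurable[OF W])
next
  fix x :: "real^'n" assume "x \<in> space uniform_sphere"
  then show "(LINT y|uniform_sphere. W (x \<bullet> y)) = jacobi_integral CARD('n) W"
    by (intro zonal_integral n W) (simp add: space_uniform_sphere)
qed (use B in \<open>auto simp: inner_commute\<close>)

text \<open>The potentials of densities are bounded by \<open>B\<close> and share the modulus of continuity of \<open>W\<close>,
  so the Arzela-Ascoli theorem applies.\<close>

lemma sphere_compact_mean_field:
  assumes n: "CARD('n::finite) \<ge> 3" and W: "continuous_on UNIV W" and B: "\<And>t. \<bar>W t\<bar> \<le> B"
  shows "compact_mean_field (uniform_sphere :: (real^'n) measure) (\<lambda>x y. W (x \<bullet> y)) B (jacobi_integral CARD('n) W)"
proof -
  interpret M: mean_field "uniform_sphere :: (real^'n) measure" "\<lambda>x y. W (x \<bullet> y)" B "jacobi_integral CARD('n) W"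
    by (rule sphere_mean_field[OF n W B])
  show ?thesis
  proof unfold_locales
    fix \<rho> :: "nat \<Rightarrow> real^'n \<Rightarrow> real"
    assume \<rho>: "\<And>n. M.finite_entropy_density (\<rho> n)"
    note D = M.finite_entropy_densityD[OF \<rho>]
    have bd: "norm (M.potential (\<rho> n) x) \<le> B" if "x \<in> unit_sphere" for n x
      using M.potential_bound[OF D(2)[of n], of x] that D(6) by (simp add: space_uniform_sphere)
    have uc: "uniformly_continuous_on {-1..1} W"
      using W by (intro compact_uniformly_continuous) (auto intro: continuous_on_subset)
    have eq: "\<exists>d>0. \<forall>n y. y \<in> unit_sphere \<and> norm (x - y) < d \<longrightarrow> norm (M.potential (\<rho> n) x - M.potential (\<rho> n) y) < e"
      if x: "x \<in> unit_sphere" and e: "e > 0" for x e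
    proof -
      obtain d where d: "d > 0" "\<And>s t. s \<in> {-1..1} \<Longrightarrow> t \<in> {-1..1} \<Longrightarrow> dist t s < d \<Longrightarrow> dist (W t) (W s) < e / 2"
        using uc e unfolding uniformly_continuous_on_def by (metis half_gt_zero)
      have "norm (M.potential (\<rho> n) x - M.potential (\<rho> n) y) < e" if y: "y \<in> unit_sphere" "norm (x - y) < d" for n y
      proof -
        have ix: "integrable uniform_sphere (\<lambda>z. W (x \<bullet> z) * \<rho> n z)" "integrable uniform_sphere (\<lambda>z. W (y \<bullet> z) * \<rho> n z)"
          using M.integrable_kernel_mult[OF D(2)] x y by (auto simp: space_uniform_sphere)
        have "\<bar>M.potential (\<rho> n) x - M.potential (\<rho> n) y\<bar> = \<bar>LINT z|uniform_sphere. W (x \<bullet> z) * \<rho> n z - W (y \<bullet> z) * \<rho> n z\<bar>"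
          unfolding M.potential_def using ix by simp
        also have "\<dots> \<le> (LINT z|uniform_sphere. \<bar>W (x \<bullet> z) * \<rho> n z - W (y \<bullet> z) * \<rho> n z\<bar>)" by (rule integral_abs_bound)
        also have "\<dots> \<le> (LINT z|uniform_sphere. e / 2 * \<rho> n z)"
        proof (rule integral_mono)
          fix z assume "z \<in> space (uniform_sphere :: (real^'n) measure)"
          then have z: "norm z = 1" by (simp add: space_uniform_sphere)
          have "\<bar>x \<bullet> z - y \<bullet> z\<bar> \<le> norm (x - y) * norm z"
            unfolding inner_diff_left[symmetric] by (rule Cauchy_Schwarz_ineq2)
          then have "dist (x \<bullet> z) (y \<bullet> z) < d" using y z by (simp add: dist_real_def)
          then have "dist (W (x \<bullet> z)) (W (y \<bullet> z)) < e / 2"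
            using x y z by (intro d(2) inner_unit_range) auto
          then have "\<bar>W (x \<bullet> z) - W (y \<bullet> z)\<bar> * \<bar>\<rho> n z\<bar> \<le> e / 2 * \<rho> n z"
            using D(1)[of n z] e by (intro mult_mono) (auto simp: dist_real_def)
          then show "\<bar>W (x \<bullet> z) * \<rho> n z - W (y \<bullet> z) * \<rho> n z\<bar> \<le> e / 2 * \<rho> n z"
            unfolding left_diff_distrib[symmetric] abs_mult .
        qed (use ix D(2)[of n] in auto)
        also have "\<dots> = e / 2" using D(3) by simp
        finally show ?thesis using e by simp
      qed
      then show ?thesis using d(1) by blast
    qed
    obtain g r where r: "strict_mono (r :: nat \<Rightarrow> nat)"
      and lim: "\<And>e. 0 < e \<Longrightarrow> \<exists>N. \<forall>n x. n \<ge> N \<and> x \<in> unit_sphere \<longrightarrow> norm (M.potential (\<rho> (r n)) x - g x) < e"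
      using Arzela_Ascoli[of unit_sphere "\<lambda>n. M.potential (\<rho> n)" B, OF compact_sphere bd eq] by metis
    have "\<exists>N. \<forall>m\<ge>N. \<forall>n\<ge>N. \<forall>x\<in>space uniform_sphere. \<bar>M.potential (\<rho> (r m)) x - M.potential (\<rho> (r n)) x\<bar> \<le> e" if e: "e > 0" for e
    proof -
      obtain N where N: "\<forall>n x. n \<ge> N \<and> x \<in> unit_sphere \<longrightarrow> norm (M.potential (\<rho> (r n)) x - g x) < e / 2"
        using lim[of "e / 2"] e by auto
      have "\<bar>M.potential (\<rho> (r m)) x - M.potential (\<rho> (r n)) x\<bar> \<le> e" if "m \<ge> N" "n \<ge> N" "x \<in> unit_sphere" for m n x
      proof -
        have "\<bar>M.potential (\<rho> (r m)) x - g x\<bar> < e / 2" "\<bar>M.potential (\<rho> (r n)) x - g x\<bar> < e / 2"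
          using N that by auto
        then show ?thesis by linarith
      qed
      then show ?thesis by (intro exI[of _ N]) (simp add: space_uniform_sphere)
    qed
    with r show "\<exists>r :: nat \<Rightarrow> nat. strict_mono r \<and> (\<forall>e>0. \<exists>N. \<forall>m\<ge>N. \<forall>n\<ge>N. \<forall>x\<in>space uniform_sphere.
        \<bar>M.potential (\<rho> (r m)) x - M.potential (\<rho> (r n)) x\<bar> \<le> e)" by blast
  qed
qed

lemma uniform_sphere_eq_density:
  "uniform_sphere = density (surface_measure :: (real^'n) measure) (\<lambda>_. ennreal (1 / sphere_area TYPE('n)))"
  by (rule measure_eqI) (simp_all add: uniform_sphere_def emeasure_density_const)

text \<open>The kernel \<open>K\<close> is arbitrary off the sphere, while \<open>k\<close> is bounded everywhere; the two give
  the same free energy.\<close>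

locale spherical_gas = compact_mean_field "uniform_sphere :: (real^'n) measure" k B c0
  for k :: "real^'n \<Rightarrow> real^'n \<Rightarrow> real" and B c0 :: real +
  fixes K :: "real^'n \<Rightarrow> real^'n \<Rightarrow> real"
  assumes K_eq: "\<And>x y. x \<in> unit_sphere \<Longrightarrow> y \<in> unit_sphere \<Longrightarrow> K x y = k x y"
begin

abbreviation U :: "(real^'n) measure" where "U \<equiv> uniform_sphere"

definition with_density :: "(real^'n \<Rightarrow> real) \<Rightarrow> (real^'n) measure" where
  "with_density \<rho> = density U (\<lambda>x. ennreal (\<rho> x))"

lemma with_density_one: "with_density (\<lambda>_. 1) = U"
  by (simp add: with_density_def density_1)

lemma with_density_cong_one:
  assumes "finite_entropy_density \<rho>" "AE x in U. \<rho> x = 1"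
  shows "with_density \<rho> = U"
proof -
  have "with_density \<rho> = with_density (\<lambda>_. 1)"
    unfolding with_density_def using assms finite_entropy_densityD(5)[OF assms(1)]
    by (intro density_cong) (auto elim!: eventually_mono)
  then show ?thesis by (simp add: with_density_one)
qed

lemma has_pos_density_with_density:
  assumes "finite_entropy_density \<rho>" "AE x in U. 0 < \<rho> x"
  shows "has_pos_density U (with_density \<rho>) \<rho>"
  using assms finite_entropy_densityD[OF assms(1)]
  by (auto simp: has_pos_density_def has_density_def with_density_def)

lemma sphere_prob_with_density:
  assumes \<rho>: "finite_entropy_density \<rho>"
  shows "sphere_prob (with_density \<rho>)"
proof -
  note D = finite_entropy_densityD[OF \<rho>]
  have "emeasure (with_density \<rho>) (space (with_density \<rho>)) = (\<integral>\<^sup>+x. ennreal (\<rho> x) \<partial>U)"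
    using D unfolding with_density_def by (simp add: emeasure_density cong: nn_integral_cong)
  also have "\<dots> = 1" using D by (simp add: nn_integral_eq_integral)
  finally have "prob_space (with_density \<rho>)" by (rule prob_spaceI)
  then show ?thesis by (simp add: sphere_prob_def with_density_def sets_uniform_sphere)
qed

lemma rel_entropy_integrals:
  assumes \<rho>: "finite_entropy_density \<rho>"
  shows "integrable U (\<lambda>x. \<rho> x * ln (\<rho> x))" "(LINT x|U. \<rho> x * ln (\<rho> x)) = entropy_of \<rho>"
proof -
  note D = finite_entropy_densityD[OF \<rho>]
  have eq: "(\<lambda>x. \<rho> x * ln (\<rho> x)) = (\<lambda>x. rel_entropy_fun (\<rho> x) + \<rho> x - 1)"
    by (simp add: rel_entropy_fun_def)
  show "integrable U (\<lambda>x. \<rho> x * ln (\<rho> x))" unfolding eq using D by simp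
  show "(LINT x|U. \<rho> x * ln (\<rho> x)) = entropy_of \<rho>"
    unfolding eq entropy_of_def using D by (simp add: prob_space)
qed

lemma density_unique_AE:
  assumes r: "has_density U (with_density \<rho>) r" and \<rho>: "finite_entropy_density \<rho>"
  shows "AE x in U. r x = \<rho> x"
proof -
  have [measurable]: "r \<in> borel_measurable U" "\<rho> \<in> borel_measurable U"
    using r finite_entropy_densityD[OF \<rho>] by (auto simp: has_density_def)
  have "density U (\<lambda>x. ennreal (r x)) = density U (\<lambda>x. ennreal (\<rho> x))"
    using r by (simp add: has_density_def with_density_def)
  then have "AE x in U. ennreal (r x) = ennreal (\<rho> x)"
    by (intro density_unique) auto
  moreover have "AE x in U. 0 \<le> r x" using r by (simp add: has_density_def)
  ultimately show ?thesis
    by eventually_elim (use finite_entropy_densityD(1)[OF \<rho>] in \<open>simp add: ennreal_inj\<close>)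
qed

text \<open>The density chosen in the definition of the entropy agrees with \<open>\<rho>\<close> almost everywhere, so
  the choice does not matter.\<close>

lemma entropy_sphere_with_density:
  assumes \<rho>: "finite_entropy_density \<rho>" and pos: "AE x in U. 0 < \<rho> x"
  shows "entropy_sphere (with_density \<rho>) = ereal (entropy_of \<rho>)"
proof -
  define r where "r = (SOME r. has_pos_density U (with_density \<rho>) r)"
  have ex: "\<exists>r. has_pos_density U (with_density \<rho>) r"
    using has_pos_density_with_density[OF \<rho> pos] by blast
  then have r: "has_pos_density U (with_density \<rho>) r" unfolding r_def by (rule someI_ex)
  then have rd: "has_density U (with_density \<rho>) r" by (simp add: has_pos_density_def)
  have [measurable]: "r \<in> borel_measurable U" "\<rho> \<in> borel_measurable U"
    using rd finite_entropy_densityD[OF \<rho>] by (auto simp: has_density_def)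
  have ae: "AE x in U. r x * ln (r x) = \<rho> x * ln (\<rho> x)"
    using density_unique_AE[OF rd \<rho>] by eventually_elim simp
  have "integrable U (\<lambda>x. r x * ln (r x))"
    by (rule integrable_cong_AE_imp[OF rel_entropy_integrals(1)[OF \<rho>]]) (use ae in \<open>auto elim!: eventually_mono\<close>)
  moreover have "(LINT x|U. r x * ln (r x)) = (LINT x|U. \<rho> x * ln (\<rho> x))"
    by (rule integral_cong_AE) (use ae in auto)
  ultimately show ?thesis
    unfolding entropy_sphere_def using ex by (simp add: Let_def r_def[symmetric] rel_entropy_integrals[OF \<rho>])
qed

lemma interaction_energy_with_density:
  assumes \<rho>: "finite_entropy_density \<rho>"
  shows "interaction_energy K (with_density \<rho>) = pairing \<rho> \<rho> / 2"
proof -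
  note D = finite_entropy_densityD[OF \<rho>]
  have sp: "space (with_density \<rho>) = unit_sphere" by (simp add: with_density_def space_uniform_sphere)
  have inner: "(LINT y|with_density \<rho>. K x y) = potential \<rho> x" if x: "x \<in> unit_sphere" for x
  proof -
    have xU: "x \<in> space U" using x by (simp add: space_uniform_sphere)
    have "(LINT y|with_density \<rho>. K x y) = (LINT y|with_density \<rho>. k x y)"
      using x by (intro Bochner_Integration.integral_cong refl K_eq) (auto simp: sp)
    also have "\<dots> = (LINT y|U. \<rho> y *\<^sub>R k x y)"
      unfolding with_density_def using D xU by (intro integral_density kernel_section_measurable) auto
    finally show ?thesis by (simp add: potential_def mult.commute)
  qed
  have "(LINT x|with_density \<rho>. LINT y|with_density \<rho>. K x y) = (LINT x|with_density \<rho>. potential \<rho> x)"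
    by (intro Bochner_Integration.integral_cong refl inner) (simp add: sp)
  also have "\<dots> = (LINT x|U. \<rho> x *\<^sub>R potential \<rho> x)"
    unfolding with_density_def using D by (intro integral_density potential_measurable) auto
  finally show ?thesis by (simp add: interaction_energy_def pairing_def)
qed

lemma free_energy_with_density:
  assumes "finite_entropy_density \<rho>" "AE x in U. 0 < \<rho> x"
  shows "free_energy K \<gamma> (with_density \<rho>) = ereal (energy \<gamma> \<rho>)"
  using assms by (simp add: free_energy_def entropy_sphere_with_density interaction_energy_with_density energy_def)

lemma free_energy_uniform: "free_energy K \<gamma> U = ereal (c0 / 2)"
  using free_energy_with_density[OF finite_entropy_density_one, of \<gamma>] by (simp add: with_density_one energy_one)

text \<open>Finite free energy forces a positive density whose entropy integral exists; its positive
  part is a representative that is nonnegative everywhere.\<close>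

lemma free_energy_finite_imp_density:
  assumes \<mu>: "sphere_prob \<mu>" and fin: "free_energy K \<gamma> \<mu> \<noteq> \<infinity>" and \<gamma>: "\<gamma> > 0"
  shows "\<exists>\<rho>. finite_entropy_density \<rho> \<and> (AE x in U. 0 < \<rho> x) \<and> \<mu> = with_density \<rho>"
proof -
  have "entropy_sphere \<mu> \<noteq> \<infinity>"
    using fin \<gamma> by (auto simp: free_energy_def)
  define r where "r = (SOME r. has_pos_density U \<mu> r)"
  have ex: "\<exists>r. has_pos_density U \<mu> r" and ri: "integrable U (\<lambda>x. r x * ln (r x))"
    using \<open>entropy_sphere \<mu> \<noteq> \<infinity>\<close> unfolding entropy_sphere_def Let_def r_def by (auto split: if_splits)
  from ex have r: "has_pos_density U \<mu> r" unfolding r_def by (rule someI_ex)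
  then have [measurable]: "r \<in> borel_measurable U" and rp: "AE x in U. 0 < r x"
    and \<mu>r: "\<mu> = density U (\<lambda>x. ennreal (r x))"
    by (auto simp: has_pos_density_def has_density_def)
  define \<rho> where "\<rho> x = max 0 (r x)" for x
  have [measurable]: "\<rho> \<in> borel_measurable U" unfolding \<rho>_def[abs_def] by measurable
  have ae: "AE x in U. r x = \<rho> x" using rp by eventually_elim (simp add: \<rho>_def)
  have \<mu>\<rho>: "\<mu> = with_density \<rho>"
    unfolding \<mu>r with_density_def by (rule density_cong) (use ae in \<open>auto elim!: eventually_mono\<close>)
  have "(\<integral>\<^sup>+x. ennreal (\<rho> x) \<partial>U) = emeasure \<mu> (space \<mu>)"
    unfolding \<mu>\<rho> with_density_def by (simp add: emeasure_density cong: nn_integral_cong)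
  also have "\<dots> = 1" using \<mu> prob_space.emeasure_space_1 by (auto simp: sphere_prob_def)
  finally have one: "(\<integral>\<^sup>+x. ennreal (\<rho> x) \<partial>U) = 1" .
  have \<rho>0: "0 \<le> \<rho> x" for x by (simp add: \<rho>_def)
  have \<rho>i: "integrable U \<rho>" using one \<rho>0 by (intro integrableI_nonneg) auto
  have "ennreal (LINT x|U. \<rho> x) = 1"
    using one nn_integral_eq_integral[OF \<rho>i] \<rho>0 by simp
  then have \<rho>1: "(LINT x|U. \<rho> x) = 1" by (simp add: ennreal_eq_1)
  have "integrable U (\<lambda>x. \<rho> x * ln (\<rho> x))"
    by (rule integrable_cong_AE_imp[OF ri]) (use ae in \<open>auto elim!: eventually_mono\<close>)
  then have "integrable U (\<lambda>x. rel_entropy_fun (\<rho> x))"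
    unfolding rel_entropy_fun_def using \<rho>i by simp
  then have "finite_entropy_density \<rho>" using \<rho>0 \<rho>i \<rho>1 by (simp add: finite_entropy_density_def)
  moreover have "AE x in U. 0 < \<rho> x" using rp by eventually_elim (simp add: \<rho>_def)
  ultimately show ?thesis using \<mu>\<rho> by blast
qed

lemma positive_energy_minimizer:
  assumes \<gamma>: "\<gamma> > 0"
  shows "\<exists>\<rho>. finite_entropy_density \<rho> \<and> (AE x in U. 0 < \<rho> x) \<and> (\<forall>\<sigma>. finite_entropy_density \<sigma> \<longrightarrow> energy \<gamma> \<rho> \<le> energy \<gamma> \<sigma>)"
  using exists_energy_minimizer[OF \<gamma>] energy_minimizer_positive[OF \<gamma>] by blast

lemma is_minimizerI:
  assumes \<gamma>: "\<gamma> > 0" and \<rho>: "finite_entropy_density \<rho>" "AE x in U. 0 < \<rho> x"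
    and min: "\<And>\<sigma>. finite_entropy_density \<sigma> \<Longrightarrow> energy \<gamma> \<rho> \<le> energy \<gamma> \<sigma>"
  shows "is_minimizer K \<gamma> (with_density \<rho>)"
  unfolding is_minimizer_def is_arg_min_def
proof (intro conjI notI)
  show "sphere_prob (with_density \<rho>)" by (rule sphere_prob_with_density[OF \<rho>(1)])
  assume "\<exists>\<nu>. sphere_prob \<nu> \<and> free_energy K \<gamma> \<nu> < free_energy K \<gamma> (with_density \<rho>)"
  then obtain \<nu> where \<nu>: "sphere_prob \<nu>" "free_energy K \<gamma> \<nu> < free_energy K \<gamma> (with_density \<rho>)" by blast
  then have "free_energy K \<gamma> \<nu> \<noteq> \<infinity>" by auto
  from free_energy_finite_imp_density[OF \<nu>(1) this \<gamma>]
  obtain \<sigma> where \<sigma>: "finite_entropy_density \<sigma>" "AE x in U. 0 < \<sigma> x" "\<nu> = with_density \<sigma>" by blast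
  then have "energy \<gamma> \<sigma> < energy \<gamma> \<rho>" using \<nu>(2) \<rho> by (simp add: free_energy_with_density)
  then show False using min[OF \<sigma>(1)] by linarith
qed

text \<open>A minimizer among measures competes only with positive densities. It is minimal among all
  densities of finite entropy as well, because the energy minimizer of that larger class is itself
  positive.\<close>

lemma is_minimizerD:
  assumes \<gamma>: "\<gamma> > 0" and \<mu>: "is_minimizer K \<gamma> \<mu>"
  shows "\<exists>\<rho>. finite_entropy_density \<rho> \<and> \<mu> = with_density \<rho> \<and> (\<forall>\<sigma>. finite_entropy_density \<sigma> \<longrightarrow> energy \<gamma> \<rho> \<le> energy \<gamma> \<sigma>)"
proof -
  have prob: "sphere_prob \<mu>" and le: "\<And>\<nu>. sphere_prob \<nu> \<Longrightarrow> free_energy K \<gamma> \<mu> \<le> free_energy K \<gamma> \<nu>"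
    using \<mu> by (auto simp: is_minimizer_def is_arg_min_def not_less)
  have "free_energy K \<gamma> \<mu> \<le> ereal (c0 / 2)"
    using le[OF sphere_prob_with_density[OF finite_entropy_density_one]]
    by (simp add: with_density_one free_energy_uniform)
  then have "free_energy K \<gamma> \<mu> \<noteq> \<infinity>" by auto
  from free_energy_finite_imp_density[OF prob this \<gamma>]
  obtain \<rho> where \<rho>: "finite_entropy_density \<rho>" "AE x in U. 0 < \<rho> x" "\<mu> = with_density \<rho>" by blast
  obtain \<sigma> where \<sigma>: "finite_entropy_density \<sigma>" "AE x in U. 0 < \<sigma> x"
    and min: "\<forall>\<tau>. finite_entropy_density \<tau> \<longrightarrow> energy \<gamma> \<sigma> \<le> energy \<gamma> \<tau>"
    using positive_energy_minimizer[OF \<gamma>] by blast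
  have "energy \<gamma> \<rho> \<le> energy \<gamma> \<sigma>"
    using le[OF sphere_prob_with_density[OF \<sigma>(1)]] \<rho> \<sigma> by (simp add: free_energy_with_density)
  then show ?thesis using \<rho> min by (intro exI[of _ \<rho>]) (auto intro: order_trans)
qed

lemma uniform_is_minimizer_iff:
  assumes \<gamma>: "\<gamma> > 0"
  shows "is_minimizer K \<gamma> U \<longleftrightarrow> uniform_minimal \<gamma>"
proof
  assume "uniform_minimal \<gamma>"
  then have "is_minimizer K \<gamma> (with_density (\<lambda>_. 1))"
    using \<gamma> by (intro is_minimizerI finite_entropy_density_one) (auto simp: uniform_minimal_def energy_one)
  then show "is_minimizer K \<gamma> U" by (simp add: with_density_one)
next
  assume "is_minimizer K \<gamma> U"
  then obtain \<rho> where \<rho>: "finite_entropy_density \<rho>" "U = with_density \<rho>"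
    and min: "\<forall>\<sigma>. finite_entropy_density \<sigma> \<longrightarrow> energy \<gamma> \<rho> \<le> energy \<gamma> \<sigma>"
    using is_minimizerD[OF \<gamma>] by blast
  have "has_density U (with_density \<rho>) (\<lambda>_. 1)"
    using \<rho>(2) by (simp add: has_density_def density_1)
  then have ae: "AE x in U. 1 = \<rho> x" using density_unique_AE \<rho>(1) by blast
  have "energy \<gamma> \<rho> = c0 / 2"
  proof -
    have [measurable]: "\<rho> \<in> borel_measurable U" using finite_entropy_densityD[OF \<rho>(1)] by blast
    have "AE x in U. \<bar>\<rho> x - 1\<bar> = 0" using ae by eventually_elim simp
    then have "(LINT x|U. \<bar>\<rho> x - 1\<bar>) = 0" by (simp add: integral_eq_zero_AE)
    then have "pairing \<rho> \<rho> = pairing (\<lambda>_. 1) (\<lambda>_. 1)"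
      using pairing_self_diff[OF finite_entropy_densityD(2)[OF \<rho>(1)], of "\<lambda>_. 1"] by simp
    moreover have "entropy_of \<rho> = 0"
      unfolding entropy_of_def by (rule integral_eq_zero_AE) (use ae in eventually_elim, simp)
    ultimately show ?thesis using pairing_one_right[of "\<lambda>_. 1"] by (simp add: energy_def prob_space)
  qed
  then show "uniform_minimal \<gamma>" using min unfolding uniform_minimal_def by metis
qed

text \<open>For a minimizer at \<open>\<gamma> < \<gamma>c\<close> the inequality \<open>uniform_minimal_below\<close> forces zero entropy, and
  then \<open>weak_pinsker\<close> forces the density \<open>1\<close>.\<close>

lemma unique_minimizer_below:
  assumes "uniform_minimal \<gamma>c" "0 < \<gamma>" "\<gamma> < \<gamma>c"
  shows "is_minimizer K \<gamma> \<mu> \<longleftrightarrow> \<mu> = U"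
proof
  assume "\<mu> = U"
  then show "is_minimizer K \<gamma> \<mu>"
    using uniform_is_minimizer_iff[OF assms(2)] uniform_minimal_antimono[OF assms(1,2)] assms(3) by simp
next
  assume "is_minimizer K \<gamma> \<mu>"
  then obtain \<rho> where \<rho>: "finite_entropy_density \<rho>" "\<mu> = with_density \<rho>"
    and min: "\<forall>\<sigma>. finite_entropy_density \<sigma> \<longrightarrow> energy \<gamma> \<rho> \<le> energy \<gamma> \<sigma>"
    using is_minimizerD[OF assms(2)] by blast
  have "energy \<gamma> \<rho> \<le> c0 / 2" using min finite_entropy_density_one by (metis energy_one)
  then have "entropy_of \<rho> * (1 / \<gamma> - 1 / \<gamma>c) \<le> 0"
    using uniform_minimal_below[OF assms \<rho>(1)] by linarith
  moreover have "1 / \<gamma> - 1 / \<gamma>c > 0" using assms(2,3) by (simp add: field_simps)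
  ultimately have "entropy_of \<rho> \<le> 0" by (simp add: mult_le_0_iff)
  then have "(LINT x|U. \<bar>\<rho> x - 1\<bar>)\<^sup>2 \<le> 0" using weak_pinsker[OF \<rho>(1)] by linarith
  then have "(LINT x|U. \<bar>\<rho> x - 1\<bar>) = 0" by simp
  moreover have "integrable U (\<lambda>x. \<bar>\<rho> x - 1\<bar>)" using finite_entropy_densityD[OF \<rho>(1)] by simp
  ultimately have "AE x in U. \<bar>\<rho> x - 1\<bar> = 0"
    by (subst (asm) integral_nonneg_eq_0_iff_AE) auto
  then have "AE x in U. \<rho> x = 1" by eventually_elim simp
  then show "\<mu> = U" using with_density_cong_one[OF \<rho>(1)] \<rho>(2) by simp
qed

lemma transition_pointI:
  assumes "0 < \<gamma>c" "uniform_minimal \<gamma>c" "\<And>\<gamma>. \<gamma> > \<gamma>c \<Longrightarrow> \<not> uniform_minimal \<gamma>"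
  shows "transition_point K \<gamma>c"
  unfolding transition_point_def
proof (intro conjI allI impI)
  show "0 < \<gamma>c" by fact
  show "is_minimizer K \<gamma>c U" using assms uniform_is_minimizer_iff by simp
next
  fix \<gamma> \<mu> assume "0 < \<gamma> \<and> \<gamma> < \<gamma>c"
  then show "is_minimizer K \<gamma> \<mu> \<longleftrightarrow> \<mu> = U" using unique_minimizer_below[OF assms(2)] by blast
next
  fix \<gamma> assume g: "\<gamma>c < \<gamma>"
  then have \<gamma>: "\<gamma> > 0" using assms(1) by linarith
  obtain \<rho> where \<rho>: "finite_entropy_density \<rho>" "AE x in U. 0 < \<rho> x"
    and min: "\<forall>\<sigma>. finite_entropy_density \<sigma> \<longrightarrow> energy \<gamma> \<rho> \<le> energy \<gamma> \<sigma>"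
    using positive_energy_minimizer[OF \<gamma>] by blast
  have m: "is_minimizer K \<gamma> (with_density \<rho>)" using min by (intro is_minimizerI[OF \<gamma> \<rho>]) blast
  moreover have "with_density \<rho> \<noteq> U" using m uniform_is_minimizer_iff[OF \<gamma>] assms(3)[OF g] by auto
  ultimately show "\<exists>\<mu>. is_minimizer K \<gamma> \<mu> \<and> (\<exists>\<rho>. has_pos_density U \<mu> \<rho>) \<and> \<mu> \<noteq> U"
    using has_pos_density_with_density[OF \<rho>] by blast
qed

lemma has_density_surface:
  assumes \<rho>: "finite_entropy_density \<rho>"
  shows "has_density surface_measure (with_density \<rho>) (\<lambda>x. \<rho> x / sphere_area TYPE('n))"
    and "(LINT x|surface_measure. \<bar>\<rho> x / sphere_area TYPE('n) - 1 / sphere_area TYPE('n)\<bar>) = (LINT x|U. \<bar>\<rho> x - 1\<bar>)"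
proof -
  note D = finite_entropy_densityD[OF \<rho>]
  have s: "sets U = sets surface_measure" by (simp add: uniform_sphere_def)
  have [measurable]: "\<rho> \<in> borel_measurable surface_measure"
    using D(5) by (subst measurable_cong_sets[OF s[symmetric] refl])
  have a: "sphere_area TYPE('n) > 0" by (rule sphere_area_pos)
  have "with_density \<rho> = density surface_measure (\<lambda>x. ennreal (1 / sphere_area TYPE('n)) * ennreal (\<rho> x))"
    unfolding with_density_def uniform_sphere_eq_density by (rule density_density_eq) auto
  also have "\<dots> = density surface_measure (\<lambda>x. ennreal (\<rho> x / sphere_area TYPE('n)))"
    using D(1) a by (simp add: ennreal_mult[symmetric])
  finally show "has_density surface_measure (with_density \<rho>) (\<lambda>x. \<rho> x / sphere_area TYPE('n))"
    using D(1) a by (auto simp: has_density_def)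
  have "(LINT x|U. \<bar>\<rho> x - 1\<bar>) = (LINT x|surface_measure. (1 / sphere_area TYPE('n)) *\<^sub>R \<bar>\<rho> x - 1\<bar>)"
    unfolding uniform_sphere_eq_density using a by (intro integral_density) auto
  also have "\<dots> = (LINT x|surface_measure. \<bar>\<rho> x / sphere_area TYPE('n) - 1 / sphere_area TYPE('n)\<bar>)"
    using a by (intro Bochner_Integration.integral_cong refl) (simp add: diff_divide_distrib[symmetric] abs_divide)
  finally show "(LINT x|surface_measure. \<bar>\<rho> x / sphere_area TYPE('n) - 1 / sphere_area TYPE('n)\<bar>) = (LINT x|U. \<bar>\<rho> x - 1\<bar>)" by simp
qed

text \<open>Choosing a minimizer for each \<open>\<gamma> > \<gamma>c\<close> gives a family whose \<open>L\<^sub>1\<close> distance to the uniform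
  density is at least \<open>\<eta>\<close> near \<open>\<gamma>c\<close>, so the limit in the definition of a continuous transition
  point fails.\<close>

lemma not_continuous_transition_pointI:
  assumes \<gamma>c: "0 < \<gamma>c" "\<gamma>c < \<gamma>1" and \<eta>: "0 < \<eta>" and above: "\<And>\<gamma>. \<gamma> > \<gamma>c \<Longrightarrow> \<not> uniform_minimal \<gamma>"
    and far: "\<And>\<gamma> \<rho>. \<gamma>c < \<gamma> \<Longrightarrow> \<gamma> \<le> \<gamma>1 \<Longrightarrow> finite_entropy_density \<rho> \<Longrightarrow> energy \<gamma> \<rho> < c0 / 2 \<Longrightarrow>
      \<eta> \<le> (LINT x|U. \<bar>\<rho> x - 1\<bar>)"
  shows "\<not> continuous_transition_point K \<gamma>c"
proof
  assume cont: "continuous_transition_point K \<gamma>c"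
  have "\<exists>\<rho>. finite_entropy_density \<rho> \<and> is_minimizer K \<gamma> (with_density \<rho>) \<and> energy \<gamma> \<rho> < c0 / 2" if g: "\<gamma> > \<gamma>c" for \<gamma>
  proof -
    have \<gamma>: "\<gamma> > 0" using g \<gamma>c by linarith
    obtain \<rho> where \<rho>: "finite_entropy_density \<rho>" "AE x in U. 0 < \<rho> x"
      and min: "\<forall>\<sigma>. finite_entropy_density \<sigma> \<longrightarrow> energy \<gamma> \<rho> \<le> energy \<gamma> \<sigma>"
      using positive_energy_minimizer[OF \<gamma>] by blast
    have "is_minimizer K \<gamma> (with_density \<rho>)" using min by (intro is_minimizerI[OF \<gamma> \<rho>]) blast
    moreover obtain \<sigma> where "finite_entropy_density \<sigma>" "energy \<gamma> \<sigma> < c0 / 2"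
      using above[OF g] by (auto simp: uniform_minimal_def not_le)
    ultimately show ?thesis using \<rho> min by (intro exI[of _ \<rho>]) (auto intro: le_less_trans)
  qed
  then obtain \<rho> where \<rho>: "\<And>\<gamma>. \<gamma> > \<gamma>c \<Longrightarrow> finite_entropy_density (\<rho> \<gamma>)"
    "\<And>\<gamma>. \<gamma> > \<gamma>c \<Longrightarrow> is_minimizer K \<gamma> (with_density (\<rho> \<gamma>))" "\<And>\<gamma>. \<gamma> > \<gamma>c \<Longrightarrow> energy \<gamma> (\<rho> \<gamma>) < c0 / 2"
    by metis
  define r where "r \<gamma> x = \<rho> \<gamma> x / sphere_area TYPE('n)" for \<gamma> x
  have "\<forall>\<gamma>>\<gamma>c. \<exists>\<mu>. is_minimizer K \<gamma> \<mu> \<and> has_density surface_measure \<mu> (r \<gamma>)"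
    using \<rho>(2) has_density_surface(1)[OF \<rho>(1)] unfolding r_def by blast
  moreover have "(\<forall>\<gamma>>\<gamma>c. \<exists>\<mu>. is_minimizer K \<gamma> \<mu> \<and> has_density surface_measure \<mu> (r \<gamma>)) \<longrightarrow>
      ((\<lambda>\<gamma>. LINT x|surface_measure. \<bar>r \<gamma> x - 1 / sphere_area TYPE('n)\<bar>) \<longlongrightarrow> 0) (at_right \<gamma>c)"
    using cont unfolding continuous_transition_point_def by blast
  ultimately have "((\<lambda>\<gamma>. LINT x|surface_measure. \<bar>r \<gamma> x - 1 / sphere_area TYPE('n)\<bar>) \<longlongrightarrow> 0) (at_right \<gamma>c)" by blast
  then have "\<forall>\<^sub>F \<gamma> in at_right \<gamma>c. (LINT x|surface_measure. \<bar>r \<gamma> x - 1 / sphere_area TYPE('n)\<bar>) < \<eta>"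
    using \<eta> by (rule order_tendstoD(2))
  moreover have "\<forall>\<^sub>F \<gamma> in at_right \<gamma>c. \<gamma>c < \<gamma> \<and> \<gamma> < \<gamma>1"
    using \<gamma>c(2) eventually_at_right by blast
  ultimately have "\<forall>\<^sub>F \<gamma> in at_right \<gamma>c. False"
  proof eventually_elim
    case (elim \<gamma>)
    then show ?case
      using has_density_surface(2)[OF \<rho>(1), of \<gamma>] far[of \<gamma> "\<rho> \<gamma>"] \<rho>(1,3)[of \<gamma>] by (simp add: r_def)
  qed
  then show False by (simp add: trivial_limit_at_right_real)
qed

end

section \<open>Discontinuity of the transition\<close>

theorem theorem1p5:
  fixes K :: "real^'n \<Rightarrow> real^'n \<Rightarrow> real"
    and W :: "real \<Rightarrow> real"
    and k :: nat
    and p :: 'n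
    and L :: "nat set"
    and \<alpha> :: "nat \<Rightarrow> real"
  assumes dim: "CARD('n) \<ge> 3"
    and cont: "continuous_on (unit_sphere \<times> unit_sphere) (\<lambda>(x, y). K x y)"
    and rot: "\<And>x y. x \<in> unit_sphere \<Longrightarrow> y \<in> unit_sphere \<Longrightarrow> K x y = W (x \<bullet> y)"
    and neg: "\<exists>j\<ge>1. gegenbauer_coeff CARD('n) W j < 0"
    and kmin: "is_arg_min (gegenbauer_coeff CARD('n) W) (\<lambda>l. l \<ge> 1) k"
    and L: "finite L"
      "L \<subseteq> {l. l \<ge> 1 \<and> gegenbauer_coeff CARD('n) W l = gegenbauer_coeff CARD('n) W k}"
    and v3: "(LINT x|surface_measure. (\<Sum>l\<in>L. \<alpha> l * zonal_harmonic p l x) ^ 3) \<noteq> 0"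
  shows "\<exists>\<gamma>c. discontinuous_transition_point K \<gamma>c \<and>
           0 < \<gamma>c \<and> \<gamma>c < - 1 / gegenbauer_coeff CARD('n) W k"
proof -
  let ?N = "CARD('n)"
  obtain i j :: 'n where ij: "i \<noteq> j" using two_indices[OF dim] by blast
  have "continuous_on {-1..1} (\<lambda>t. (\<lambda>(x, y). K x y) (axis i 1, tilted_unit i j t))"
  proof (rule continuous_on_compose2[OF cont])
    show "continuous_on {-1..1} (\<lambda>t. (axis i 1 :: real^'n, tilted_unit i j t))"
      unfolding tilted_unit_def by (intro continuous_intros)
    show "(\<lambda>t. (axis i 1 :: real^'n, tilted_unit i j t)) ` {-1..1} \<subseteq> unit_sphere \<times> unit_sphere"
      using tilted_unit(1)[OF ij] by auto
  qed
  then have Wc: "continuous_on {-1..1} W"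
  proof (rule continuous_on_cong[THEN iffD1, OF refl, rotated])
    fix t :: real assume t: "t \<in> {-1..1}"
    have "K (axis i 1) (tilted_unit i j t) = W (axis i 1 \<bullet> tilted_unit i j t)"
      using tilted_unit(1)[OF ij t] by (intro rot) auto
    then show "(\<lambda>(x, y). K x y) (axis i 1, tilted_unit i j t) = W t"
      by (simp add: tilted_unit(2)[OF ij t])
  qed
  \<comment> \<open>The kernel determines \<open>W\<close> only on \<open>[-1, 1]\<close>; clamping makes it continuous and bounded on the line.\<close>
  define V where "V t = W (max (-1) (min 1 t))" for t
  have Vc: "continuous_on UNIV V"
    unfolding V_def by (rule continuous_on_compose2[OF Wc]) (auto intro!: continuous_intros)
  have VW: "V t = W t" if "t \<in> {-1..1}" for t using that by (auto simp: V_def max_def min_def)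
  have coeff: "gegenbauer_coeff ?N V l = gegenbauer_coeff ?N W l" for l
    unfolding gegenbauer_coeff_def
    by (intro arg_cong2[where f = "(*)"] refl set_lebesgue_integral_cong) (auto simp: VW)
  have "bounded (W ` {-1..1})" using Wc by (intro compact_imp_bounded compact_continuous_image) auto
  then obtain B where B: "\<forall>y\<in>W ` {-1..1}. norm y \<le> B" unfolding bounded_iff by blast
  have VB: "\<bar>V t\<bar> \<le> B" for t
  proof -
    have "max (-1) (min 1 t) \<in> {-1..1}" by auto
    then show ?thesis using B unfolding V_def by (metis imageI real_norm_def)
  qed
  define c0 where "c0 = jacobi_integral ?N V"
  interpret compact_mean_field "uniform_sphere :: (real^'n) measure" "\<lambda>x y. V (x \<bullet> y)" B c0
    unfolding c0_def by (rule sphere_compact_mean_field[OF dim Vc VB])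
  interpret spherical_gas "\<lambda>x y. V (x \<bullet> y)" B c0 K
  proof unfold_locales
    fix x y :: "real^'n" assume xy: "x \<in> unit_sphere" "y \<in> unit_sphere"
    then have "x \<bullet> y \<in> {-1..1}" by (intro inner_unit_range) auto
    then show "K x y = V (x \<bullet> y)" using rot[OF xy] VW by simp
  qed
  have pot: "potential u = zonal_op V u" for u by (auto simp: potential_def zonal_op_def fun_eq_iff)
  define lam where "lam = - gegenbauer_coeff ?N W k"
  have low: "- lam \<le> gegenbauer_coeff ?N V l" if "l \<ge> 1" for l
    using kmin that by (auto simp: is_arg_min_def lam_def coeff not_less)
  have lam: "lam > 0" using neg low by (force simp: coeff)
  define e :: "real^'n" where "e = axis p 1"
  have e: "norm e = 1" by (simp add: e_def)
  have ex: "e \<bullet> x = x $ p" for x by (simp add: e_def inner_axis' )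
  \<comment> \<open>The normalization of the zonal harmonics is absorbed into the coefficients.\<close>
  define \<beta> where "\<beta> l = \<alpha> l * zonal_const p l" for l
  define v where "v x = (\<Sum>l\<in>L. \<beta> l * poly (geg ?N l) (e \<bullet> x))" for x
  have veq: "(\<Sum>l\<in>L. \<alpha> l * zonal_harmonic p l x) = v x" for x
    by (simp add: v_def \<beta>_def zonal_harmonic_def ex poly_gegenbauer mult.assoc)
  have vc: "continuous_on UNIV v" unfolding v_def by (intro continuous_intros)
  have vb: "bounded_on_sphere v" by (rule bounded_on_sphere_continuous[OF vc])
  obtain Vb where Vb: "\<forall>x\<in>unit_sphere. \<bar>v x\<bar> \<le> Vb" using continuous_bounded_on_sphere[OF vc] by blast
  have v_mean: "(LINT x|U. v x) = 0"
  proof -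
    have "(LINT x|U. poly (geg ?N l) (e \<bullet> x)) = 0" if "l \<in> L" for l
      using geg_orthogonal[OF dim e e, of l 0] that L(2) by auto
    moreover have "(LINT x|U. v x) = (\<Sum>l\<in>L. LINT x|U. \<beta> l * poly (geg ?N l) (e \<bullet> x))"
      unfolding v_def by (intro Bochner_Integration.integral_sum integrable_sphere continuous_intros)
    ultimately show ?thesis by simp
  qed
  have Tv: "zonal_op V v x = - lam * v x" if x: "x \<in> unit_sphere" for x
  proof -
    have "zonal_op V v x = (LINT y|U. (\<Sum>l\<in>L. \<beta> l * (V (x \<bullet> y) * poly (geg ?N l) (e \<bullet> y))))"
      unfolding zonal_op_def v_def by (simp add: sum_distrib_left mult.left_commute)
    also have "\<dots> = (\<Sum>l\<in>L. LINT y|U. \<beta> l * (V (x \<bullet> y) * poly (geg ?N l) (e \<bullet> y)))"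
      by (intro Bochner_Integration.integral_sum integrable_mult_right integrable_zonal_op[OF Vc]
          bounded_on_sphere_continuous continuous_intros)
    also have "\<dots> = (\<Sum>l\<in>L. \<beta> l * (- lam * poly (geg ?N l) (e \<bullet> x)))"
    proof (intro sum.cong refl)
      fix l assume "l \<in> L"
      then have "gegenbauer_coeff ?N V l = - lam" using L(2) by (auto simp: coeff lam_def)
      then show "(LINT y|U. \<beta> l * (V (x \<bullet> y) * poly (geg ?N l) (e \<bullet> y))) = \<beta> l * (- lam * poly (geg ?N l) (e \<bullet> x))"
        using funk_hecke[OF dim Vc _ e, of x l] x by (simp add: inner_commute[of x e])
    qed
    also have "\<dots> = - lam * v x" by (simp add: v_def sum_distrib_left sum_negf mult.left_commute)
    finally show ?thesis .
  qed
  have v2: "pairing v v = - lam * (LINT x|U. (v x)\<^sup>2)"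
  proof -
    have "pairing v v = (LINT x|U. - lam * (v x)\<^sup>2)"
      unfolding pairing_def pot
      by (intro Bochner_Integration.integral_cong refl) (simp add: Tv space_uniform_sphere power2_eq_square)
    then show ?thesis by simp
  qed
  have v3': "(LINT x|U. v x ^ 3) \<noteq> 0"
  proof -
    have s: "sets U = sets surface_measure" by (simp add: uniform_sphere_def)
    have "v \<in> borel_measurable U" using vb by (simp add: bounded_on_sphere_def)
    then have [measurable]: "v \<in> borel_measurable surface_measure"
      by (subst measurable_cong_sets[OF s[symmetric] refl])
    have a: "sphere_area TYPE('n) > 0" by (rule sphere_area_pos)
    have "(LINT x|U. v x ^ 3) = (LINT x|surface_measure. (1 / sphere_area TYPE('n)) *\<^sub>R v x ^ 3)"
      unfolding uniform_sphere_eq_density using a by (intro integral_density) auto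
    then show ?thesis using v3 a by (simp add: veq)
  qed
  have lower: "- lam * (LINT x|U. (u x)\<^sup>2) - B * (LINT x|U. u x)\<^sup>2 \<le> pairing u u"
    if "u \<in> borel_measurable U" "\<And>x. \<bar>u x\<bar> \<le> 1" for u
    unfolding pairing_def pot by (rule zonal_quadratic_form_lower[OF dim Vc VB lam low that])
  have "v \<in> borel_measurable U" using vb by (simp add: bounded_on_sphere_def)
  then obtain \<gamma>c \<gamma>1 \<eta> where \<gamma>: "0 < \<gamma>c" "\<gamma>c < \<gamma>1" "\<gamma>1 < 1 / lam" "0 < \<eta>"
    "uniform_minimal \<gamma>c" "\<And>\<gamma>. \<gamma> > \<gamma>c \<Longrightarrow> \<not> uniform_minimal \<gamma>"
    "\<And>\<gamma> \<rho>. \<gamma>c < \<gamma> \<Longrightarrow> \<gamma> \<le> \<gamma>1 \<Longrightarrow> finite_entropy_density \<rho> \<Longrightarrow> energy \<gamma> \<rho> < c0 / 2 \<Longrightarrow>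
      \<eta> \<le> (LINT x|U. \<bar>\<rho> x - 1\<bar>)"
    using discontinuous_transition[OF lam B_nonneg lower _ _ v_mean v2 v3', of Vb] Vb
    by (metis space_uniform_sphere)
  have "transition_point K \<gamma>c"
    by (rule transition_pointI[OF \<gamma>(1,5)]) (rule \<gamma>(6))
  moreover have "\<not> continuous_transition_point K \<gamma>c"
    by (rule not_continuous_transition_pointI[OF \<gamma>(1,2,4)]) (use \<gamma>(6,7) in blast)+
  ultimately have "discontinuous_transition_point K \<gamma>c"
    unfolding discontinuous_transition_point_def by blast
  moreover have "\<gamma>c < - 1 / gegenbauer_coeff ?N W k" using \<gamma>(2,3) by (simp add: lam_def)
  ultimately show ?thesis using \<gamma>(1) by blast
qed

end
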